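(* Let $p>2$ be a prime. There exist infinitely many pairwise non-isomorphic quartic del Pezzo surfaces $X$ over $\mathbb{F}_p(t)$ such that $X(K)=\varnothing$ for every quadratic field extension $K/\mathbb{F}_p(t)$.
   Context: A quartic del Pezzo surface over a field $k$ is a smooth, projective, geometrically integral surface with ample anticanonical sheaf and $K_X^2=4$; equivalently, a smooth complete intersection of two quadrics in $\mathbb{P}^4_k$. *)

theory Defs
  imports
    "HOL-Analysis.Cartesian_Space"
    "HOL-Library.Poly_Mapping"
    "HOL-Library.Numeral_Type"
    "HOL-Algebra.Algebraic_Closure_Type"
    "HOL-Algebra.Embedded_Algebras"
    "HOL-Computational_Algebra.Fraction_Field"
    "Berlekamp_Zassenhaus.Finite_Field"
begin

text \<open>Polynomials in five variables, indexed by the type \<open>5\<close>: finitely supported maps from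
  exponent vectors to coefficients.\<close>

type_synonym 'a poly5 = "(5 \<Rightarrow>\<^sub>0 nat) \<Rightarrow>\<^sub>0 'a"

definition homogeneous :: "nat \<Rightarrow> 'a::zero poly5 \<Rightarrow> bool" where
  "homogeneous d F \<longleftrightarrow>
     (\<forall>m\<in>Poly_Mapping.keys F. (\<Sum>i\<in>UNIV. Poly_Mapping.lookup m i) = d)"

definition eval5 :: "'k::field poly5 \<Rightarrow> 'k alg_closure ^ 5 \<Rightarrow> 'k alg_closure" where
  "eval5 F x = (\<Sum>m\<in>Poly_Mapping.keys F.
     to_ac (Poly_Mapping.lookup F m) * (\<Prod>i\<in>UNIV. x $ i ^ Poly_Mapping.lookup m i))"

definition partial :: "5 \<Rightarrow> 'a::comm_ring_1 poly5 \<Rightarrow> 'a poly5" where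
  "partial i F = (\<Sum>m\<in>Poly_Mapping.keys F.
     Poly_Mapping.single (m - Poly_Mapping.single i 1)
       (of_nat (Poly_Mapping.lookup m i) * Poly_Mapping.lookup F m))"

definition gradient :: "'k::field poly5 \<Rightarrow> 'k alg_closure ^ 5 \<Rightarrow> 'k alg_closure ^ 5" where
  "gradient F x = (\<chi> i. eval5 (partial i F) x)"

text \<open>A point of projective space with homogeneous coordinates \<open>x \<noteq> 0\<close> is the set of all nonzero
  multiples of \<open>x\<close>.\<close>

definition proj_point :: "'a::field ^ 5 \<Rightarrow> ('a ^ 5) set" where
  "proj_point x = {c *s x | c. c \<noteq> 0}"

text \<open>A pair \<open>V = (Q\<^sub>1, Q\<^sub>2)\<close> of polynomials stands for the closed subscheme \<open>Q\<^sub>1 = Q\<^sub>2 = 0\<close>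
  of \<open>\<bbbP>\<^sup>4\<close> over the field \<open>'k\<close>.  For an intermediate field \<open>L\<close> of \<open>'k alg_closure\<close> over \<open>'k\<close>,
  \<open>points V L\<close> is the set of \<open>L\<close>-rational points \<open>V(L)\<close>.\<close>

definition points ::
  "'k::field poly5 \<times> 'k poly5 \<Rightarrow> 'k alg_closure set \<Rightarrow> ('k alg_closure ^ 5) set set" where
  "points V L = {proj_point x | x. x \<noteq> 0 \<and> (\<forall>i. x $ i \<in> L) \<and>
                   eval5 (fst V) x = 0 \<and> eval5 (snd V) x = 0}"

abbreviation geom_points ::
  "'k::field poly5 \<times> 'k poly5 \<Rightarrow> ('k alg_closure ^ 5) set set" where
  "geom_points V \<equiv> points V UNIV"

text \<open>A quartic del Pezzo surface, as a smooth complete intersection of two quadrics in \<open>\<bbbP>\<^sup>4\<close>.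
  Smoothness is the Jacobian criterion at all geometric points.  Since two quadrics in \<open>\<bbbP>\<^sup>4\<close> have a
  common geometric point, rank 2 also forces both forms to be nonzero and the intersection to have
  codimension 2; such a scheme is automatically geometrically integral.\<close>

definition quartic_del_pezzo :: "'k::field poly5 \<times> 'k poly5 \<Rightarrow> bool" where
  "quartic_del_pezzo V \<longleftrightarrow>
     homogeneous 2 (fst V) \<and> homogeneous 2 (snd V) \<and>
     (\<forall>x. proj_point x \<in> geom_points V \<longrightarrow>
        rank (vector [gradient (fst V) x, gradient (snd V) x] :: 'k alg_closure ^ 5 ^ 2) = 2)"

text \<open>Morphisms over \<open>'k\<close>, described on geometric points: locally around each geometric point they
  are given by five forms of the same degree with coefficients in \<open>'k\<close>.  For geometrically integral
  \<open>V\<close> these are exactly the morphisms of \<open>'k\<close>-schemes from \<open>V\<close> to \<open>W\<close>, and two of the local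
  descriptions agree wherever both are defined.\<close>

definition morphism ::
  "'k::field poly5 \<times> 'k poly5 \<Rightarrow> 'k poly5 \<times> 'k poly5 \<Rightarrow>
     (('k alg_closure ^ 5) set \<Rightarrow> ('k alg_closure ^ 5) set) \<Rightarrow> bool" where
  "morphism V W f \<longleftrightarrow>
     f ` geom_points V \<subseteq> geom_points W \<and>
     (\<forall>x. proj_point x \<in> geom_points V \<longrightarrow>
        (\<exists>d (F :: 5 \<Rightarrow> 'k poly5). (\<forall>i. homogeneous d (F i)) \<and>
           (\<chi> i. eval5 (F i) x) \<noteq> 0 \<and>
           (\<forall>y. proj_point y \<in> geom_points V \<longrightarrow> (\<chi> i. eval5 (F i) y) \<noteq> 0 \<longrightarrow>
              f (proj_point y) = proj_point (\<chi> i. eval5 (F i) y))))"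

definition isomorphic :: "'k::field poly5 \<times> 'k poly5 \<Rightarrow> 'k poly5 \<times> 'k poly5 \<Rightarrow> bool" where
  "isomorphic V W \<longleftrightarrow> (\<exists>f g. morphism V W f \<and> morphism W V g \<and>
     (\<forall>P\<in>geom_points V. g (f P) = P) \<and> (\<forall>P\<in>geom_points W. f (g P) = P))"

text \<open>Every quadratic extension of \<open>'k\<close> is isomorphic over \<open>'k\<close> to a subfield of the algebraic
  closure.\<close>

definition quadratic_extension :: "'k::field alg_closure set \<Rightarrow> bool" where
  "quadratic_extension K \<longleftrightarrow>
     subfield K ring_of_type_algebra \<and> range (to_ac :: 'k \<Rightarrow> 'k alg_closure) \<subseteq> K \<and>
     ring.dimension ring_of_type_algebra 2 (range (to_ac :: 'k \<Rightarrow> 'k alg_closure)) K"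

text \<open>The rational function field \<open>\<bbbF>\<^sub>p(t)\<close>, where \<open>p\<close> is the cardinality of the type \<open>'p\<close>.\<close>

type_synonym 'p ratfun = "'p mod_ring poly fract"

end

theory Submission
  imports Defs "HOL-Computational_Algebra.Polynomial_Factorial"
    "HOL-Computational_Algebra.Squarefree"
begin

text \<open>Over \<open>k = \<bbbF>\<^sub>p(t)\<close> fix constants \<open>c, d \<in> \<bbbF>\<^sub>p\<close>, both nonsquare, with \<open>c + d = 1\<close>.  For a squarefree
  polynomial \<open>T\<close> of odd degree with \<open>s = 1 - c d T\<close> squarefree, take the surface \<open>A = B = 0\<close> with
  \<open>A = Y\<^sup>2 - c T (c U\<^sup>2 + 2 s U V + c T s V\<^sup>2) - c T ((d T - 1) W\<^sup>2 - 2 s W Z - s Z\<^sup>2)\<close> and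
  \<open>B = c (U\<^sup>2 - T s V\<^sup>2 - d T W\<^sup>2 + d T s Z\<^sup>2)\<close>.

  The line through a quadratic point and its conjugate is defined over \<open>k\<close> and lies on some quadric of
  the pencil spanned by \<open>A\<close> and \<open>B\<close>, so it suffices that no member of the pencil contains a
  \<open>k\<close>-line.  For \<open>B\<close> this is a local condition at a prime of odd degree dividing \<open>s\<close>.  For \<open>A - l B\<close>
  put \<open>g = l\<^sup>2 + T - c T\<^sup>2\<close>: the numerator of \<open>g\<close> has even degree, because it is a norm from the
  constant quadratic extension up to lower terms, so some prime of odd degree divides \<open>s g\<close> to an odd
  power.  At such a prime \<open>c\<close> remains a nonsquare, and the valuations of the coefficients of a diagonal
  form of \<open>A - l B\<close> exclude a totally isotropic plane.

  Such a surface has no point over a biquadratic field that splits at a prime of odd degree dividing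
  \<open>T\<close>, but it does have points over explicit biquadratic fields.  Choosing each new \<open>T\<close> so that its
  biquadratic field splits at all primes dividing the earlier ones makes the surfaces pairwise
  non-isomorphic.\<close>

section \<open>Discrete valuations and local square classes\<close>

text \<open>On the line through a quadratic point and its conjugate, \<open>A\<close> and
  \<open>B\<close> restrict to binary quadratic forms with the same two zeros. Such forms are
  proportional, which is why some member of the pencil contains the line. The obstacle is that the
  member is not known in advance: each of the infinitely many \<open>l\<close> needs its own prime.
  Parity of degree finds one, and because its degree is odd, the residue field is an extension of
  odd degree of the constants, where \<open>c\<close> and \<open>d\<close> stay nonsquare. The form
  \<open>A - l B\<close> consists of two binary blocks and a square. The relation
  \<open>c + d = 1\<close> makes the block determinants, up to simple factors, \<open>g\<close> and
  \<open>h = g - T (l - c T)\<close>, so a prime chosen for \<open>g\<close> also controls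
  \<open>h\<close>. As \<open>c d\<close> is a square, \<open>T\<close> becomes a local square at
  every prime dividing \<open>s\<close>. Points of the surface appear after adjoining two square
  roots, hence biquadratic fields. There are two recipes for them, according to whether 2 is a
  square among the constants. Local statements are proved by descent and by square roots modulo
  prime powers.\<close>

locale valuation =
  fixes v :: "'k::field \<Rightarrow> int"
  assumes v_mult: "x \<noteq> 0 \<Longrightarrow> y \<noteq> 0 \<Longrightarrow> v (x * y) = v x + v y"
    and v_add: "x \<noteq> 0 \<Longrightarrow> y \<noteq> 0 \<Longrightarrow> x + y \<noteq> 0 \<Longrightarrow> min (v x) (v y) \<le> v (x + y)"
    and two_nonzero: "(2::'k) \<noteq> 0"
    and v_two: "v 2 = 0"
begin

definition vge :: "int \<Rightarrow> 'k \<Rightarrow> bool" where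
  "vge n x \<longleftrightarrow> x = 0 \<or> n \<le> v x"

lemma v_one [simp]: "v 1 = 0"
  using v_mult[of 1 1] by simp

lemma v_power: "x \<noteq> 0 \<Longrightarrow> v (x ^ n) = int n * v x"
  by (induction n) (auto simp: v_mult algebra_simps)

lemma v_minus_one [simp]: "v (- 1) = 0"
  using v_mult[of "-1" "-1"] by simp

lemma v_minus [simp]: "v (- x) = v x"
proof (cases "x = 0")
  case False
  then show ?thesis using v_mult[of "-1" x] by simp
qed simp

lemma v_inverse: "x \<noteq> 0 \<Longrightarrow> v (inverse x) = - v x"
  using v_mult[of x "inverse x"] by simp

lemma vge_0 [simp]: "vge n 0"
  by (simp add: vge_def)

lemma vge_minus [simp]: "vge n (- x) \<longleftrightarrow> vge n x"
  by (simp add: vge_def)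

lemma vge_add: "vge n x \<Longrightarrow> vge n y \<Longrightarrow> vge n (x + y)"
  using v_add[of x y] unfolding vge_def by (cases "x = 0"; cases "y = 0"; cases "x + y = 0") auto

lemma vge_diff: "vge n x \<Longrightarrow> vge n y \<Longrightarrow> vge n (x - y)"
  using vge_add[of n x "- y"] by simp

lemma vge_mult: "vge m x \<Longrightarrow> vge n y \<Longrightarrow> vge (m + n) (x * y)"
  unfolding vge_def by (cases "x = 0"; cases "y = 0") (auto simp: v_mult)

lemma vge_mult0: "vge 0 x \<Longrightarrow> vge n y \<Longrightarrow> vge n (x * y)"
  using vge_mult[of 0 x n y] by simp

lemma vge_mult0': "vge n x \<Longrightarrow> vge 0 y \<Longrightarrow> vge n (x * y)"
  using vge_mult[of n x 0 y] by simp

lemma vge_mono: "vge n x \<Longrightarrow> m \<le> n \<Longrightarrow> vge m x"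
  unfolding vge_def by auto

lemma vge_self: "vge (v x) x"
  by (simp add: vge_def)

lemma vge_not: "x \<noteq> 0 \<Longrightarrow> \<not> vge (v x + 1) x"
  by (simp add: vge_def)

lemma vge_one: "vge 0 1"
  by (simp add: vge_def)

lemma vge_two: "vge n (2 * x) \<longleftrightarrow> vge n x"
  unfolding vge_def using two_nonzero by (cases "x = 0") (auto simp: v_mult v_two)

lemma vge_power2: "vge n x \<Longrightarrow> vge (2 * n) (x\<^sup>2)"
  using vge_mult[of n x n x] by (simp add: power2_eq_square)

text \<open>A summand of strictly smaller valuation dominates the sum. The valuations of
  \<open>g\<close>, \<open>h\<close>, \<open>u\<close> and \<open>w\<close> are later read off by
  isolating such a summand.\<close>

lemma v_near:
  assumes "x \<noteq> 0" "vge (v x + 1) e"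
  shows "x + e \<noteq> 0" "v (x + e) = v x"
proof -
  show ne: "x + e \<noteq> 0"
  proof
    assume "x + e = 0"
    then have "e = - x" by (simp add: eq_neg_iff_add_eq_0 add.commute)
    then show False using assms vge_not[of x] by simp
  qed
  show "v (x + e) = v x"
  proof (cases "e = 0")
    case False
    then have "v x < v e" using assms by (simp add: vge_def)
    have "v x \<le> v (x + e)" using v_add[OF assms(1) False ne] \<open>v x < v e\<close> by simp
    moreover have "min (v (x + e)) (v (- e)) \<le> v (x + e + - e)"
      by (rule v_add) (use ne False assms in auto)
    ultimately show ?thesis using \<open>v x < v e\<close> by auto
  qed simp
qed

text \<open>As \<open>2\<close> is a unit, by Hensel's lemma \<open>sim x y\<close> says that \<open>x\<close> and \<open>y\<close> have the same square class in
  the completion; the completion itself is never needed.\<close>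

definition sim :: "'k \<Rightarrow> 'k \<Rightarrow> bool" where
  "sim x y \<longleftrightarrow> x \<noteq> 0 \<and> y \<noteq> 0 \<and> (\<exists>z. z \<noteq> 0 \<and> vge (v x + 1) (x - y * z\<^sup>2))"

lemma simD: "sim x y \<Longrightarrow> x \<noteq> 0" "sim x y \<Longrightarrow> y \<noteq> 0"
  by (auto simp: sim_def)

lemma simE:
  assumes "sim x y"
  obtains z where "z \<noteq> 0" "vge (v x + 1) (x - y * z\<^sup>2)" "v x = v y + 2 * v z" "x \<noteq> 0" "y \<noteq> 0"
proof -
  obtain z where z: "z \<noteq> 0" "vge (v x + 1) (x - y * z\<^sup>2)" "x \<noteq> 0" "y \<noteq> 0"
    using assms unfolding sim_def by auto
  have "vge (v x + 1) (y * z\<^sup>2 - x)"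
    using z(2) vge_minus[of _ "x - y * z\<^sup>2"] by simp
  from v_near(2)[OF z(3) this] have "v (y * z\<^sup>2) = v x" by simp
  then have "v x = v y + 2 * v z" using z by (simp add: v_mult v_power)
  then show thesis by (rule that[OF z(1,2) _ z(3,4)])
qed

lemma sim_parity: "sim x y \<Longrightarrow> even (v x) \<longleftrightarrow> even (v y)"
  by (erule simE) auto

lemma sim_sq: "x \<noteq> 0 \<Longrightarrow> z \<noteq> 0 \<Longrightarrow> sim (x * z\<^sup>2) x"
  unfolding sim_def by (intro conjI exI[of _ z]) auto

lemma sim_refl: "x \<noteq> 0 \<Longrightarrow> sim x x"
  using sim_sq[of x 1] by simp

lemma sim_near: "x \<noteq> 0 \<Longrightarrow> vge (v x + 1) (y - x) \<Longrightarrow> sim y x"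
proof -
  assume a: "x \<noteq> 0" "vge (v x + 1) (y - x)"
  from v_near[OF a] have "y \<noteq> 0" "v y = v x" by auto
  then show ?thesis unfolding sim_def using a by (intro conjI exI[of _ 1]) auto
qed

lemma sim_sym: assumes "sim x y" shows "sim y x"
proof -
  obtain z where z: "z \<noteq> 0" "vge (v x + 1) (x - y * z\<^sup>2)" "v x = v y + 2 * v z" "x \<noteq> 0" "y \<noteq> 0"
    using assms by (rule simE)
  have "vge (v y + 1) (y - x * (inverse z)\<^sup>2)"
  proof -
    have "y - x * (inverse z)\<^sup>2 = - (x - y * z\<^sup>2) * (inverse z)\<^sup>2"
      using z(1) by (simp add: field_simps)
    moreover have "vge (2 * v (inverse z)) ((inverse z)\<^sup>2)"
      by (rule vge_power2, rule vge_self)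
    ultimately have "vge (v x + 1 + 2 * v (inverse z)) (y - x * (inverse z)\<^sup>2)"
      using vge_mult[of "v x + 1" "- (x - y * z\<^sup>2)" "2 * v (inverse z)" "(inverse z)\<^sup>2"] z(2)
      by (simp only: vge_minus)
    then show ?thesis using z by (simp add: v_inverse)
  qed
  then show ?thesis using z unfolding sim_def by (intro conjI exI[of _ "inverse z"]) auto
qed

lemma sim_mult: assumes "sim x y" "sim x' y'" shows "sim (x * x') (y * y')"
proof -
  obtain z where z: "z \<noteq> 0" "vge (v x + 1) (x - y * z\<^sup>2)" "v x = v y + 2 * v z" "x \<noteq> 0" "y \<noteq> 0"
    using assms(1) by (rule simE)
  obtain w where w: "w \<noteq> 0" "vge (v x' + 1) (x' - y' * w\<^sup>2)" "v x' = v y' + 2 * v w" "x' \<noteq> 0" "y' \<noteq> 0"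
    using assms(2) by (rule simE)
  have eq: "x * x' - y * y' * (z * w)\<^sup>2 = (x - y * z\<^sup>2) * x' + (y * z\<^sup>2) * (x' - y' * w\<^sup>2)"
    by (simp add: algebra_simps power_mult_distrib)
  have "vge (v x + 1 + v x') ((x - y * z\<^sup>2) * x')"
    by (rule vge_mult[OF z(2) vge_self])
  moreover have "vge (v (y * z\<^sup>2) + (v x' + 1)) ((y * z\<^sup>2) * (x' - y' * w\<^sup>2))"
    by (rule vge_mult[OF vge_self w(2)])
  moreover have "v (y * z\<^sup>2) = v x" using z by (simp add: v_mult v_power)
  ultimately have "vge (v (x * x') + 1) (x * x' - y * y' * (z * w)\<^sup>2)"
    unfolding eq using z w by (intro vge_add) (auto simp: v_mult algebra_simps)
  then show ?thesis using z w unfolding sim_def by (intro conjI exI[of _ "z * w"]) auto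
qed

lemma sim_cancel_sq: assumes "sim (x * z\<^sup>2) y" shows "sim x y"
proof -
  have nz: "x \<noteq> 0" "z \<noteq> 0" using simD(1)[OF assms] by auto
  have "sim (x * z\<^sup>2 * (inverse z)\<^sup>2) y"
  proof -
    obtain w where w: "w \<noteq> 0" "vge (v (x*z\<^sup>2) + 1) (x*z\<^sup>2 - y * w\<^sup>2)" "y \<noteq> 0"
      using assms by (rule simE)
    have "x*z\<^sup>2*(inverse z)\<^sup>2 - y * (w * inverse z)\<^sup>2 = (x*z\<^sup>2 - y * w\<^sup>2) * (inverse z)\<^sup>2"
      by (simp add: algebra_simps power_mult_distrib)
    moreover have "vge (v (x*z\<^sup>2) + 1 + 2 * v (inverse z)) ((x*z\<^sup>2 - y * w\<^sup>2) * (inverse z)\<^sup>2)"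
      by (intro vge_mult w vge_power2 vge_self)
    ultimately show ?thesis unfolding sim_def using w nz
      by (intro conjI exI[of _ "w * inverse z"]) (auto simp: v_mult v_power v_inverse algebra_simps)
  qed
  moreover have "x * z\<^sup>2 * (inverse z)\<^sup>2 = x" using nz by (simp add: field_simps)
  ultimately show ?thesis by simp
qed

lemma sim_one_iff: "x \<noteq> 0 \<Longrightarrow> y \<noteq> 0 \<Longrightarrow> sim x y \<longleftrightarrow> sim (x * y) 1"
proof
  assume nz: "x \<noteq> 0" "y \<noteq> 0" and "sim (x * y) 1"
  from sim_mult[OF this(3) sim_refl[OF nz(2)]] have "sim (x * y\<^sup>2) y"
    by (simp add: power2_eq_square mult.assoc)
  then show "sim x y" by (rule sim_cancel_sq)
next
  assume nz: "x \<noteq> 0" "y \<noteq> 0" and "sim x y"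
  from sim_sym[OF sim_mult[OF this(3) sim_refl[OF nz(2)]]] have "sim (1 * y\<^sup>2) (x * y)"
    by (simp add: power2_eq_square)
  from sim_cancel_sq[OF this] have "sim 1 (x * y)" .
  then show "sim (x * y) 1" by (rule sim_sym)
qed

text \<open>Square classes have exponent two, so the relation can be tested on products. Multiplying
  the two products leaves \<open>x * z * y\<^sup>2\<close>, where the square cancels.\<close>

lemma sim_trans: assumes "sim x y" "sim y z" shows "sim x z"
proof -
  have nz: "x \<noteq> 0" "y \<noteq> 0" "z \<noteq> 0" using assms simD by blast+
  have "sim ((x * y) * (y * z)) (1 * 1)"
    using assms nz sim_one_iff[THEN iffD1] by (intro sim_mult) blast+
  then have "sim ((x * z) * y\<^sup>2) 1" by (simp add: power2_eq_square ac_simps)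
  then have "sim (x * z) 1" by (rule sim_cancel_sq)
  then show ?thesis by (rule sim_one_iff[OF nz(1,3), THEN iffD2])
qed

text \<open>A sum of larger valuation than a summand means that the leading parts cancel. Then
  \<open>x\<close> and \<open>- y\<close> agree to first order, and \<open>- (x * y)\<close> would
  be a local square.\<close>

lemma vge_sum_aniso:
  assumes "x \<noteq> 0" "y \<noteq> 0" "\<not> sim (- (x * y)) 1" "vge n (x + y)"
  shows "vge n x \<and> vge n y"
proof (rule ccontr)
  assume neg: "\<not> (vge n x \<and> vge n y)"
  have "vge (v x + 1) (x - (-y))"
  proof (cases "vge n x")
    case True
    then have "vge n (x + y - x)" using assms(4) by (intro vge_diff) auto
    then show ?thesis using neg True by simp
  next
    case False
    then have "v x + 1 \<le> n" using assms(1) by (simp add: vge_def)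
    then show ?thesis using assms(4) vge_mono by simp
  qed
  then have "sim x (- y)" using assms unfolding sim_def by (intro conjI exI[of _ 1]) auto
  then have "sim (x * - y) 1" using assms by (subst sim_one_iff[symmetric]) auto
  then show False using assms(3) by simp
qed

text \<open>The hypothesis says that the binary form <q, r> is anisotropic over the completion, so
  its two terms never cancel. Together with parity of valuations this drives all descents
  below.\<close>

lemma vge_sum_aniso_sq:
  assumes "q \<noteq> 0" "r \<noteq> 0" "\<not> sim (- (q * r)) 1" "vge n (q * x\<^sup>2 + r * y\<^sup>2)"
  shows "vge n (q * x\<^sup>2) \<and> vge n (r * y\<^sup>2)"
proof (cases "x = 0 \<or> y = 0")
  case False
  show ?thesis
  proof (rule vge_sum_aniso)
    show "\<not> sim (- (q * x\<^sup>2 * (r * y\<^sup>2))) 1"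
    proof
      assume "sim (- (q * x\<^sup>2 * (r * y\<^sup>2))) 1"
      then have "sim (- (q * r) * (x * y)\<^sup>2) 1"
        by (simp add: power_mult_distrib ac_simps)
      from sim_cancel_sq[OF this] show False using assms by simp
    qed
  qed (use assms False in auto)
qed (use assms in auto)

lemma vge_all_zero: assumes "\<And>n. vge n x" shows "x = 0"
  using assms[of "v x + 1"] by (auto simp: vge_def)

text \<open>The gain in each descent: an element whose valuation has the wrong parity cannot sit
  exactly at the bound.\<close>

lemma vge_parity:
  assumes "x \<noteq> 0 \<Longrightarrow> odd (v x - n)" "vge n x"
  shows "vge (n + 1) x"
  using assms unfolding vge_def by (cases "v x = n") auto

lemma least_vge:
  assumes "finite S" "S \<noteq> {}" "0 \<notin> S"
  obtains m where "m \<in> S" "\<forall>x\<in>S. vge (v m) x"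
proof -
  obtain m where "m \<in> S" "\<forall>x\<in>S. v m \<le> v x"
  proof -
    have "Min (v ` S) \<in> v ` S" using assms by (intro Min_in) auto
    then obtain m where "m \<in> S" "v m = Min (v ` S)" by auto
    then show thesis using that[of m] assms by auto
  qed
  then show thesis using that by (auto simp: vge_def)
qed

end

section \<open>Totally isotropic planes of diagonal forms\<close>

definition isotropic_plane :: "(nat \<Rightarrow> 'k::field) \<Rightarrow> bool" where
  "isotropic_plane q \<longleftrightarrow> (\<exists>x y. (\<exists>i<5. \<exists>j<5. x i * y j \<noteq> x j * y i) \<and>
     (\<Sum>i<5. q i * (x i)\<^sup>2) = 0 \<and> (\<Sum>i<5. q i * (x i * y i)) = 0 \<and> (\<Sum>i<5. q i * (y i)\<^sup>2) = 0)"

text \<open>The \<open>p i j\<close> are the Pluecker coordinates of the plane. The sum of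
  \<open>q j * (p i j)\<^sup>2\<close> over \<open>j\<close> is a combination of the three vanishing
  values of the form, which gives the zero row sums. Afterwards only the linear relations among the
  \<open>e i j\<close> matter, with the parity and square class of each entry known from
  \<open>q\<close>.\<close>

lemma isotropic_plane_minors:
  assumes "isotropic_plane q"
  obtains e p where "\<And>i j. e i j = q i * q j * (p i j)\<^sup>2" "\<And>i j. e i j = e j i" "\<And>i. e i i = 0"
    "\<And>i. i < 5 \<Longrightarrow> (\<Sum>j<5. e i j) = 0" "\<exists>i<5. \<exists>j<5. p i j \<noteq> 0" "\<And>i. p i i = 0"
    "\<And>i j. p j i = - p i j"
proof -
  obtain x y where nd: "\<exists>i<5. \<exists>j<5. x i * y j \<noteq> x j * y i" and
    Q: "(\<Sum>i<5. q i * (x i)\<^sup>2) = 0" "(\<Sum>i<5. q i * (x i * y i)) = 0" "(\<Sum>i<5. q i * (y i)\<^sup>2) = 0"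
    using assms unfolding isotropic_plane_def by blast
  define p where "p = (\<lambda>i j. x i * y j - x j * y i)"
  have "(\<Sum>j<5. q i * q j * (p i j)\<^sup>2) = 0" for i
  proof -
    have "(\<Sum>j<5. q i * q j * (p i j)\<^sup>2) = (\<Sum>j<5. q i * ((x i)\<^sup>2 * (q j * (y j)\<^sup>2)
        - 2 * x i * y i * (q j * (x j * y j)) + (y i)\<^sup>2 * (q j * (x j)\<^sup>2)))"
      by (intro sum.cong) (auto simp: p_def power2_eq_square algebra_simps)
    also have "\<dots> = q i * ((x i)\<^sup>2 * (\<Sum>j<5. q j * (y j)\<^sup>2) - 2 * x i * y i * (\<Sum>j<5. q j * (x j * y j))
        + (y i)\<^sup>2 * (\<Sum>j<5. q j * (x j)\<^sup>2))"
      by (simp only: sum.distrib sum_subtractf flip: sum_distrib_left)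
    finally show ?thesis using Q by simp
  qed
  moreover have "\<exists>i<5. \<exists>j<5. p i j \<noteq> 0" using nd by (auto simp: p_def)
  ultimately show thesis
    by (intro that[of "\<lambda>i j. q i * q j * (p i j)\<^sup>2" p]) (auto simp: p_def power2_eq_square algebra_simps)
qed

lemma sum_five:
  assumes "distinct [a, b, c, d, e]" "{a, b, c, d, e} = {..<5::nat}"
  shows "(\<Sum>i<5. f i) = f a + f b + f c + f d + (f e :: 'b::comm_monoid_add)"
  using assms(1) by (auto simp flip: assms(2) simp: add.assoc)

context valuation
begin

text \<open>By Springer's theorem the Witt index is the sum of the Witt indices of the two residue
  forms. The ternary one contributes at most 1, so a plane forces the binary one to be hyperbolic.
  The proof is a direct descent on the minors.\<close>

lemma isotropic_pair_triple:
  assumes iso: "isotropic_plane q" and nz: "\<And>i. i < 5 \<Longrightarrow> q i \<noteq> 0"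
    and abc: "distinct [a, b, c, d, e]" "{a, b, c, d, e} = {..<5}"
    and par: "even (v (q a)) = even (v (q b))" "even (v (q c)) \<noteq> even (v (q a))"
      "even (v (q d)) = even (v (q c))" "even (v (q e)) = even (v (q c))"
  shows "sim (- (q a * q b)) 1"
proof (rule ccontr)
  assume aniso: "\<not> sim (- (q a * q b)) 1"
  obtain m p where mp: "\<And>i j. m i j = q i * q j * (p i j)\<^sup>2" and sym: "\<And>i j. m i j = m j i"
    and diag: "\<And>i. m i i = 0"
    and row: "\<And>i. i < 5 \<Longrightarrow> (\<Sum>j<5. m i j) = 0" and ex: "\<exists>i<5. \<exists>j<5. p i j \<noteq> 0"
    and pii: "\<And>i. p i i = 0" and pji: "\<And>i j. p j i = - p i j"
    by (rule isotropic_plane_minors[OF iso], rule that)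
  have lt: "a < 5" "b < 5" "c < 5" "d < 5" "e < 5" using abc(2) by auto
  have qn: "q a \<noteq> 0" "q b \<noteq> 0" "q c \<noteq> 0" "q d \<noteq> 0" "q e \<noteq> 0" using lt nz by auto
  have row': "m i a + m i b + m i c + m i d + m i e = 0" if "i < 5" for i
    using row[OF that] by (simp only: sum_five[OF abc])
  have parm: "even (v (m i j)) \<longleftrightarrow> even (v (q i) + v (q j))" if "m i j \<noteq> 0" for i j
    using that unfolding mp by (auto simp: v_mult v_power)
  \<comment> \<open>Both entries contain the factor \<open>q j\<close>; without it their sum is a
    value of the anisotropic form <q a, q b>.\<close>
  have split: "vge n (m a j) \<and> vge n (m b j)" if "vge n (m a j + m b j)" "j \<in> {c, d, e}" for j n
  proof -
    have "q j \<noteq> 0" using that qn by auto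
    then have "vge (n - v (q j)) ((m a j + m b j) * inverse (q j))"
      using vge_mult[OF that(1) vge_self[of "inverse (q j)"]] by (simp add: v_inverse)
    moreover have "(m a j + m b j) * inverse (q j) = q a * (p a j)\<^sup>2 + q b * (p b j)\<^sup>2"
      using \<open>q j \<noteq> 0\<close> unfolding mp by (simp add: field_simps)
    ultimately have ab: "vge (n - v (q j)) (q a * (p a j)\<^sup>2) \<and> vge (n - v (q j)) (q b * (p b j)\<^sup>2)"
      using vge_sum_aniso_sq[OF qn(1,2) aniso] by simp
    have "vge (n - v (q j) + v (q j)) (q a * (p a j)\<^sup>2 * q j)"
       "vge (n - v (q j) + v (q j)) (q b * (p b j)\<^sup>2 * q j)"
      by (rule vge_mult[OF conjunct1[OF ab] vge_self] vge_mult[OF conjunct2[OF ab] vge_self])+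
    then show ?thesis unfolding mp by (simp add: ac_simps)
  qed
  define S where "S = {m c d, m c e, m d e} - {0}"
  have S0: "S = {}"
  proof (rule ccontr)
    assume "S \<noteq> {}"
    then obtain z where z: "z \<in> S" "\<forall>x\<in>S. vge (v z) x"
      using least_vge[of S] by (auto simp: S_def)
    define n where "n = v z"
    have "z \<noteq> 0" and zm: "z = m c d \<or> z = m c e \<or> z = m d e" using z by (auto simp: S_def)
    then have evn: "even n" unfolding n_def using parm[of c d] parm[of c e] parm[of d e] par by auto
    have all: "vge n (m c d)" "vge n (m c e)" "vge n (m d e)"
      using z(2) unfolding n_def S_def by (metis DiffI insertCI singletonD vge_0)+
    \<comment> \<open>Row \<open>j\<close> bounds the sum of the two mixed entries, anisotropy
      bounds each of them, and their odd valuation lifts the even bound \<open>n\<close> by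
      one.\<close>
    have up: "vge (n + 1) (m j k + m j l)" if jkl: "j \<in> {c, d, e}" and
      "m j a + m j b + m j k + m j l = 0" "vge n (m j k)" "vge n (m j l)" for j k l
    proof -
      have eq: "m a j + m b j = - (m j k + m j l)"
        using that(2) sym[of j a] sym[of j b] by Groebner_Basis.algebra
      have "vge n (m a j + m b j)" unfolding eq vge_minus by (rule vge_add[OF that(3,4)])
      from split[OF this jkl] have 1: "vge n (m a j)" "vge n (m b j)" by auto
      have up1: "vge (n + 1) (m i j)" if "i \<in> {a, b}" "vge n (m i j)" for i
        by (rule vge_parity[OF _ that(2)]) (use parm[of i j] that jkl par evn in auto)
      have "vge (n + 1) (m a j)" "vge (n + 1) (m b j)"
        using 1 by (auto intro: up1)
      from vge_add[OF this] show ?thesis unfolding eq vge_minus .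
    qed
    have u1: "vge (n + 1) (m c d + m c e)"
      by (rule up) (use row'[of c] lt diag all in \<open>auto simp: ac_simps\<close>)
    have u2: "vge (n + 1) (m d c + m d e)"
      by (rule up) (use row'[of d] lt diag all sym[of d c] in \<open>auto simp: ac_simps\<close>)
    have u3: "vge (n + 1) (m e c + m e d)"
      by (rule up) (use row'[of e] lt diag all sym[of e c] sym[of e d] in \<open>auto simp: ac_simps\<close>)
    \<comment> \<open>The three pairwise sums determine the three entries up to the unit 2, so even
      the entry of least valuation \<open>n\<close> lies above \<open>n\<close>.\<close>
    have "vge (n + 1) (2 * m c d)" "vge (n + 1) (2 * m c e)" "vge (n + 1) (2 * m d e)"
      using vge_diff[OF vge_add[OF u1 u2] u3] vge_diff[OF vge_add[OF u1 u3] u2] vge_diff[OF vge_add[OF u2 u3] u1]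
      by (simp_all add: sym[of d c] sym[of e c] sym[of e d])
    then have "vge (n + 1) z" using zm vge_two by auto
    then show False using vge_not[OF \<open>z \<noteq> 0\<close>] by (simp add: n_def)
  qed
  then have z0: "m c d = 0" "m c e = 0" "m d e = 0" by (auto simp: S_def)
  have z1: "m a j = 0 \<and> m b j = 0" if "j \<in> {c, d, e}" for j
  proof -
    have "m a j + m b j = 0"
      using that row'[of j] z0 lt diag sym[of j] by auto
    then show ?thesis using split[OF _ that] vge_all_zero by (metis vge_0)
  qed
  have "m a b = 0" using row'[of a] lt diag z1 by auto
  with z0 have z0: "m a b = 0" "m c d = 0" "m c e = 0" "m d e = 0" by auto
  have all0: "m i j = 0" if "i \<in> {a, b, c, d, e}" "j \<in> {a, b, c, d, e}" for i j
    using that z0 z1[of c] z1[of d] z1[of e] diag sym[of b a] sym[of c a] sym[of d a] sym[of e a]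
      sym[of c b] sym[of d b] sym[of e b] sym[of d c] sym[of e c] sym[of e d] by auto
  obtain i j where ij: "i < 5" "j < 5" "p i j \<noteq> 0" using ex by auto
  then have "m i j = 0" by (intro all0) (auto simp: abc(2))
  then show False using ij nz by (auto simp: mp)
qed

text \<open>Here one residue form has rank one and Witt index 0, so the quaternary one must have
  Witt index 2. It is then hyperbolic, and its discriminant is a square.\<close>

lemma isotropic_quadruple:
  assumes iso: "isotropic_plane q" and nz: "\<And>i. i < 5 \<Longrightarrow> q i \<noteq> 0"
    and abc: "distinct [a, b, c, d, e]" "{a, b, c, d, e} = {..<5}"
    and par: "even (v (q b)) = even (v (q a))" "even (v (q c)) = even (v (q a))"
      "even (v (q d)) = even (v (q a))" "even (v (q e)) \<noteq> even (v (q a))"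
  shows "sim (q a * q b * q c * q d) 1"
proof (rule ccontr)
  assume aniso: "\<not> sim (q a * q b * q c * q d) 1"
  obtain m p where mp: "\<And>i j. m i j = q i * q j * (p i j)\<^sup>2" and sym: "\<And>i j. m i j = m j i"
    and diag: "\<And>i. m i i = 0"
    and row: "\<And>i. i < 5 \<Longrightarrow> (\<Sum>j<5. m i j) = 0" and ex: "\<exists>i<5. \<exists>j<5. p i j \<noteq> 0"
    and pii: "\<And>i. p i i = 0" and pji: "\<And>i j. p j i = - p i j"
    by (rule isotropic_plane_minors[OF iso], rule that)
  have lt: "a < 5" "b < 5" "c < 5" "d < 5" "e < 5" using abc(2) by auto
  have qn: "q a \<noteq> 0" "q b \<noteq> 0" "q c \<noteq> 0" "q d \<noteq> 0" "q e \<noteq> 0" using lt nz by auto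
  have row': "m i a + m i b + m i c + m i d + m i e = 0" if "i < 5" for i
    using row[OF that] by (simp only: sum_five[OF abc])
  have parm: "even (v (m i j)) \<longleftrightarrow> even (v (q i) + v (q j))" if "m i j \<noteq> 0" for i j
    using that unfolding mp by (auto simp: v_mult v_power)
  \<comment> \<open>For complementary pairs, \<open>m i j - m k l\<close> is a value of the form <q
    i q j, - q k q l>, which is anisotropic because the product of the four coefficients is not a
    square.\<close>
  have split: "vge n (m i j) \<and> vge n (m k l)"
    if "q i * q j * q k * q l = q a * q b * q c * q d" "i < 5" "j < 5" "k < 5" "l < 5"
      "vge n (m i j - m k l)" for i j k l n
  proof -
    have "q i * q j * - (q k * q l) = - (q a * q b * q c * q d)"
      using that(1) by (simp add: mult.assoc)
    then have "\<not> sim (- (q i * q j * - (q k * q l))) 1" using aniso by simp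
    moreover have "vge n (q i * q j * (p i j)\<^sup>2 + - (q k * q l) * (p k l)\<^sup>2)"
      using that(6) by (simp add: mp)
    ultimately have "vge n (q i * q j * (p i j)\<^sup>2) \<and> vge n (- (q k * q l) * (p k l)\<^sup>2)"
      using nz that by (intro vge_sum_aniso_sq) auto
    then show ?thesis by (simp add: mp)
  qed
  have two0: "x = 0" if "2 * x = 0" for x :: 'k using that two_nonzero by simp
  \<comment> \<open>Rows \<open>a\<close> and \<open>b\<close>, minus rows \<open>c\<close> and
    \<open>d\<close>, plus row \<open>e\<close>; the other two identities arise by permuting
    \<open>b\<close>, \<open>c\<close>, \<open>d\<close>.\<close>
  have s1: "2 * (m a b - m c d + (m a e + m b e)) = 0"
    and s2: "2 * (m a c - m b d + (m a e + m c e)) = 0"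
    and s3: "2 * (m a d - m b c + (m a e + m d e)) = 0"
  proof -
    have R: "m a b + m a c + m a d + m a e = 0" "m a b + m b c + m b d + m b e = 0"
      "m a c + m b c + m c d + m c e = 0" "m a d + m b d + m c d + m d e = 0"
      "m a e + m b e + m c e + m d e = 0"
      using row'[OF lt(1)] row'[OF lt(2)] row'[OF lt(3)] row'[OF lt(4)] row'[OF lt(5)] diag
        sym[of b a] sym[of c a] sym[of c b] sym[of d a] sym[of d b] sym[of d c] sym[of e a]
        sym[of e b] sym[of e c] sym[of e d] by simp_all
    show "2 * (m a b - m c d + (m a e + m b e)) = 0"
      using R by Groebner_Basis.algebra
    show "2 * (m a c - m b d + (m a e + m c e)) = 0"
      using R by Groebner_Basis.algebra
    show "2 * (m a d - m b c + (m a e + m d e)) = 0"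
      using R by Groebner_Basis.algebra
  qed
  define S where "S = {m a e, m b e, m c e, m d e} - {0}"
  have pair: "vge n (m a b) \<and> vge n (m c d) \<and> vge n (m a c) \<and> vge n (m b d) \<and> vge n (m a d) \<and> vge n (m b c)"
    if "vge n (m a e)" "vge n (m b e)" "vge n (m c e)" "vge n (m d e)" for n
  proof -
    have "m a b - m c d = - (m a e + m b e)" "m a c - m b d = - (m a e + m c e)"
      "m a d - m b c = - (m a e + m d e)"
      using two0[OF s1] two0[OF s2] two0[OF s3] by Groebner_Basis.algebra+
    then have "vge n (m a b - m c d)" "vge n (m a c - m b d)" "vge n (m a d - m b c)"
      using that by (auto simp del: minus_add_distrib intro!: vge_add)
    then show ?thesis
      using split[of a b c d n] split[of a c b d n] split[of a d b c n] lt by (auto simp: ac_simps)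
  qed
  have S0: "S = {}"
  proof (rule ccontr)
    assume "S \<noteq> {}"
    then obtain z where z: "z \<in> S" "\<forall>x\<in>S. vge (v z) x"
      using least_vge[of S] by (auto simp: S_def)
    define n where "n = v z"
    have "z \<noteq> 0" and zm: "z = m a e \<or> z = m b e \<or> z = m c e \<or> z = m d e" using z by (auto simp: S_def)
    have oddn: "odd n" unfolding n_def using zm \<open>z \<noteq> 0\<close> parm[of a e] parm[of b e] parm[of c e] parm[of d e] par by auto
    have all: "vge n (m a e)" "vge n (m b e)" "vge n (m c e)" "vge n (m d e)"
      using z(2) unfolding n_def S_def by (metis DiffI insertCI singletonD vge_0)+
    have up: "vge (n + 1) (m i j)" if "vge n (m i j)" "i \<in> {a, b, c, d}" "j \<in> {a, b, c, d}" for i j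
      by (rule vge_parity[OF _ that(1)]) (use parm[of i j] that par oddn in auto)
    have big: "vge (n + 1) (m a b)" "vge (n + 1) (m c d)" "vge (n + 1) (m a c)"
      "vge (n + 1) (m b d)" "vge (n + 1) (m a d)" "vge (n + 1) (m b c)"
      using pair[OF all] by (auto intro: up)
    \<comment> \<open>Entries inside the quadruple have even valuation and so exceed the odd bound
      \<open>n\<close>. The row sums pass this gain back to the entries involving
      \<open>e\<close>.\<close>
    have "vge (n + 1) (- (m a b + m a c + m a d))" "vge (n + 1) (- (m a b + m b c + m b d))"
      "vge (n + 1) (- (m a c + m b c + m c d))" "vge (n + 1) (- (m a d + m b d + m c d))"
      using big by (auto simp del: minus_add_distrib intro!: vge_add)
    moreover have "m a e = - (m a b + m a c + m a d)" "m b e = - (m a b + m b c + m b d)"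
      "m c e = - (m a c + m b c + m c d)" "m d e = - (m a d + m b d + m c d)"
      using row'[OF lt(1)] row'[OF lt(2)] row'[OF lt(3)] row'[OF lt(4)] diag[of a] diag[of b] diag[of c] diag[of d]
        sym[of b a] sym[of c a] sym[of c b] sym[of d a] sym[of d b] sym[of d c]
      by Groebner_Basis.algebra+
    ultimately have "vge (n + 1) z" using zm by auto
    then show False using vge_not[OF \<open>z \<noteq> 0\<close>] by (simp add: n_def)
  qed
  then have z0: "m a e = 0" "m b e = 0" "m c e = 0" "m d e = 0" by (auto simp: S_def)
  have z1: "m a b = 0" "m c d = 0" "m a c = 0" "m b d = 0" "m a d = 0" "m b c = 0"
    using pair z0 vge_all_zero vge_0 by metis+
  then have all0: "m i j = 0" if "i \<in> {a, b, c, d, e}" "j \<in> {a, b, c, d, e}" for i j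
    using that z0 z1 diag sym by auto
  obtain i j where ij: "i < 5" "j < 5" "p i j \<noteq> 0" using ex by auto
  then have "m i j = 0" by (intro all0) (auto simp: abc(2))
  then show False using ij nz by (auto simp: mp)
qed

end

text \<open>A binary block that represents \<open>u\<close> is isometric to <u, u D>, where D is its
  determinant. The map \<open>N\<close> takes coordinates with respect to the vector
  \<open>(e, f)\<close> and its orthogonal complement. The representing vectors are left free so
  that each local argument can pick a value of convenient valuation.\<close>

lemma block_isotropic:
  fixes x y :: "nat \<Rightarrow> 'k::field"
  assumes nd: "\<exists>i<5. \<exists>j<5. x i * y j \<noteq> x j * y i"
    and xx: "P1 * (x 0)\<^sup>2 + 2 * P2 * (x 0 * x 1) + P3 * (x 1)\<^sup>2
        + (R1 * (x 2)\<^sup>2 + 2 * R2 * (x 2 * x 3) + R3 * (x 3)\<^sup>2) + (x 4)\<^sup>2 = 0"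
    and xy: "P1 * (x 0 * y 0) + P2 * (x 0 * y 1 + x 1 * y 0) + P3 * (x 1 * y 1)
        + (R1 * (x 2 * y 2) + R2 * (x 2 * y 3 + x 3 * y 2) + R3 * (x 3 * y 3)) + x 4 * y 4 = 0"
    and yy: "P1 * (y 0)\<^sup>2 + 2 * P2 * (y 0 * y 1) + P3 * (y 1)\<^sup>2
        + (R1 * (y 2)\<^sup>2 + 2 * R2 * (y 2 * y 3) + R3 * (y 3)\<^sup>2) + (y 4)\<^sup>2 = 0"
    and u: "u = P1 * e\<^sup>2 + 2 * P2 * (e * f) + P3 * f\<^sup>2" "u \<noteq> 0"
    and w: "w = R1 * m\<^sup>2 + 2 * R2 * (m * n) + R3 * n\<^sup>2" "w \<noteq> 0"
  shows "isotropic_plane (\<lambda>i. [u, u * (P1 * P3 - P2\<^sup>2), w, w * (R1 * R3 - R2\<^sup>2), 1] ! i)"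
proof -
  define N where "N = (\<lambda>x :: nat \<Rightarrow> 'k. \<lambda>i. [((P1 * e + P2 * f) * x 0 + (P2 * e + P3 * f) * x 1) / u,
     (e * x 1 - f * x 0) / u, ((R1 * m + R2 * n) * x 2 + (R2 * m + R3 * n) * x 3) / w,
     (m * x 3 - n * x 2) / w, x 4] ! i)"
  have Nlin: "N (\<lambda>i. a * x i + b * y i) i = a * N x i + b * N y i" if "i < 5" for a b x y i
  proof -
    have "i = 0 \<or> i = 1 \<or> i = 2 \<or> i = 3 \<or> i = 4" using that by auto
    then show ?thesis unfolding N_def using u(2) w(2)
      by (elim disjE) (simp_all add: field_simps)
  qed
  have Nzero: "x i = 0" if z: "\<And>i. i < 5 \<Longrightarrow> N x i = 0" and "i < 5" for x i
  proof -
    have 1: "(P1 * e + P2 * f) * x 0 + (P2 * e + P3 * f) * x 1 = 0" "e * x 1 - f * x 0 = 0"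
      "(R1 * m + R2 * n) * x 2 + (R2 * m + R3 * n) * x 3 = 0" "m * x 3 - n * x 2 = 0" "x 4 = 0"
      using z[of 0] z[of 1] z[of 2] z[of 3] z[of 4] u(2) w(2) by (simp_all add: N_def)
    have "u * x 0 = 0" "u * x 1 = 0" "w * x 2 = 0" "w * x 3 = 0"
      unfolding u(1) w(1) using 1(1-4) by Groebner_Basis.algebra+
    then have "x 0 = 0" "x 1 = 0" "x 2 = 0" "x 3 = 0" using u(2) w(2) by simp_all
    moreover have "i = 0 \<or> i = 1 \<or> i = 2 \<or> i = 3 \<or> i = 4" using that by auto
    ultimately show ?thesis using 1(5) by auto
  qed
  have nd': "\<exists>i<5. \<exists>j<5. N x i * N y j \<noteq> N x j * N y i"
  proof (rule ccontr)
    assume "\<not> ?thesis"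
    then have eq: "N x i * N y j = N x j * N y i" if "i < 5" "j < 5" for i j using that by blast
    obtain i j where ij: "i < 5" "j < 5" "x i * y j \<noteq> x j * y i" using nd by auto
    show False
    proof (cases "\<exists>l<5. N y l \<noteq> 0")
      case True
      then obtain l where l: "l < 5" "N y l \<noteq> 0" by auto
      have "N y l * x i + - N x l * y i = 0" if "i < 5" for i
      proof (rule Nzero[OF _ that])
        fix i :: nat assume "i < 5"
        then show "N (\<lambda>i. N y l * x i + - N x l * y i) i = 0"
          using eq[OF _ l(1)] by (simp only: Nlin) (simp add: mult.commute)
      qed
      from this[OF ij(1)] this[OF ij(2)] have "N y l * (x i * y j - x j * y i) = 0" by Groebner_Basis.algebra
      then show False using l ij by simp
    next
      case False
      have "y i = 0" if "i < 5" for i by (rule Nzero[of y]) (use False that in auto)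
      then show False using ij by simp
    qed
  qed
  have key: "u * (A / u * (B / u)) + u * D * (M / u * (M' / u)) = K"
    if "A * B + D * (M * M') = u * K" "u \<noteq> 0" for u A B D M M' K :: 'k
  proof -
    have "u * (A / u * (B / u)) + u * D * (M / u * (M' / u)) = (A * B + D * (M * M')) / u"
      using that(2) by (simp add: add_divide_distrib)
    then show ?thesis using that by simp
  qed
  have key': "u * (((P1 * e + P2 * f) * a + (P2 * e + P3 * f) * b) / u * (((P1 * e + P2 * f) * a' + (P2 * e + P3 * f) * b') / u))
     + u * (P1 * P3 - P2\<^sup>2) * ((e * b - f * a) / u * ((e * b' - f * a') / u))
     = P1 * (a * a') + P2 * (a * b' + b * a') + P3 * (b * b')"
    if "u = P1 * e\<^sup>2 + 2 * P2 * (e * f) + P3 * f\<^sup>2" "u \<noteq> 0" for u P1 P2 P3 e f a b a' b' :: 'k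
    by (rule key[OF _ that(2)]) (unfold that(1), Groebner_Basis.algebra)
  have form: "(\<Sum>i<5. [u, u * (P1 * P3 - P2\<^sup>2), w, w * (R1 * R3 - R2\<^sup>2), 1] ! i * (N x i * N y i))
     = P1 * (x 0 * y 0) + P2 * (x 0 * y 1 + x 1 * y 0) + P3 * (x 1 * y 1)
        + (R1 * (x 2 * y 2) + R2 * (x 2 * y 3 + x 3 * y 2) + R3 * (x 3 * y 3)) + x 4 * y 4" for x y
    using key'[OF u, of "x 0" "x 1" "y 0" "y 1"] key'[OF w, of "x 2" "x 3" "y 2" "y 3"]
    by (simp add: eval_nat_numeral N_def del: divide_eq_0_iff)
  show ?thesis unfolding isotropic_plane_def
  proof (rule exI[of _ "N x"], rule exI[of _ "N y"], intro conjI)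
    show "\<exists>i<5. \<exists>j<5. N x i * N y j \<noteq> N x j * N y i" by (rule nd')
    show "(\<Sum>i<5. [u, u * (P1 * P3 - P2\<^sup>2), w, w * (R1 * R3 - R2\<^sup>2), 1] ! i * (N x i * N y i)) = 0"
      unfolding form using xy .
    show "(\<Sum>i<5. [u, u * (P1 * P3 - P2\<^sup>2), w, w * (R1 * R3 - R2\<^sup>2), 1] ! i * (N x i)\<^sup>2) = 0"
      unfolding power2_eq_square[of "N _ _"] form using xx by (simp add: power2_eq_square algebra_simps)
    show "(\<Sum>i<5. [u, u * (P1 * P3 - P2\<^sup>2), w, w * (R1 * R3 - R2\<^sup>2), 1] ! i * (N y i)\<^sup>2) = 0"
      unfolding power2_eq_square[of "N _ _"] form using yy by (simp add: power2_eq_square algebra_simps)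
  qed
qed

section \<open>The pencil of quadrics\<close>

text \<open>The polar form of \<open>A - l B\<close>; the coordinates \<open>0, \<dots>, 4\<close> are \<open>U, V, W, Z, Y\<close>.\<close>

definition pencil :: "'k::field \<Rightarrow> 'k \<Rightarrow> 'k \<Rightarrow> 'k \<Rightarrow> (nat \<Rightarrow> 'k) \<Rightarrow> (nat \<Rightarrow> 'k) \<Rightarrow> 'k" where
  "pencil c d T l x y = (let s = 1 - c * d * T in
     - c * (l + c * T) * (x 0 * y 0) - c * T * s * (x 0 * y 1 + x 1 * y 0)
     + c * T * s * (l - c * T) * (x 1 * y 1)
     + (c * T * (1 - d * T + d * l) * (x 2 * y 2) + c * T * s * (x 2 * y 3 + x 3 * y 2)
     + c * T * s * (1 - d * l) * (x 3 * y 3)) + x 4 * y 4)"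

definition pencil_plane :: "'k::field \<Rightarrow> 'k \<Rightarrow> 'k \<Rightarrow> 'k \<Rightarrow> bool" where
  "pencil_plane c d T l \<longleftrightarrow> (\<exists>x y. (\<exists>i<5. \<exists>j<5. x i * y j \<noteq> x j * y i) \<and>
     pencil c d T l x x = 0 \<and> pencil c d T l x y = 0 \<and> pencil c d T l y y = 0)"

text \<open>Substituting \<open>d = 1 - c\<close> factors both block determinants. Up to squares the
  first is \<open>- T s\<close> times \<open>l\<^sup>2 + T - c T\<^sup>2\<close> and the second is
  \<open>- s\<close> times \<open>l\<^sup>2 - T l + T\<close>.\<close>

lemma pencil_plane_diag:
  assumes "pencil_plane c d T l" "c + d = 1" "s = 1 - c * d * T"
    and "u = - c * (l + c * T) * e\<^sup>2 - 2 * c * T * s * e * f + c * T * s * (l - c * T) * f\<^sup>2" "u \<noteq> 0"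
    and "w = c * T * ((1 - d * T + d * l) * m\<^sup>2 + 2 * s * m * n + s * (1 - d * l) * n\<^sup>2)" "w \<noteq> 0"
  shows "isotropic_plane (\<lambda>i. [u, - (u * (c\<^sup>2 * T * s * (l\<^sup>2 + T - c * T\<^sup>2))), w,
            - (w * ((c * d * T)\<^sup>2 * s * (l\<^sup>2 - T * l + T))), 1] ! i)"
proof -
  obtain x y where nd: "\<exists>i<5. \<exists>j<5. x i * y j \<noteq> x j * y i" and
     Q: "pencil c d T l x x = 0" "pencil c d T l x y = 0" "pencil c d T l y y = 0"
    using assms(1) unfolding pencil_plane_def by blast
  have d: "d = 1 - c" using assms(2) by (simp add: eq_diff_eq add.commute)
  have "isotropic_plane (\<lambda>i. [u, u * (- c * (l + c * T) * (c * T * s * (l - c * T)) - (- c * T * s)\<^sup>2), w,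
            w * (c * T * (1 - d * T + d * l) * (c * T * s * (1 - d * l)) - (c * T * s)\<^sup>2), 1] ! i)"
    by (rule block_isotropic[OF nd, where e = e and f = f and m = m and n = n])
      (use Q assms(4-) in \<open>simp_all add: pencil_def Let_def power2_eq_square algebra_simps assms(3)\<close>)
  also have "- c * (l + c * T) * (c * T * s * (l - c * T)) - (- c * T * s)\<^sup>2
      = - (c\<^sup>2 * T * s * (l\<^sup>2 + T - c * T\<^sup>2))"
    unfolding assms(3) d by Groebner_Basis.algebra
  also have "c * T * (1 - d * T + d * l) * (c * T * s * (1 - d * l)) - (c * T * s)\<^sup>2
      = - ((c * d * T)\<^sup>2 * s * (l\<^sup>2 - T * l + T))"
    unfolding assms(3) d by Groebner_Basis.algebra
  finally show ?thesis by simp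
qed

context valuation
begin

lemma sim_pairD:
  assumes "sim (- (x * y)) 1" "sim x x'" "sim y y'"
  shows "sim (- (x' * y')) 1"
proof -
  have "sim (- 1 * (x * y)) (- 1 * (x' * y'))"
    by (intro sim_mult sim_refl assms) auto
  then show ?thesis using sim_trans[OF sim_sym assms(1), of "- (x' * y')"] by simp
qed

lemma sim_minus: "sim x y \<Longrightarrow> sim (- x) (- y)"
  using sim_mult[OF sim_refl[of "- 1"], of x y] by simp

lemma sim_mult_sq: "sim x y \<Longrightarrow> z \<noteq> 0 \<Longrightarrow> sim (x * z\<^sup>2) y"
  using sim_trans[OF sim_sq[of x z]] simD(1) by blast

lemma sim_mult_left: "x \<noteq> 0 \<Longrightarrow> sim y z \<Longrightarrow> sim (x * y) (x * z)"
  by (intro sim_mult sim_refl)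

end

lemma lessThan_five_perms:
  "{0, 2, 3, 4, Suc 0} = {..<5}" "{3, 4, 0, Suc 0, 2} = {..<5}" "{Suc 0, 3, 0, 2, 4} = {..<5}"
  "{0, 2, Suc 0, 3, 4} = {..<5}" "{Suc 0, 2, 0, 3, 4} = {..<5}" "{0, 4, Suc 0, 2, 3} = {..<5}"
  "{0, 3, Suc 0, 2, 4} = {..<5}"
  by auto

text \<open>The valuation stands for a prime of odd degree, where \<open>c\<close> is still not a
  square. The locale assumes a plane on one member of the pencil; \<open>good_prime\<close>,
  \<open>prime_dvd_T\<close> and \<open>prime_dvd_s\<close> refute it according to the behaviour of
  \<open>T\<close> and \<open>s\<close>. The case \<open>c = d\<close> is kept possible, since
  \<open>c\<close> and \<open>d\<close> may both be 1/2.\<close>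

locale pencil_at_prime = valuation v for v :: "'k::field \<Rightarrow> int" +
  fixes c d \<kappa> T s l :: 'k
  assumes cnz: "c \<noteq> 0" "d \<noteq> 0" and vc: "v c = 0" "v d = 0" and cd1: "c + d = 1"
    and cd2: "c * d = \<kappa>\<^sup>2" and csq: "\<not> sim c 1"
    and cmd: "c \<noteq> d \<Longrightarrow> v (c - d) = 0"
    and Tnz: "T \<noteq> 0" and s_def: "s = 1 - c * d * T" and snz: "s \<noteq> 0"
    and gnz: "l\<^sup>2 + T - c * T\<^sup>2 \<noteq> 0" and hnz: "l\<^sup>2 - T * l + T \<noteq> 0"
    and plane: "pencil_plane c d T l"
begin

definition "g = l\<^sup>2 + T - c * T\<^sup>2"
definition "h = l\<^sup>2 - T * l + T"

lemma g_nz: "g \<noteq> 0" and h_nz: "h \<noteq> 0"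
  using gnz hnz by (simp_all add: g_def h_def)

text \<open>The factored forms show \<open>g\<close> and \<open>h\<close> modulo a prime dividing
  \<open>s\<close>; the last identity carries information from \<open>g\<close> to
  \<open>h\<close>.\<close>

lemma g_eq: "g = (l - c * T) * (l + c * T) + T * s"
  and h_eq: "h = (l - c * T) * (l - d * T) + T * s"
  and h_eq': "h = g - T * (l - c * T)"
proof -
  have d: "d = 1 - c" using cd1 by (simp add: eq_diff_eq add.commute)
  show "g = (l - c * T) * (l + c * T) + T * s" "h = (l - c * T) * (l - d * T) + T * s"
    "h = g - T * (l - c * T)"
    unfolding g_def h_def s_def d by Groebner_Basis.algebra+
qed

lemma vge_const: "vge 0 c" "vge 0 d" "vge 0 (c * T)" "vge 0 (d * T)" "vge 0 T" if "0 \<le> v T"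
  using that vc cnz Tnz by (auto simp: vge_def v_mult)

lemma diag:
  assumes "u = - c * (l + c * T) * e\<^sup>2 - 2 * c * T * s * e * f + c * T * s * (l - c * T) * f\<^sup>2" "u \<noteq> 0"
    and "w = c * T * ((1 - d * T + d * l) * m\<^sup>2 + 2 * s * m * n + s * (1 - d * l) * n\<^sup>2)" "w \<noteq> 0"
  shows "isotropic_plane (\<lambda>i. [u, - (u * (c\<^sup>2 * T * s * g)), w, - (w * ((c * d * T)\<^sup>2 * s * h)), 1] ! i)"
  using pencil_plane_diag[OF plane cd1 s_def assms] by (simp add: g_def h_def)

lemma five_cases: "i < 5 \<Longrightarrow> i = 0 \<or> i = 1 \<or> i = 2 \<or> i = 3 \<or> i = (4::nat)"
  by auto

lemma nonzero_diag: "u \<noteq> 0 \<Longrightarrow> w \<noteq> 0 \<Longrightarrow> i < 5 \<Longrightarrow>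
    [u, - (u * (c\<^sup>2 * T * s * g)), w, - (w * ((c * d * T)\<^sup>2 * s * h)), 1] ! i \<noteq> 0"
  using five_cases[of i] cnz Tnz snz g_nz h_nz by auto

lemma v_diag:
  assumes "u \<noteq> 0" "w \<noteq> 0"
  shows "v (- (u * (c\<^sup>2 * T * s * g))) = v u + v T + v s + v g"
    "v (- (w * ((c * d * T)\<^sup>2 * s * h))) = v w + 2 * v T + v s + v h"
  using assms cnz Tnz snz g_nz h_nz vc by (simp_all add: v_mult v_power)

lemma not_sim_c: "z \<noteq> 0 \<Longrightarrow> x = c * z\<^sup>2 \<Longrightarrow> sim x 1 \<Longrightarrow> False"
  using sim_cancel_sq csq by blast

text \<open>Four diagonal entries have even valuation and the one containing \<open>g\<close> has
  odd valuation. Since \<open>g\<close> vanishes modulo the prime, \<open>(l + c T) h\<close> is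
  congruent to \<open>T * (T * s)\<close>, so the product of the four is \<open>c\<close> up to
  squares.\<close>

lemma good_prime:
  assumes vT: "v T = 0" and vs: "v s = 0" and odd: "odd (v g)"
  shows False
proof -
  have int: "vge 0 l"
  proof (rule ccontr)
    assume "\<not> vge 0 l"
    then have l: "l \<noteq> 0" "v l < 0" by (auto simp: vge_def)
    have "vge 0 (T - c * (T * T))" by (intro vge_diff vge_mult0 vge_const) (simp_all add: vT)
    then have "vge (v (l\<^sup>2) + 1) (T - c * (T * T))" by (rule vge_mono) (use l in \<open>simp add: v_power\<close>)
    from v_near(2)[OF _ this] have "v g = v (l\<^sup>2)" using l by (simp add: g_def power2_eq_square algebra_simps)
    then show False using odd l by (simp add: v_power)
  qed
  have ints: "vge 0 (l - c * T)" "vge 0 (l + c * T)" "vge 0 (l - d * T)" "vge 0 T" "vge 0 s"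
  proof -
    have const: "vge 0 (c * T)" "vge 0 (d * T)" "vge 0 T" using vge_const vT by auto
    show "vge 0 (l - c * T)" "vge 0 (l + c * T)" "vge 0 (l - d * T)" "vge 0 T"
      by (intro vge_diff vge_add int const)+
    show "vge 0 s" using vs by (simp add: vge_def)
  qed
  have "vge 0 g" unfolding g_eq by (intro vge_add vge_mult0 ints)
  then have vg: "vge 1 g" using odd by (cases "v g = 0") (auto simp: vge_def)
  have Ts: "T * s \<noteq> 0" "v (T * s) = 0" using Tnz snz vT vs by (simp_all add: v_mult)
  have prod: "(l - c * T) * (l + c * T) = - (T * s) + g" unfolding g_eq by simp
  have "vge (v (- (T * s)) + 1) g" using vg Ts by simp
  from v_near[OF _ this] Ts have 0: "(l - c * T) * (l + c * T) \<noteq> 0" "v ((l - c * T) * (l + c * T)) = 0"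
    unfolding prod by auto
  then have nz: "l - c * T \<noteq> 0" "l + c * T \<noteq> 0" by auto
  from 0(2) have v0: "v (l - c * T) = 0" "v (l + c * T) = 0"
    using ints(1,2) nz by (auto simp: vge_def v_mult)
  have Tl: "- (T * (l - c * T)) \<noteq> 0" "v (- (T * (l - c * T))) = 0"
    using nz Tnz vT v0 by (simp_all add: v_mult)
  have vgh: "vge (v (- (T * (l - c * T))) + 1) (h - - (T * (l - c * T)))"
    unfolding h_eq' using vg Tl by simp
  have vh: "v h = 0" using v_near(2)[OF Tl(1) vgh] Tl by simp
  have simh: "sim h (- (T * (l - c * T)))" by (rule sim_near[OF Tl(1) vgh])
  define u where "u = - c * (l + c * T)"
  have u: "u \<noteq> 0" "v u = 0" using cnz nz vc v0 by (simp_all add: u_def v_mult)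
  define R1 R3 where "R1 = c * T * (1 - d * T + d * l)" and "R3 = c * T * s * (1 - d * l)"
  have Rint: "vge 0 R1" "vge 0 R3"
    unfolding R1_def R3_def
    by (intro vge_mult0 vge_add vge_diff vge_one vge_const int ints; simp add: vT)+
  have R2: "v (2 * (c * T * s)) = 0" "c * T * s \<noteq> 0"
    using cnz Tnz snz two_nonzero vc vT vs v_two by (simp_all add: v_mult)
  \<comment> \<open>The block represents a unit at (1,0) or (0,1), and if both values vanish modulo
    the prime, then at (1,1), because the cross term \<open>2 * (c * T * s)\<close> is a
    unit.\<close>
  obtain m n where w: "c * T * ((1 - d * T + d * l) * m\<^sup>2 + 2 * s * m * n + s * (1 - d * l) * n\<^sup>2) \<noteq> 0"
    "v (c * T * ((1 - d * T + d * l) * m\<^sup>2 + 2 * s * m * n + s * (1 - d * l) * n\<^sup>2)) = 0"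
  proof (cases "vge 1 R1 \<and> vge 1 R3")
    case True
    then have "vge (v (2 * (c * T * s)) + 1) (R1 + R3)" using vge_add R2 by auto
    from v_near[OF _ this] R2 two_nonzero
    have "2 * (c * T * s) + (R1 + R3) \<noteq> 0" "v (2 * (c * T * s) + (R1 + R3)) = 0" by auto
    then show thesis using that[of 1 1] by (simp add: R1_def R3_def algebra_simps)
  next
    case False
    then consider "R1 \<noteq> 0" "v R1 = 0" | "R3 \<noteq> 0" "v R3 = 0" using Rint by (auto simp: vge_def)
    then show thesis using that[of 1 0] that[of 0 1] by cases (auto simp: R1_def R3_def algebra_simps)
  qed
  define w where "w = c * T * ((1 - d * T + d * l) * m\<^sup>2 + 2 * s * m * n + s * (1 - d * l) * n\<^sup>2)"
  have w0: "w \<noteq> 0" "v w = 0" using w by (simp_all add: w_def)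
  have iso: "isotropic_plane (\<lambda>i. [u, - (u * (c\<^sup>2 * T * s * g)), w, - (w * ((c * d * T)\<^sup>2 * s * h)), 1] ! i)"
    by (rule diag[of _ 1 0, OF _ u(1) w_def w0(1)]) (simp add: u_def)
  have "sim (u * w * (- (w * ((c * d * T)\<^sup>2 * s * h))) * 1) 1"
    using isotropic_quadruple[OF iso nonzero_diag[OF u(1) w0(1)], of 0 2 3 4 1]
      v_diag[OF u(1) w0(1)] vT vs vh odd u w0 by (auto simp: lessThan_five_perms)
  moreover have "u * w * (- (w * ((c * d * T)\<^sup>2 * s * h))) * 1 = (c * s * ((l + c * T) * h)) * (w * (c * d * T))\<^sup>2"
    unfolding u_def by Groebner_Basis.algebra
  ultimately have 1: "sim (c * s * ((l + c * T) * h)) 1" using sim_cancel_sq by metis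
  have "sim ((l + c * T) * h) ((l + c * T) * - (T * (l - c * T)))"
    by (rule sim_mult_left[OF nz(2) simh])
  also have "(l + c * T) * - (T * (l - c * T)) = T * (T * s) - T * g" unfolding g_eq by Groebner_Basis.algebra
  finally have 2: "sim ((l + c * T) * h) (T * (T * s) - T * g)" .
  have "sim (T * (T * s) - T * g) (T * (T * s))"
  proof (rule sim_near)
    show "vge (v (T * (T * s)) + 1) (T * (T * s) - T * g - T * (T * s))"
      using vge_mult0[OF ints(4) vg] Ts Tnz snz vT vs by (simp add: v_mult)
  qed (use Tnz snz in auto)
  from sim_trans[OF 2 this] have "sim (c * s * ((l + c * T) * h)) (c * s * (T * (T * s)))"
    using cnz snz by (intro sim_mult_left) auto
  from sim_trans[OF sim_sym[OF this] 1] show False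
    using Tnz snz by (intro not_sim_c[of "s * T"]) (auto simp: power2_eq_square ac_simps)
qed

text \<open>Odd valuation of \<open>g\<close> forces the prime to divide \<open>l\<close>, so
  \<open>g\<close> and \<open>h\<close> have the class of \<open>T\<close>. The entries at 3 and 4
  are the even ones, and minus their product is \<open>c\<close> up to squares.\<close>

lemma prime_dvd_T:
  assumes vT: "v T = 1" and odd: "odd (v g)"
  shows False
proof -
  have T2: "vge 2 (c * (T * T))" using vT Tnz cnz vc by (simp add: vge_def v_mult)
  have T1: "vge 1 T" "vge 1 (c * T)" "vge 1 (d * T)" using vT Tnz cnz vc by (simp_all add: vge_def v_mult)
  have l1: "vge 1 l"
  proof (rule ccontr)
    assume "\<not> vge 1 l"
    then have l: "l \<noteq> 0" "v l \<le> 0" by (auto simp: vge_def)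
    have "vge 1 (T - c * (T * T))" using T2 vge_mono by (intro vge_diff T1) auto
    then have "vge (v (l\<^sup>2) + 1) (T - c * (T * T))" by (rule vge_mono) (use l in \<open>simp add: v_power\<close>)
    from v_near(2)[OF _ this] have "v g = v (l\<^sup>2)" using l by (simp add: g_def power2_eq_square algebra_simps)
    then show False using odd l by (simp add: v_power)
  qed
  have "vge 1 (- (c * d * T))" using T1 vge_mult0[of d 1 "c * T"] vc by (simp add: vge_def ac_simps)
  then have s: "sim s 1" "v s = 0" using sim_near[of 1 s] v_near(2)[of 1 "- (c * d * T)"] by (simp_all add: s_def)
  have l2: "vge 2 (l * l)" "vge 2 (T * l)" using vge_mult[OF l1 l1] vge_mult[OF T1(1) l1] by simp_all
  have gT: "sim g T" "v g = 1"
    using sim_near[of T g] v_near(2)[of T "l * l - c * (T * T)"] vge_diff[OF l2(1) T2] Tnz vT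
    by (simp_all add: g_def power2_eq_square algebra_simps)
  have hT: "sim h T" "v h = 1"
    using sim_near[of T h] v_near(2)[of T "l * l - T * l"] vge_diff[OF l2] Tnz vT
    by (simp_all add: h_def power2_eq_square algebra_simps)
  define w where "w = c * T * (1 - d * T + d * l)"
  have "vge 2 (c * T * (d * l - d * T))"
  proof -
    have "vge 0 d" by (simp add: vge_def vc)
    then have "vge 1 (d * l - d * T)" by (intro vge_diff T1(3) vge_mult0[OF _ l1])
    from vge_mult[OF T1(2) this] show ?thesis by simp
  qed
  then have w: "sim w (c * T)" "w \<noteq> 0" "v w = 1"
    using sim_near[of "c * T" w] v_near[of "c * T" "c * T * (d * l - d * T)"] cnz Tnz vc vT
    by (simp_all add: w_def v_mult algebra_simps)
  define u1 u2 where "u1 = - c * (l + c * T)" and "u2 = u1 - 2 * (c * T * s) + c * T * s * (l - c * T)"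
  \<comment> \<open>A value of valuation exactly 1 is wanted. If the value at (1,0) is more
    divisible, the vector (1,1) works, because its cross term has valuation 1.\<close>
  obtain e f where u: "- c * (l + c * T) * e\<^sup>2 - 2 * c * T * s * e * f + c * T * s * (l - c * T) * f\<^sup>2 \<noteq> 0"
    "v (- c * (l + c * T) * e\<^sup>2 - 2 * c * T * s * e * f + c * T * s * (l - c * T) * f\<^sup>2) = 1"
  proof (cases "vge 2 u1")
    case True
    have "vge 2 (c * T * s * (l - c * T))"
    proof -
      have "vge 1 (c * T * s)" using T1(2) s snz vge_mult0'[of 1 "c * T" s] by (simp add: vge_def)
      from vge_mult[OF this vge_diff[OF l1 T1(2)]] show ?thesis by simp
    qed
    with True have "vge 2 (u1 + c * T * s * (l - c * T))" by (rule vge_add)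
    moreover have "- (2 * (c * T * s)) \<noteq> 0" "v (- (2 * (c * T * s))) = 1"
      using cnz Tnz snz two_nonzero vc vT s v_two by (simp_all add: v_mult)
    ultimately have "- (2 * (c * T * s)) + (u1 + c * T * s * (l - c * T)) \<noteq> 0"
      "v (- (2 * (c * T * s)) + (u1 + c * T * s * (l - c * T))) = 1"
      using v_near[of "- (2 * (c * T * s))" "u1 + c * T * s * (l - c * T)"] by auto
    then show thesis using that[of 1 1] by (simp add: u1_def algebra_simps)
  next
    case False
    have "vge 1 u1" unfolding u1_def using vge_mult0[of "- c" 1 "l + c * T"] vge_add[OF l1 T1(2)] vc
      by (simp add: vge_def)
    with False have "u1 \<noteq> 0" "v u1 = 1" by (auto simp: vge_def)
    then show thesis using that[of 1 0] by (simp add: u1_def)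
  qed
  define u where "u = - c * (l + c * T) * e\<^sup>2 - 2 * c * T * s * e * f + c * T * s * (l - c * T) * f\<^sup>2"
  have u0: "u \<noteq> 0" "v u = 1" using u by (simp_all add: u_def)
  have iso: "isotropic_plane (\<lambda>i. [u, - (u * (c\<^sup>2 * T * s * g)), w, - (w * ((c * d * T)\<^sup>2 * s * h)), 1] ! i)"
    by (rule diag[of _ e f _ 1 0, OF u_def u0(1) _ w(2)]) (simp add: w_def)
  have 1: "sim (- (- (w * ((c * d * T)\<^sup>2 * s * h)) * 1)) 1"
    using isotropic_pair_triple[OF iso nonzero_diag[OF u0(1) w(2)], of 3 4 0 1 2]
      v_diag[OF u0(1) w(2)] vT s hT gT u0 w by (auto simp: lessThan_five_perms)
  have "sim (w * ((c * d * T)\<^sup>2 * s * h)) (c * T * ((c * d * T)\<^sup>2 * 1 * T))"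
    by (intro sim_mult w s hT sim_refl) (use cnz Tnz in auto)
  from sim_trans[OF sim_sym[OF this]] 1 have "sim (c * T * ((c * d * T)\<^sup>2 * 1 * T)) 1" by simp
  then show False
    using cnz Tnz by (intro not_sim_c[of "T * (c * d * T)"]) (auto simp: power2_eq_square ac_simps)
qed

text \<open>Modulo a prime dividing \<open>s\<close> one has \<open>c d T = 1\<close>. This is where
  \<open>c d\<close> being a square is used: it makes \<open>T\<close> a local square.\<close>

lemma sim_cdT:
  assumes "v s = 1"
  shows "sim (c * d * T) 1" "sim T 1" "v T = 0"
proof -
  have eq: "c * d * T = 1 - s" by (simp add: s_def)
  have "vge 1 s" using assms by (simp add: vge_def)
  then have 1: "vge (v 1 + 1) (- s)" by simp
  then show 2: "sim (c * d * T) 1" unfolding eq by (intro sim_near) auto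
  have "v (c * d * T) = 0" unfolding eq using v_near(2)[OF _ 1] by simp
  then show "v T = 0" using cnz Tnz vc by (simp add: v_mult)
  have "T * \<kappa>\<^sup>2 = c * d * T" using cd2 by simp
  then show "sim T 1" using sim_cancel_sq 2 by metis
qed

text \<open>The cases follow which of \<open>l - c T\<close>, \<open>l + c T\<close>,
  \<open>l - d T\<close> vanish modulo the prime. In each, the diagonal entries split by parity into
  a pair and a triple, or a quadruple and a single entry, and the class forced to be a square turns
  out to be that of \<open>c\<close>.\<close>

lemma prime_dvd_s:
  assumes vs: "v s = 1" and even: "even (v g)"
  shows False
proof -
  note T = sim_cdT[OF vs]
  have T0: "0 \<le> v T" using T by simp
  note const = vge_const[OF T0]
  have s1: "vge 1 s" "vge 1 (T * s)" using vs snz Tnz T by (simp_all add: vge_def v_mult)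
  have vTs: "T * s \<noteq> 0" "v (T * s) = 1" using vs snz Tnz T by (simp_all add: v_mult)
  have simTs: "sim (T * s) s" using sim_mult[OF T(2) sim_refl[OF snz]] by simp
  note nzs = cnz Tnz snz g_nz h_nz two_nonzero
  define a1 a2 a3 where "a1 = l - c * T" and "a2 = l + c * T" and "a3 = l - d * T"
  note a_def = a1_def a2_def a3_def
  have g: "g = a1 * a2 + T * s" and h: "h = a1 * a3 + T * s"
    by (simp_all add: a_def g_eq h_eq)
  define u where "u = - c * a2"
  define w where "w = c * T * (s + d * a3)"
  \<comment> \<open>\<open>w\<close> and \<open>w'\<close> are the values of the second block at
    (1,0) and (0,1); \<open>w'\<close> replaces \<open>w\<close> when \<open>a3\<close> vanishes
    modulo the prime but \<open>a1\<close> does not.\<close>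
  define w' where "w' = c * T * s * (s - d * a1)"
  have w_eq: "w = c * T * (1 - d * T + d * l)"
    unfolding w_def a_def s_def using cd1 by Groebner_Basis.algebra
  have w'_eq: "w' = c * T * s * (1 - d * l)"
    by (simp add: w'_def a_def s_def algebra_simps)
  have iso: "isotropic_plane (\<lambda>i. [u, - (u * (c\<^sup>2 * T * s * g)), w, - (w * ((c * d * T)\<^sup>2 * s * h)), 1] ! i)"
    if "u \<noteq> 0" "w \<noteq> 0"
    by (rule diag[of _ 1 0 _ 1 0, OF _ that(1) _ that(2)]) (simp_all add: u_def a_def w_eq)
  have iso': "isotropic_plane (\<lambda>i. [u, - (u * (c\<^sup>2 * T * s * g)), w', - (w' * ((c * d * T)\<^sup>2 * s * h)), 1] ! i)"
    if "u \<noteq> 0" "w' \<noteq> 0"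
    by (rule diag[of _ 1 0 _ 0 1, OF _ that(1) _ that(2)]) (simp_all add: u_def a_def w'_eq)
  have sim_ug: "sim (- (u * (c\<^sup>2 * T * s * g))) (- (u0 * (s * g0)))" if "sim u u0" "sim g g0" for u u0 g0
  proof -
    have "sim (u * (T * s) * g) (u0 * s * g0)" by (intro sim_mult that simTs)
    from sim_minus[OF sim_mult_sq[OF this, of c]] cnz show ?thesis by (simp add: power2_eq_square ac_simps)
  qed
  have sim_wh: "sim (- (w * ((c * d * T)\<^sup>2 * s * h))) (- (w0 * (s * h0)))" if "sim w w0" "sim h h0" for w w0 h0
  proof -
    have "sim (w * s * h) (w0 * s * h0)" by (intro sim_mult that sim_refl snz)
    from sim_minus[OF sim_mult_sq[OF this, of "c * d * T"]] cnz Tnz show ?thesis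
      by (simp add: power2_eq_square ac_simps)
  qed
  have sim_w: "sim w a3" if "a3 \<noteq> 0" "vge (v a3 + 1) s"
  proof -
    have "sim (d * a3 + s) (d * a3)"
      by (rule sim_near) (use that cnz vc in \<open>simp_all add: v_mult\<close>)
    then have "sim (c * T * (d * a3 + s)) (c * T * (d * a3))"
      by (intro sim_mult_left) (use cnz Tnz in auto)
    also have "c * T * (d * a3) = c * d * T * a3" by simp
    finally have "sim w (c * d * T * a3)" by (simp add: w_def add.commute)
    then show ?thesis using sim_trans sim_mult[OF T(1) sim_refl[OF that(1)]] by simp
  qed
  show False
  proof (cases "vge 0 l")
    case False
    then have l: "l \<noteq> 0" "v l < 0" by (auto simp: vge_def)
    have big: "sim (l + e) l" "v (l + e) = v l" "l + e \<noteq> 0" if "vge 0 e" for e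
    proof -
      have "vge (v l + 1) e" using that vge_mono l by auto
      then show "sim (l + e) l" "v (l + e) = v l" "l + e \<noteq> 0"
        using sim_near[of l "l + e"] v_near[of l e] l by auto
    qed
    have a: "sim a1 l" "v a1 = v l" "a1 \<noteq> 0" "sim a2 l" "v a2 = v l" "a2 \<noteq> 0" "sim a3 l" "v a3 = v l" "a3 \<noteq> 0"
      using big[of "- (c * T)"] big[of "c * T"] big[of "- (d * T)"] const by (simp_all add: a_def)
    have near: "sim (x * y + T * s) (l * l)" "v (x * y + T * s) = 2 * v l"
      if "sim x l" "sim y l" "v x = v l" "v y = v l" for x y
    proof -
      have nz: "x * y \<noteq> 0" using that simD by auto
      have "vge (v (x * y) + 1) (T * s)" using vTs nz that l by (simp add: vge_def v_mult)
      then show "sim (x * y + T * s) (l * l)" "v (x * y + T * s) = 2 * v l"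
        using sim_trans[OF sim_near[OF nz] sim_mult[OF that(1,2)]] v_near[OF nz] that nz
        by (simp_all add: v_mult)
    qed
    have gh: "sim g (l * l)" "v g = 2 * v l" "sim h (l * l)" "v h = 2 * v l"
      using near[of a1 a2] near[of a1 a3] a unfolding g h by simp_all
    have u: "u \<noteq> 0" "sim u (- (c * l))" "v u = v l"
      using a cnz vc sim_minus[OF sim_mult_left[of c a2 l]] by (simp_all add: u_def v_mult)
    have "vge (v a3 + 1) s" using s1 vge_mono a l by auto
    from sim_trans[OF sim_w[OF a(9) this] a(7)] have w: "sim w l" .
    have vw: "w \<noteq> 0" "even (v w) = even (v l)" using w simD sim_parity by auto
    have q1: "sim (- (u * (c\<^sup>2 * T * s * g))) (- (- (c * l) * (s * (l * l))))"
      by (rule sim_ug[OF u(2) gh(1)])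
    have q3: "sim (- (w * ((c * d * T)\<^sup>2 * s * h))) (- (l * (s * (l * l))))"
      by (rule sim_wh[OF w gh(3)])
    show False
    \<comment> \<open>The odd entries are at 1 and 3 when \<open>v l\<close> is even, and at 0 and 2
      when it is odd.\<close>
    proof (cases "even (v l)")
      case True
      have "sim (- (- (u * (c\<^sup>2 * T * s * g)) * - (w * ((c * d * T)\<^sup>2 * s * h)))) 1"
        using isotropic_pair_triple[OF iso nonzero_diag[OF u(1) vw(1)], of 1 3 0 2 4]
          v_diag[OF u(1) vw(1)] vs T gh u vw True by (auto simp: lessThan_five_perms)
      from sim_pairD[OF this q1 q3] show False
        using l snz by (intro not_sim_c[of "s * l\<^sup>2 * l"]) (auto simp: power2_eq_square ac_simps)
    next
      case False
      have "sim (- (u * w)) 1"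
        using isotropic_pair_triple[OF iso nonzero_diag[OF u(1) vw(1)], of 0 2 1 3 4]
          v_diag[OF u(1) vw(1)] vs T gh u vw False by (auto simp: lessThan_five_perms)
      from sim_pairD[OF this u(2) w] show False
        using l snz by (intro not_sim_c[of l]) (auto simp: power2_eq_square ac_simps)
    qed
  next
    case int: True
    have a: "vge 0 a1" "vge 0 a2" "vge 0 a3"
      unfolding a_def by (intro vge_diff vge_add int const)+
    have va: "x \<noteq> 0" "v x = 0" if "vge 0 x" "\<not> vge 1 x" for x
      using that by (auto simp: vge_def)
    have c0: "v (2 * c) = 0" "2 * c \<noteq> 0" "v (2 * c * T) = 0" "2 * c * T \<noteq> 0"
      using nzs v_two vc T by (simp_all add: v_mult)
    have sim2cT: "sim (2 * c * T) (2 * c)"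
      using sim_mult_left[OF c0(2) T(2)] by simp
    consider (generic) "\<not> vge 1 a1" "\<not> vge 1 a2" | (b) "vge 1 a2" | (c) "vge 1 a1" by blast
    then show False
    proof cases
      case generic
      note a1 = va[OF a(1) generic(1)] and a2 = va[OF a(2) generic(2)]
      have gg: "sim g (a1 * a2)" "v g = 0"
        using sim_near[of "a1 * a2" g] v_near(2)[of "a1 * a2" "T * s"] a1 a2 s1 by (simp_all add: g v_mult)
      have u: "u \<noteq> 0" "v u = 0" using a2 cnz vc by (simp_all add: u_def v_mult)
      have q1: "sim (- (u * (c\<^sup>2 * T * s * g))) (c * s * a1)"
      proof -
        have "sim (- (u * (c\<^sup>2 * T * s * g))) (- (u * (s * (a1 * a2))))"
          by (rule sim_ug[OF sim_refl[OF u(1)] gg(1)])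
        moreover have "- (u * (s * (a1 * a2))) = c * s * a1 * a2\<^sup>2" unfolding u_def by Groebner_Basis.algebra
        moreover have "sim (c * s * a1 * a2\<^sup>2) (c * s * a1)" using a1 a2 nzs by (intro sim_sq) auto
        ultimately show ?thesis using sim_trans by metis
      qed
      show False
      proof (cases "vge 1 a3")
        case False
        note a3 = va[OF a(3) False]
        have hh: "sim h (a1 * a3)" "v h = 0"
          using sim_near[of "a1 * a3" h] v_near(2)[of "a1 * a3" "T * s"] a1 a3 s1 by (simp_all add: h v_mult)
        have w: "sim w a3" by (rule sim_w) (use a3 s1 in auto)
        have vw: "w \<noteq> 0" "even (v w)" using w simD sim_parity a3 by auto
        have q3: "sim (- (w * ((c * d * T)\<^sup>2 * s * h))) (- (a3 * (s * (a1 * a3))))"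
          by (rule sim_wh[OF w hh(1)])
        have "sim (- (- (u * (c\<^sup>2 * T * s * g)) * - (w * ((c * d * T)\<^sup>2 * s * h)))) 1"
          using isotropic_pair_triple[OF iso nonzero_diag[OF u(1) vw(1)], of 1 3 0 2 4]
            v_diag[OF u(1) vw(1)] vs T gg hh u vw by (auto simp: lessThan_five_perms)
        from sim_pairD[OF this q1 q3] show False
          using a1 a3 snz by (intro not_sim_c[of "s * a1 * a3"]) (auto simp: power2_eq_square ac_simps)
      next
        case a3: True
        have "sim (- (d * a1) + s) (- (d * a1))" "v (- (d * a1) + s) = 0" "- (d * a1) + s \<noteq> 0"
          using sim_near[of "- (d * a1)" "- (d * a1) + s"] v_near[of "- (d * a1)" s] a1 cnz vc s1
          by (simp_all add: v_mult)
        then have sd: "sim (s - d * a1) (- (d * a1))" "v (s - d * a1) = 0" "s - d * a1 \<noteq> 0"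
          by (simp_all add: add.commute)
        have w': "w' \<noteq> 0" "v w' = 1" using sd nzs vc T vs by (simp_all add: w'_def v_mult)
        have sw: "sim w' (- (s * a1))"
        proof -
          have "sim (c * T * s * (s - d * a1)) (c * T * s * - (d * a1))"
            by (intro sim_mult_left sd) (use nzs in auto)
          also have "c * T * s * - (d * a1) = c * d * T * - (s * a1)" by simp
          finally have "sim w' (c * d * T * - (s * a1))" by (simp add: w'_def)
          moreover have "sim (c * d * T * - (s * a1)) (1 * - (s * a1))"
            by (intro sim_mult T sim_refl) (use a1 snz in auto)
          ultimately show ?thesis using sim_trans by fastforce
        qed
        show False
        \<comment> \<open>The prime divides \<open>h\<close> in this case, with unknown parity. If
          \<open>v h\<close> is even, the odd entries are at 1 and 2; otherwise the even entries are
          at 0 and 4.\<close>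
        proof (cases "even (v h)")
          case True
          have "sim (- (- (u * (c\<^sup>2 * T * s * g)) * w')) 1"
            using isotropic_pair_triple[OF iso' nonzero_diag[OF u(1) w'(1)], of 1 2 0 3 4]
              v_diag[OF u(1) w'(1)] vs T gg u w' True by (auto simp: lessThan_five_perms)
          from sim_pairD[OF this q1 sw] show False
            using a1 snz by (intro not_sim_c[of "s * a1"]) (auto simp: power2_eq_square ac_simps)
        next
          case False
          have "sim (- (u * 1)) 1"
            using isotropic_pair_triple[OF iso' nonzero_diag[OF u(1) w'(1)], of 0 4 1 2 3]
              v_diag[OF u(1) w'(1)] vs T gg u w' False by (auto simp: lessThan_five_perms)
          moreover have "a2 = T + a3" unfolding a_def using cd1 by Groebner_Basis.algebra
          then have "sim a2 T" using sim_near[of T a2] Tnz a3 T by simp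
          then have "sim u (- (c * T))" unfolding u_def using sim_minus[OF sim_mult_left[OF cnz(1)]] by simp
          then have "sim u (- c)" using sim_trans sim_minus[OF sim_mult_left[OF cnz(1) T(2)]] by fastforce
          ultimately have "sim (- (- c * 1)) 1" by (rule sim_pairD) (simp add: sim_refl)
          then show False using csq by simp
        qed
      qed
    next
      case b
      have a1: "sim a1 (- (2 * c * T))" "v a1 = 0" "a1 \<noteq> 0"
        using sim_near[of "- (2 * c * T)" a1] v_near[of "- (2 * c * T)" a2] c0 b
        by (simp_all add: a_def algebra_simps)
      have sa1: "sim a1 (- (2 * c))" using sim_trans[OF a1(1) sim_minus[OF sim2cT]] .
      have "vge 1 g" unfolding g by (intro vge_add vge_mult0 a b s1)
      \<comment> \<open>An even positive valuation is at least 2. So \<open>g\<close> is negligible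
        against \<open>T * s\<close> of valuation 1, which determines the class of
        \<open>a1 * a2\<close> and hence of \<open>u\<close>.\<close>
      then have g2: "vge 2 g" using even g_nz by (cases "v g = 1") (auto simp: vge_def)
      have prod: "a1 * a2 = - (T * s) + g" unfolding g by simp
      have p: "sim (a1 * a2) (- (T * s))" "v (a1 * a2) = 1" "a1 * a2 \<noteq> 0"
        using sim_near[of "- (T * s)" "a1 * a2"] v_near[of "- (T * s)" g] vTs g2 unfolding prod by auto
      have sp: "sim (a1 * a2) (- s)" using sim_trans[OF p(1) sim_minus[OF simTs]] .
      have a2nz: "a2 \<noteq> 0" "v a2 = 1" using p a1 by (auto simp: v_mult)
      have "sim (a1 * (a1 * a2)) (- (2 * c) * - s)" by (rule sim_mult[OF sa1 sp])
      then have "sim (a2 * a1\<^sup>2) (2 * c * s)" by (simp add: power2_eq_square ac_simps)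
      from sim_cancel_sq[OF this] have "sim (- c * a2) (- c * (2 * c * s))" by (intro sim_mult_left) (use cnz in auto)
      then have "sim u (- (2 * s) * c\<^sup>2)" by (simp add: u_def power2_eq_square ac_simps)
      then have su: "sim u (- (2 * s))" by (rule sim_trans) (intro sim_sq; use nzs in auto)
      have u: "u \<noteq> 0" "v u = 1" using a2nz cnz vc by (simp_all add: u_def v_mult)
      have "a3 = - T + a2" unfolding a_def using cd1 by Groebner_Basis.algebra
      then have a3: "sim a3 (- T)" "v a3 = 0" "a3 \<noteq> 0"
        using sim_near[of "- T" a3] v_near[of "- T" a2] b T Tnz by auto
      have sa3: "sim a3 (- 1)" using sim_trans[OF a3(1) sim_minus[OF T(2)]] .
      have hh: "sim h (a1 * a3)" "v h = 0"
        using sim_near[of "a1 * a3" h] v_near(2)[of "a1 * a3" "T * s"] a1 a3 s1 by (simp_all add: h v_mult)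
      have sh: "sim h (2 * c)" using sim_trans[OF hh(1) sim_mult[OF sa1 sa3]] by simp
      have w: "sim w (- 1)" by (rule sim_trans[OF sim_w sa3]) (use a3 s1 in auto)
      have vw: "w \<noteq> 0" "even (v w)" using w simD sim_parity by auto
      have q3: "sim (- (w * ((c * d * T)\<^sup>2 * s * h))) (- (- 1 * (s * (2 * c))))"
        by (rule sim_wh[OF w sh])
      have "sim (- (u * - (w * ((c * d * T)\<^sup>2 * s * h)))) 1"
        using isotropic_pair_triple[OF iso nonzero_diag[OF u(1) vw(1)], of 0 3 1 2 4]
          v_diag[OF u(1) vw(1)] vs T even hh u vw by (auto simp: lessThan_five_perms)
      from sim_pairD[OF this su q3] show False
        using snz two_nonzero by (intro not_sim_c[of "2 * s"]) (auto simp: power2_eq_square ac_simps)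
    next
      case c
      have a2: "sim a2 (2 * c * T)" "v a2 = 0" "a2 \<noteq> 0"
        using sim_near[of "2 * c * T" a2] v_near[of "2 * c * T" a1] c0 c
        by (simp_all add: a_def algebra_simps)
      have sa2: "sim a2 (2 * c)" using sim_trans[OF a2(1) sim2cT] .
      have "vge 1 g" unfolding g by (intro vge_add vge_mult0' a c s1)
      then have g2: "vge 2 g" using even g_nz by (cases "v g = 1") (auto simp: vge_def)
      have u: "u \<noteq> 0" "v u = 0" using a2 cnz vc by (simp_all add: u_def v_mult)
      have "sim (- c * a2) (- c * (2 * c))" by (intro sim_mult_left sa2) (use cnz in auto)
      then have "sim u (- 2 * c\<^sup>2)" by (simp add: u_def power2_eq_square ac_simps)
      then have su: "sim u (- 2)" by (rule sim_trans) (intro sim_sq; use nzs in auto)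
      \<comment> \<open>Eliminating \<open>a1\<close> between the formulas for \<open>g\<close> and
        \<open>h\<close> expresses the class of \<open>h\<close> through \<open>T\<close>,
        \<open>s\<close> and \<open>a2\<close>, the term with \<open>g\<close> being
        negligible.\<close>
      have "h * a2 = T * (T * s) + g * a3" unfolding g h a_def using cd1 by Groebner_Basis.algebra
      moreover have TTs: "sim (T * (T * s)) s" "v (T * (T * s)) = 1" "T * (T * s) \<noteq> 0"
        using sim_mult[OF T(2) simTs] T nzs vs by (simp_all add: v_mult)
      moreover have "vge 2 (g * a3)" by (rule vge_mult0'[OF g2 a(3)])
      ultimately have ha2: "sim (h * a2) s" "v (h * a2) = 1"
        using sim_trans[OF sim_near[of "T * (T * s)" "h * a2"] TTs(1)] v_near[of "T * (T * s)" "g * a3"] by auto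
      have vh: "v h = 1" using ha2 a2 h_nz by (simp add: v_mult)
      have "sim (h * a2 * a2) (s * (2 * c))" by (rule sim_mult[OF ha2(1) sa2])
      then have "sim (h * a2\<^sup>2) (s * (2 * c))" by (simp add: power2_eq_square ac_simps)
      then have sh: "sim h (s * (2 * c))" by (rule sim_cancel_sq)
      show False
      proof (cases "c = d")
        case False
        have "a3 = (c - d) * T + a1" unfolding a_def by Groebner_Basis.algebra
        then have a3: "v a3 = 0" "a3 \<noteq> 0"
          using v_near[of "(c - d) * T" a1] cmd[OF False] False c T Tnz by (simp_all add: v_mult)
        have w: "sim w a3" by (rule sim_w) (use a3 s1 in auto)
        have vw: "w \<noteq> 0" "even (v w)" using w simD sim_parity a3 by auto
        have "sim (u * w * - (w * ((c * d * T)\<^sup>2 * s * h)) * 1) 1"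
          using isotropic_quadruple[OF iso nonzero_diag[OF u(1) vw(1)], of 0 2 3 4 1]
            v_diag[OF u(1) vw(1)] vs T even vh u vw by (auto simp: lessThan_five_perms)
        moreover have "sim (u * w * - (w * ((c * d * T)\<^sup>2 * s * h)) * 1) (- 2 * a3 * - (a3 * (s * (s * (2 * c)))) * 1)"
          by (intro sim_mult sim_wh su w sh sim_refl) auto
        ultimately have "sim (- 2 * a3 * - (a3 * (s * (s * (2 * c)))) * 1) 1"
          using sim_trans sim_sym by blast
        then show False
          using snz two_nonzero a3 by (intro not_sim_c[of "2 * s * a3"]) (auto simp: power2_eq_square ac_simps)
      next
        \<comment> \<open>Now \<open>a3 = a1\<close> vanishes modulo the prime too, so
          \<open>w\<close> has odd valuation. As \<open>c\<close> is 1/2, the class of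
          \<open>c\<close> is that of 2, and \<open>u\<close> has the class of -2.\<close>
        case True
        then have a31: "a3 = a1" by (simp add: a_def)
        have c2: "2 * c = 1" using cd1 True by simp
        have L: "l = c * T + a1" by (simp add: a_def)
        have Ls: "v l = 0" "sim l (c * T)" "l \<noteq> 0"
          using v_near[of "c * T" a1] sim_near[of "c * T" l] c cnz Tnz vc T by (simp_all add: L v_mult)
        have "a2 * (s + d * a1) = s * l + d * g" 
        proof -
          have "a2 = a1 + 2 * c * T" by (simp add: a_def)
          then show ?thesis unfolding g using True L by Groebner_Basis.algebra
        qed
        moreover have "vge 2 (d * g)" using vge_mult0[of d 2 g] g2 vc by (simp add: vge_def)
        moreover have sl: "v (s * l) = 1" "s * l \<noteq> 0" "sim (s * l) (s * (c * T))"
          using Ls snz vs sim_mult_left[OF snz Ls(2)] by (simp_all add: v_mult)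
        ultimately have m: "sim (a2 * (s + d * a1)) (s * l)" "v (a2 * (s + d * a1)) = 1" "a2 * (s + d * a1) \<noteq> 0"
          using sim_near[of "s * l" "a2 * (s + d * a1)"] v_near[of "s * l" "d * g"] by auto
        have "sim (c * T * (a2 * (a2 * (s + d * a1)))) (c * T * (2 * c * (s * (c * T))))"
          by (intro sim_mult_left sim_mult[OF sa2] sim_trans[OF m(1) sl(3)]) (use cnz Tnz in auto)
        then have "sim (w * a2\<^sup>2) (2 * c * (s * (c * T)\<^sup>2))"
          by (simp add: w_def a31 power2_eq_square ac_simps)
        then have "sim (w * a2\<^sup>2) (s * (c * T)\<^sup>2)" unfolding c2 by simp
        then have "sim w (s * (c * T)\<^sup>2)" by (rule sim_cancel_sq)
        then have w: "sim w s" by (rule sim_trans) (intro sim_sq; use nzs in auto)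
        have vw: "w \<noteq> 0" "odd (v w)" using w simD sim_parity vs by auto
        have "sim (- (u * 1)) 1"
          using isotropic_pair_triple[OF iso nonzero_diag[OF u(1) vw(1)], of 0 4 1 2 3]
            v_diag[OF u(1) vw(1)] vs T even vh u vw by (auto simp: lessThan_five_perms)
        from sim_pairD[OF this su sim_refl[of 1]] have "sim 2 1" by simp
        moreover have "2 = c * 2\<^sup>2" using c2 by Groebner_Basis.algebra
        ultimately show False using two_nonzero by (intro not_sim_c[of 2 2])
      qed
    qed
  qed
qed

end

section \<open>Primes of odd degree\<close>

text \<open>The degree is the sum of multiplicity times degree over the primes, so an odd total has
  a summand with both factors odd. The induction strips off one full prime power at a time.\<close>

lemma odd_degree_prime:
  fixes f :: "'a::field_gcd poly"
  assumes "odd (degree f)"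
  obtains \<pi> where "prime_elem \<pi>" "odd (degree \<pi>)" "odd (multiplicity \<pi> f)"
proof -
  have "\<exists>\<pi>. prime_elem \<pi> \<and> odd (degree \<pi>) \<and> odd (multiplicity \<pi> f)"
    using assms
  proof (induction "degree f" arbitrary: f rule: less_induct)
    case less
    have "f \<noteq> 0" using less.prems by auto
    then have f: "f \<noteq> 0" "\<not> is_unit f" using less.prems is_unit_iff_degree[of f] by (force, metis even_zero)
    then obtain q where q: "prime q" "q dvd f" using prime_divisor_exists by blast
    then have pq: "prime_elem q" by simp
    define m where "m = multiplicity q f"
    obtain f' where f': "f = q ^ m * f'" "\<not> q dvd f'"
      using multiplicity_decompose'[OF f(1), of q] pq unfolding m_def
      by (metis prime_elem_def mult.commute)
    have nz: "q \<noteq> 0" "f' \<noteq> 0" using f f' pq by auto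
    have m: "m > 0" using q f f' by (metis dvd_0_right m_def multiplicity_gt_zero_iff pq prime_elem_not_unit)
    have dq: "degree q > 0" using pq nz by (auto simp: prime_elem_def is_unit_iff_degree)
    have df: "degree f = m * degree q + degree f'"
      using nz f'(1) by (simp add: degree_mult_eq degree_power_eq)
    show ?case
    proof (cases "odd (degree q) \<and> odd m")
      case True
      then show ?thesis using pq m_def by auto
    next
      case False
      then have "odd (degree f')" using df less.prems by auto
      moreover have "degree f' < degree f" using df m dq by simp
      ultimately obtain \<pi> where \<pi>: "prime_elem \<pi>" "odd (degree \<pi>)" "odd (multiplicity \<pi> f')"
        using less.hyps by blast
      have "\<pi> dvd f'" using \<pi>(3) not_dvd_imp_multiplicity_0[of \<pi> f'] by fastforce
      have "\<not> \<pi> dvd q"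
      proof
        assume "\<pi> dvd q"
        then obtain r where r: "q = \<pi> * r" by (rule dvdE)
        then have "is_unit r"
          using irreducibleD[OF prime_elem_imp_irreducible[OF pq] r] \<pi>(1) by (auto simp: prime_elem_def)
        then have "q dvd \<pi>" by (simp add: r mult_unit_dvd_iff)
        then show False using \<open>\<pi> dvd f'\<close> f'(2) dvd_trans by blast
      qed
      then have "multiplicity \<pi> q = 0" by (rule not_dvd_imp_multiplicity_0)
      then have "multiplicity \<pi> f = multiplicity \<pi> f'"
        using nz \<pi>(1) unfolding f'(1)
        by (simp add: prime_elem_multiplicity_mult_distrib prime_elem_multiplicity_power_distrib)
      then show ?thesis using \<pi> by auto
    qed
  qed
  then show thesis using that by blast
qed

text \<open>The top coefficient is \<open>X\<^sup>2 - c Y\<^sup>2\<close> in the coefficients of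
  \<open>x\<close> and \<open>y\<close> of the larger degree. It cannot vanish, because
  \<open>c\<close> is not a square.\<close>

lemma degree_norm_form:
  fixes x y :: "'a::field poly"
  assumes "\<nexists>z. z\<^sup>2 = c" "x \<noteq> 0 \<or> y \<noteq> 0"
  shows "degree (x\<^sup>2 - smult c (y\<^sup>2)) = 2 * max (degree x) (degree y)" "x\<^sup>2 - smult c (y\<^sup>2) \<noteq> 0"
proof -
  have c: "c \<noteq> 0" using assms(1) by (metis power_zero_numeral)
  define n where "n = max (degree x) (degree y)"
  have top: "coeff (p\<^sup>2) (2 * n) = (coeff p n)\<^sup>2" if "degree p \<le> n" for p :: "'a poly"
  proof (cases "degree p = n")
    case True
    then show ?thesis using coeff_mult_degree_sum[of p p] by (simp add: power2_eq_square mult_2)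
  next
    case False
    then have "degree (p\<^sup>2) < 2 * n" "degree p < n" using that degree_power_le[of p 2] by auto
    then show ?thesis by (simp add: coeff_eq_0)
  qed
  have nz: "(coeff x n)\<^sup>2 - c * (coeff y n)\<^sup>2 \<noteq> 0"
  proof
    assume eq: "(coeff x n)\<^sup>2 - c * (coeff y n)\<^sup>2 = 0"
    show False
    proof (cases "coeff y n = 0")
      case True
      then have 0: "coeff x n = 0" "coeff y n = 0" using eq by simp_all
      have "degree x = n \<or> degree y = n" "degree x \<le> n" "degree y \<le> n" by (auto simp: n_def)
      then have "x = 0 \<and> y = 0" using 0 leading_coeff_0_iff[of x] leading_coeff_0_iff[of y] by fastforce
      then show False using assms(2) by simp
    next
      case False
      then have "(coeff x n / coeff y n)\<^sup>2 = c" using eq by (simp add: power_divide)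
      then show False using assms(1) by blast
    qed
  qed
  have cn: "coeff (x\<^sup>2 - smult c (y\<^sup>2)) (2 * n) = (coeff x n)\<^sup>2 - c * (coeff y n)\<^sup>2"
    using top[of x] top[of y] by (simp add: n_def)
  have "degree (x\<^sup>2 - smult c (y\<^sup>2)) \<le> 2 * n"
  proof (rule degree_diff_le)
    show "degree (x\<^sup>2) \<le> 2 * n" using degree_power_le[of x 2] by (simp add: n_def)
    have "degree (smult c (y\<^sup>2)) \<le> degree (y\<^sup>2)" by (rule degree_smult_le)
    also have "\<dots> \<le> 2 * n" using degree_power_le[of y 2] by (simp add: n_def)
    finally show "degree (smult c (y\<^sup>2)) \<le> 2 * n" .
  qed
  moreover have "2 * n \<le> degree (x\<^sup>2 - smult c (y\<^sup>2))" using cn nz by (intro le_degree) simp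
  ultimately show "degree (x\<^sup>2 - smult c (y\<^sup>2)) = 2 * max (degree x) (degree y)" by (simp add: n_def)
  show "x\<^sup>2 - smult c (y\<^sup>2) \<noteq> 0" using cn nz by force
qed

text \<open>Whenever the prime divides the norm it divides both arguments, so its factors come out
  in squares. That inertness is a hypothesis here because the next lemma proves it by induction on
  the degree, using this lemma for smaller primes.\<close>

lemma even_multiplicity_norm_form:
  fixes x y :: "'a::field_gcd poly"
  assumes c: "\<nexists>z. z\<^sup>2 = c" and \<pi>: "prime_elem \<pi>"
    and dvd: "\<And>x y. \<pi> dvd x\<^sup>2 - smult c (y\<^sup>2) \<Longrightarrow> \<pi> dvd x \<and> \<pi> dvd y"
  shows "even (multiplicity \<pi> (x\<^sup>2 - smult c (y\<^sup>2)))"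
proof (cases "x \<noteq> 0 \<or> y \<noteq> 0")
  case True
  then show ?thesis
  proof (induction "degree x + degree y" arbitrary: x y rule: less_induct)
    case less
    let ?N = "\<lambda>x y. x\<^sup>2 - smult c (y\<^sup>2)"
    show ?case
    proof (cases "\<pi> dvd ?N x y")
      case False
      then show ?thesis by (simp add: not_dvd_imp_multiplicity_0)
    next
      case True
      then obtain x' y' where xy: "x = \<pi> * x'" "y = \<pi> * y'" using dvd by (blast elim: dvdE)
      have eq: "?N x y = \<pi> ^ 2 * ?N x' y'"
        unfolding xy by (simp add: power_mult_distrib right_diff_distrib)
      have nz: "x' \<noteq> 0 \<or> y' \<noteq> 0" using less.prems xy by auto
      have d\<pi>: "degree \<pi> > 0" "\<pi> \<noteq> 0" using \<pi> by (auto simp: prime_elem_def is_unit_iff_degree)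
      have "degree z' \<le> degree (\<pi> * z')" for z' using d\<pi> by (cases "z' = 0") (auto simp: degree_mult_eq)
      moreover have "degree z' < degree (\<pi> * z')" if "z' \<noteq> 0" for z' using d\<pi> that by (auto simp: degree_mult_eq)
      ultimately have "degree x' + degree y' < degree x + degree y"
        unfolding xy using nz by (metis add_le_less_mono add_less_le_mono)
      then have "even (multiplicity \<pi> (?N x' y'))" using less.hyps nz by blast
      moreover have "multiplicity \<pi> (?N x y) = 2 + multiplicity \<pi> (?N x' y')"
        using degree_norm_form(2)[OF c nz] d\<pi> \<pi> unfolding eq
        by (simp add: prime_elem_multiplicity_mult_distrib prime_elem_multiplicity_power_distrib)
      ultimately show ?thesis by simp
    qed
  qed
qed simp

text \<open>Instead of counting residues modulo \<open>\<pi>\<close>: reduce \<open>x\<close> and \<open>y\<close> modulo \<open>\<pi>\<close>; as norm forms have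
  even degree, the cofactor of \<open>\<pi>\<close> has odd degree and supplies a smaller prime of odd degree.\<close>

lemma odd_prime_dvd_norm_form:
  fixes x y \<pi> :: "'a::field_gcd poly"
  assumes c: "\<nexists>z. z\<^sup>2 = c" and "prime_elem \<pi>" "odd (degree \<pi>)" "\<pi> dvd x\<^sup>2 - smult c (y\<^sup>2)"
  shows "\<pi> dvd x \<and> \<pi> dvd y"
  using assms(2-)
proof (induction "degree \<pi>" arbitrary: \<pi> x y rule: less_induct)
  case less
  let ?N = "\<lambda>x y. x\<^sup>2 - smult c (y\<^sup>2)"
  have c0: "c \<noteq> 0" using c by (metis power_zero_numeral)
  have \<pi>: "degree \<pi> > 0" "\<pi> \<noteq> 0" using less.prems(1) by (auto simp: prime_elem_def is_unit_iff_degree)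
  show ?case
  proof (rule ccontr)
    assume neg: "\<not> ?thesis"
    define x1 y1 where "x1 = x mod \<pi>" and "y1 = y mod \<pi>"
    have nz: "x1 \<noteq> 0 \<or> y1 \<noteq> 0" using neg by (auto simp: x1_def y1_def mod_eq_0_iff_dvd)
    have deg: "degree x1 < degree \<pi>" "degree y1 < degree \<pi>"
      using degree_mod_less[OF \<pi>(2), of x] degree_mod_less[OF \<pi>(2), of y] \<pi>(1)
      by (auto simp: x1_def y1_def)
    have "\<pi> dvd x - x1" "\<pi> dvd y - y1" by (simp_all add: x1_def y1_def dvd_minus_mod)
    then have "\<pi> dvd (x - x1) * (x + x1) - smult c ((y - y1) * (y + y1))"
      by (rule dvd_diff[OF dvd_mult2 dvd_smult[OF dvd_mult2]])
    then have "\<pi> dvd ?N x y - (?N x1 y1)"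
      by (simp add: power2_eq_square algebra_simps smult_diff_right smult_add_right)
    then have "\<pi> dvd ?N x1 y1" using less.prems(3)
      by (metis dvd_diff_right_iff dvd_diff_commute)
    then obtain f where f: "?N x1 y1 = \<pi> * f" by (rule dvdE)
    have N0: "?N x1 y1 \<noteq> 0" by (rule degree_norm_form(2)[OF c nz])
    then have f0: "f \<noteq> 0" using f by auto
    have dN: "degree \<pi> + degree f = 2 * max (degree x1) (degree y1)"
      using degree_norm_form(1)[OF c nz] f f0 \<pi> by (simp add: degree_mult_eq)
    have df: "degree f < degree \<pi>" "odd (degree f)"
      using dN deg less.prems(2) by (linarith, metis even_add dvd_triv_left)
    obtain \<rho> where \<rho>: "prime_elem \<rho>" "odd (degree \<rho>)" "odd (multiplicity \<rho> f)"
      using odd_degree_prime[OF df(2)] by blast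
    have "\<rho> dvd f" using \<rho>(3) not_dvd_imp_multiplicity_0[of \<rho> f] by fastforce
    then have d\<rho>: "degree \<rho> < degree \<pi>" using dvd_imp_degree_le[OF _ f0] df by fastforce
    have "even (multiplicity \<rho> (?N x1 y1))"
      by (rule even_multiplicity_norm_form[OF c \<rho>(1)]) (use less.hyps[OF d\<rho> \<rho>(1,2)] in blast)
    moreover have "\<not> \<rho> dvd \<pi>"
    proof
      assume "\<rho> dvd \<pi>"
      then obtain r where r: "\<pi> = \<rho> * r" by (rule dvdE)
      then have "is_unit r"
        using less.prems(1) \<rho>(1) irreducibleD[OF prime_elem_imp_irreducible[OF less.prems(1)] r]
        by (auto simp: prime_elem_def)
      then have "degree r = 0" by (metis is_unit_iff_degree not_is_unit_0)
      then show False using r d\<rho> \<pi> by (auto simp: degree_mult_eq)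
    qed
    then have "multiplicity \<rho> (?N x1 y1) = multiplicity \<rho> f"
      using f f0 \<pi> \<rho>(1) by (simp add: prime_elem_multiplicity_mult_distrib not_dvd_imp_multiplicity_0)
    ultimately show False using \<rho>(3) by simp
  qed
qed

section \<open>The valuation of the rational function field at a prime polynomial\<close>

definition prime_val :: "'a::field_gcd poly \<Rightarrow> 'a poly fract \<Rightarrow> int" where
  "prime_val \<pi> x = int (multiplicity \<pi> (fst (quot_of_fract x))) - int (multiplicity \<pi> (snd (quot_of_fract x)))"

lemma fract_conv_quot: "x = to_fract (fst (quot_of_fract x)) / to_fract (snd (quot_of_fract x))"
  by (simp flip: Fract_conv_to_fract)

lemma prime_val_fract:
  assumes \<pi>: "prime_elem \<pi>" and "a \<noteq> 0" "b \<noteq> 0"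
  shows "prime_val \<pi> (to_fract a / to_fract b) = int (multiplicity \<pi> a) - int (multiplicity \<pi> b)"
proof -
  define q where "q = quot_of_fract (to_fract a / to_fract b)"
  have q: "snd q \<noteq> 0" "to_fract (fst q) / to_fract (snd q) = to_fract a / to_fract b"
    by (simp_all add: q_def flip: fract_conv_quot)
  then have "to_fract (fst q) * to_fract b = to_fract a * to_fract (snd q)"
    using assms by (simp add: frac_eq_eq)
  then have "fst q * b = a * snd q" by (simp flip: to_fract_mult)
  moreover from this have "fst q \<noteq> 0" using assms q(1) by auto
  ultimately have "multiplicity \<pi> (fst q) + multiplicity \<pi> b = multiplicity \<pi> a + multiplicity \<pi> (snd q)"
    using assms q(1) by (metis prime_elem_multiplicity_mult_distrib)
  then show ?thesis by (simp add: prime_val_def q_def[symmetric])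
qed

lemma fract_repr:
  fixes x :: "'a::field_gcd poly fract"
  obtains a b where "x = to_fract a / to_fract b" "b \<noteq> 0" "x \<noteq> 0 \<Longrightarrow> a \<noteq> 0"
proof (rule that)
  show x: "x = to_fract (fst (quot_of_fract x)) / to_fract (snd (quot_of_fract x))"
    by (rule fract_conv_quot)
  show "snd (quot_of_fract x) \<noteq> 0" by simp
  show "fst (quot_of_fract x) \<noteq> 0" if "x \<noteq> 0" using that by simp
qed

lemma prime_val_to_fract: "prime_elem \<pi> \<Longrightarrow> a \<noteq> 0 \<Longrightarrow> prime_val \<pi> (to_fract a) = int (multiplicity \<pi> a)"
  using prime_val_fract[of \<pi> a 1] by simp

lemma prime_val_const: "prime_elem \<pi> \<Longrightarrow> a \<noteq> 0 \<Longrightarrow> prime_val \<pi> (to_fract [:a:]) = 0"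
  by (simp add: prime_val_to_fract multiplicity_unit_right is_unit_pCons_iff)

lemma valuation_prime_val:
  assumes \<pi>: "prime_elem \<pi>" and two: "(2::'a::field_gcd) \<noteq> 0"
  shows "valuation (prime_val (\<pi> :: 'a poly))"
proof
  fix x y :: "'a poly fract"
  assume nz: "x \<noteq> 0" "y \<noteq> 0"
  obtain a b where x: "x = to_fract a / to_fract b" "b \<noteq> 0" "a \<noteq> 0" using nz fract_repr[of x] by metis
  obtain a' b' where y: "y = to_fract a' / to_fract b'" "b' \<noteq> 0" "a' \<noteq> 0" using nz fract_repr[of y] by metis
  have "x * y = to_fract (a * a') / to_fract (b * b')" using x y by simp
  then have "prime_val \<pi> (x * y) = int (multiplicity \<pi> (a * a')) - int (multiplicity \<pi> (b * b'))"
    using x y by (simp only: prime_val_fract[OF \<pi>] mult_eq_0_iff simp_thms)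
  then show "prime_val \<pi> (x * y) = prime_val \<pi> x + prime_val \<pi> y"
    using x y \<pi> by (simp add: prime_val_fract prime_elem_multiplicity_mult_distrib)
  assume xy: "x + y \<noteq> 0"
  have eq: "x + y = to_fract (a * b' + a' * b) / to_fract (b * b')"
    using x y by (simp add: add_frac_eq)
  have nz': "a * b' + a' * b \<noteq> 0" using xy unfolding eq by (metis divide_eq_0_iff to_fract_0)
  define m where "m = min (multiplicity \<pi> (a * b')) (multiplicity \<pi> (a' * b))"
  have "\<pi> ^ m dvd a * b'" "\<pi> ^ m dvd a' * b" by (auto simp: m_def intro: multiplicity_dvd')
  then have "m \<le> multiplicity \<pi> (a * b' + a' * b)"
    using nz' \<pi> by (intro multiplicity_geI) (auto simp: prime_elem_def)
  moreover have "prime_val \<pi> (x + y) = int (multiplicity \<pi> (a * b' + a' * b)) - int (multiplicity \<pi> (b * b'))"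
    unfolding eq using x y nz' by (intro prime_val_fract \<pi>) auto
  ultimately show "min (prime_val \<pi> x) (prime_val \<pi> y) \<le> prime_val \<pi> (x + y)"
    using x y \<pi> by (auto simp: prime_val_fract prime_elem_multiplicity_mult_distrib m_def)
next
  have "[:2::'a:] = 1 + 1" by (simp add: one_pCons)
  then have "to_fract [:2::'a:] = 1 + 1" by (simp only: to_fract_add to_fract_1)
  then have two_eq: "(2 :: 'a poly fract) = to_fract [:2:]" by (simp only: one_add_one)
  show "(2::'a poly fract) \<noteq> 0" unfolding two_eq using two by simp
  show "prime_val \<pi> 2 = 0" unfolding two_eq by (rule prime_val_const[OF \<pi> two])
qed

text \<open>If \<open>c\<close> were a local square, a fraction a/b in lowest terms would give a
  norm \<open>a\<^sup>2 - c b\<^sup>2\<close> divisible by \<open>\<pi>\<close> with neither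
  argument divisible, contrary to \<open>odd_prime_dvd_norm_form\<close>.\<close>

lemma not_sim_nonsquare:
  assumes \<pi>: "prime_elem \<pi>" "odd (degree \<pi>)" and two: "(2::'a::field_gcd) \<noteq> 0" and c: "\<nexists>z::'a. z\<^sup>2 = c"
  shows "\<not> valuation.sim (prime_val \<pi>) (to_fract [:c:]) 1"
proof
  interpret valuation "prime_val \<pi>" by (rule valuation_prime_val[OF \<pi>(1) two])
  assume "sim (to_fract [:c:]) 1"
  have c0: "c \<noteq> 0" using c by (metis power_zero_numeral)
  from \<open>sim (to_fract [:c:]) 1\<close> obtain z where z: "z \<noteq> 0" "vge (prime_val \<pi> (to_fract [:c:]) + 1) (to_fract [:c:] - 1 * z\<^sup>2)"
    "prime_val \<pi> (to_fract [:c:]) = prime_val \<pi> 1 + 2 * prime_val \<pi> z" by (rule simE)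
  then have vz: "prime_val \<pi> z = 0" using prime_val_const[OF \<pi>(1) c0] by simp
  define a b where "a = fst (quot_of_fract z)" and "b = snd (quot_of_fract z)"
  have ab: "coprime a b" "z = to_fract a / to_fract b" "b \<noteq> 0"
    by (simp_all add: a_def b_def coprime_quot_of_fract flip: fract_conv_quot)
  have a0: "a \<noteq> 0" using ab z(1) by auto
  have "multiplicity \<pi> a = multiplicity \<pi> b"
    using vz prime_val_fract[OF \<pi>(1) a0 ab(3)] ab(2) by simp
  moreover have "\<not> (\<pi> dvd a \<and> \<pi> dvd b)" using ab(1) \<pi>(1) by (meson coprime_common_divisor prime_elem_def)
  ultimately have nd: "\<not> \<pi> dvd a \<and> \<not> \<pi> dvd b"
    using a0 ab(3) \<pi>(1) by (metis multiplicity_eq_zero_iff prime_elem_not_unit)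
  have eq: "to_fract [:c:] - 1 * z\<^sup>2 = to_fract (- (a\<^sup>2 - smult c (b\<^sup>2))) / to_fract (b\<^sup>2)"
  proof -
    have "to_fract (smult c (b\<^sup>2)) = to_fract [:c:] * to_fract (b\<^sup>2)" by (simp flip: to_fract_mult)
    then show ?thesis using ab by (simp add: field_simps power2_eq_square)
  qed
  have "\<pi> dvd a\<^sup>2 - smult c (b\<^sup>2)"
  proof (cases "a\<^sup>2 - smult c (b\<^sup>2) = 0")
    case False
    have "prime_val \<pi> (to_fract [:c:] - 1 * z\<^sup>2) = int (multiplicity \<pi> (- (a\<^sup>2 - smult c (b\<^sup>2)))) - int (multiplicity \<pi> (b\<^sup>2))"
      unfolding eq using False ab by (intro prime_val_fract \<pi>) auto
    moreover have "multiplicity \<pi> (b\<^sup>2) = 0"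
      using nd \<pi>(1) by (metis not_dvd_imp_multiplicity_0 prime_elem_dvd_power)
    moreover have "to_fract [:c:] - 1 * z\<^sup>2 \<noteq> 0" unfolding eq using False ab by simp
    ultimately have "multiplicity \<pi> (- (a\<^sup>2 - smult c (b\<^sup>2))) \<ge> 1"
      using z(2) prime_val_const[OF \<pi>(1) c0] by (auto simp: vge_def)
    then have "\<pi> dvd - (a\<^sup>2 - smult c (b\<^sup>2))"
      by (metis not_dvd_imp_multiplicity_0 not_one_le_zero)
    then show ?thesis by (simp only: dvd_minus_iff)
  qed simp
  then show False using odd_prime_dvd_norm_form[OF c \<pi>] nd by blast
qed

abbreviation cst :: "'a::field_gcd \<Rightarrow> 'a poly fract" where "cst a \<equiv> to_fract [:a:]"

lemma squarefree_multiplicity_le: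
  fixes f :: "'a::field_gcd poly"
  assumes "squarefree f" "prime_elem \<pi>"
  shows "multiplicity \<pi> f \<le> 1"
proof (rule ccontr)
  assume "\<not> ?thesis"
  then have "\<pi> ^ 2 dvd f" by (intro multiplicity_dvd') simp
  then show False using squarefreeD[OF assms(1)] prime_elem_not_unit[OF assms(2)] by blast
qed

section \<open>The pencil attached to a polynomial of odd degree: choice of the prime\<close>

locale surface_parameters =
  fixes c d \<kappa> :: "'a::field_gcd" and T :: "'a poly"
  assumes two: "(2::'a) \<noteq> 0" and c_nonsquare: "\<nexists>z. z\<^sup>2 = c" and d_nonsquare: "\<nexists>z. z\<^sup>2 = d"
    and cd_sum: "c + d = 1" and cd_prod: "c * d = \<kappa>\<^sup>2"
    and odd_degree: "odd (degree T)" and squarefree_T: "squarefree T"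
    and squarefree_S: "squarefree (1 - smult (c * d) T)"
begin

definition S :: "'a poly" where "S = 1 - smult (c * d) T"

lemma nonzero: "c \<noteq> 0" "d \<noteq> 0" "T \<noteq> 0" "S \<noteq> 0" "degree T > 0"
proof -
  show cd: "c \<noteq> 0" "d \<noteq> 0" using c_nonsquare d_nonsquare by (metis power_zero_numeral)+
  show T: "T \<noteq> 0" "degree T > 0" using odd_degree by (auto intro: Nat.gr0I)
  show "S \<noteq> 0"
  proof
    assume "S = 0"
    then have "degree (smult (c * d) T) = 0" by (simp add: S_def)
    then show False using T cd by simp
  qed
qed

lemma degree_S: "degree S = degree T"
proof -
  have "degree (smult (c * d) T) = degree T" using nonzero by simp
  then have "degree (- smult (c * d) T + 1) = degree T"
    using nonzero(5) by (subst degree_add_eq_left) auto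
  then show ?thesis by (simp add: S_def)
qed

lemma to_fract_S: "to_fract S = 1 - cst c * cst d * to_fract T"
proof -
  have "smult (c * d) T = [:c:] * [:d:] * T" by (simp add: mult.commute)
  then show ?thesis unfolding S_def by (simp only: to_fract_diff to_fract_mult to_fract_1)
qed

lemma cst_nonzero: "cst c \<noteq> 0" "cst d \<noteq> 0" "to_fract T \<noteq> 0" "to_fract S \<noteq> 0"
  using nonzero by simp_all

lemma cst_sum: "cst c + cst d = 1"
  and cst_prod: "cst c * cst d = (cst \<kappa>)\<^sup>2"
proof -
  have "[:c:] + [:d:] = 1" using cd_sum by (simp add: one_pCons)
  then show "cst c + cst d = 1" by (simp only: to_fract_1 flip: to_fract_add)
  have "[:c:] * [:d:] = [:\<kappa>:] * [:\<kappa>:]" using cd_prod by (simp add: power2_eq_square mult.commute)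
  then show "cst c * cst d = (cst \<kappa>)\<^sup>2" by (simp only: power2_eq_square flip: to_fract_mult)
qed

lemma val_T_S:
  assumes "prime_elem \<pi>"
  shows "prime_val \<pi> (to_fract T) = int (multiplicity \<pi> T)" "multiplicity \<pi> T \<le> 1"
    "prime_val \<pi> (to_fract S) = int (multiplicity \<pi> S)" "multiplicity \<pi> S \<le> 1"
    "multiplicity \<pi> T = 0 \<or> multiplicity \<pi> S = 0"
proof -
  show "prime_val \<pi> (to_fract T) = int (multiplicity \<pi> T)" "prime_val \<pi> (to_fract S) = int (multiplicity \<pi> S)"
    using assms nonzero by (simp_all add: prime_val_to_fract)
  show "multiplicity \<pi> T \<le> 1" "multiplicity \<pi> S \<le> 1"
    unfolding S_def by (rule squarefree_multiplicity_le[OF squarefree_T assms]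
        squarefree_multiplicity_le[OF squarefree_S assms])+
  have "\<not> (\<pi> dvd T \<and> \<pi> dvd S)"
  proof
    assume "\<pi> dvd T \<and> \<pi> dvd S"
    then have "\<pi> dvd S + smult (c * d) T" by (intro dvd_add dvd_smult) auto
    then have "is_unit \<pi>" by (simp add: S_def)
    then show False using prime_elem_not_unit[OF assms] by blast
  qed
  then show "multiplicity \<pi> T = 0 \<or> multiplicity \<pi> S = 0" 
    using not_dvd_imp_multiplicity_0[of \<pi> T] not_dvd_imp_multiplicity_0[of \<pi> S]
    by (cases "\<pi> dvd T") simp_all
qed

text \<open>The numerator of \<open>\<lambda>\<^sup>2 + T - c T\<^sup>2\<close> is a norm from the constant quadratic extension up to terms
  of lower degree, so its degree is even.\<close>

lemma numerator_g:
  fixes a b :: "'a poly"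
  assumes "b \<noteq> 0"
  defines "G \<equiv> a\<^sup>2 + T * b\<^sup>2 - smult c (T\<^sup>2 * b\<^sup>2)"
  shows "even (degree G)" "G \<noteq> 0"
    "(to_fract a / to_fract b)\<^sup>2 + to_fract T - cst c * (to_fract T)\<^sup>2 = to_fract G / to_fract (b\<^sup>2)"
proof -
  define N where "N = a\<^sup>2 - smult c ((T * b)\<^sup>2)"
  have Tb: "T * b \<noteq> 0" using assms nonzero by simp
  have N: "degree N = 2 * max (degree a) (degree (T * b))" "N \<noteq> 0"
    using degree_norm_form[OF c_nonsquare, of a "T * b"] Tb by (simp_all add: N_def)
  have G: "G = N + T * b\<^sup>2" by (simp add: G_def N_def power_mult_distrib)
  have "degree (T * b\<^sup>2) = degree T + 2 * degree b" "degree (T * b) = degree T + degree b"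
    using assms nonzero by (simp_all add: degree_mult_eq degree_power_eq)
  then have "degree (T * b\<^sup>2) < degree N"
    using N(1) nonzero(5) max.cobounded2[of "degree (T * b)" "degree a"] by linarith
  then have "degree G = degree N" unfolding G by (rule degree_add_eq_left)
  then show "even (degree G)" using N by simp
  show "G \<noteq> 0" using \<open>degree (T * b\<^sup>2) < degree N\<close> \<open>degree G = degree N\<close> by auto
  have "to_fract (smult c (T\<^sup>2 * b\<^sup>2)) = cst c * to_fract (T\<^sup>2 * b\<^sup>2)" by (simp flip: to_fract_mult)
  then show "(to_fract a / to_fract b)\<^sup>2 + to_fract T - cst c * (to_fract T)\<^sup>2 = to_fract G / to_fract (b\<^sup>2)"
    using assms(1) unfolding G_def by (simp add: field_simps power2_eq_square)
qed

lemma exists_prime_T: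
  obtains \<pi> where "prime_elem \<pi>" "odd (degree \<pi>)" "multiplicity \<pi> T = 1"
proof -
  obtain \<pi> where \<pi>: "prime_elem \<pi>" "odd (degree \<pi>)" "odd (multiplicity \<pi> T)"
    using odd_degree_prime[OF odd_degree] .
  moreover have "multiplicity \<pi> T \<le> 1" using \<pi> val_T_S by blast
  ultimately show thesis by (intro that[of \<pi>]) (auto elim: oddE)
qed

text \<open>As a polynomial in \<open>l\<close> the expression is Eisenstein at a prime dividing
  \<open>T\<close> exactly once, so it has no root in the field.\<close>

lemma h_nonzero: "l\<^sup>2 - to_fract T * l + to_fract T \<noteq> 0"
proof -
  obtain \<pi> where \<pi>: "prime_elem \<pi>" "odd (degree \<pi>)" "multiplicity \<pi> T = 1" by (rule exists_prime_T)
  interpret valuation "prime_val \<pi>" by (rule valuation_prime_val[OF \<pi>(1) two])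
  let ?T = "to_fract T"
  have vT: "prime_val \<pi> ?T = 1" using val_T_S[OF \<pi>(1)] \<pi> by simp
  show ?thesis
  proof (cases "vge 1 l")
    case True
    then have "vge 2 (l * l - ?T * l)"
      using vge_mult[OF True True] vge_mult[OF vge_self[of ?T] True] vT by (intro vge_diff) auto
    then have "?T + (l * l - ?T * l) \<noteq> 0" using vT cst_nonzero by (intro v_near) auto
    then show ?thesis by (simp add: power2_eq_square algebra_simps)
  next
    case False
    then have l: "l \<noteq> 0" "prime_val \<pi> l \<le> 0" by (auto simp: vge_def)
    have "vge (1 + prime_val \<pi> l) (?T * l)" using vge_mult[OF vge_self vge_self, of ?T l] vT by simp
    then have "vge (2 * prime_val \<pi> l + 1) (?T - ?T * l)"
      using vge_self[of ?T] vT l by (intro vge_diff) (auto elim: vge_mono)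
    then have "l\<^sup>2 + (?T - ?T * l) \<noteq> 0" using l by (intro v_near) (auto simp: v_power)
    then show ?thesis by (simp add: algebra_simps)
  qed
qed

theorem no_pencil_plane: "\<not> pencil_plane (cst c) (cst d) (to_fract T) l"
proof
  assume plane: "pencil_plane (cst c) (cst d) (to_fract T) l"
  obtain a b where ab: "l = to_fract a / to_fract b" "b \<noteq> 0" using fract_repr[of l] by metis
  define G where "G = a\<^sup>2 + T * b\<^sup>2 - smult c (T\<^sup>2 * b\<^sup>2)"
  note G = numerator_g[OF ab(2), of a, folded G_def ab(1)]
  have "odd (degree (S * G))" using G nonzero odd_degree by (simp add: degree_mult_eq degree_S)
  then obtain \<pi> where \<pi>: "prime_elem \<pi>" "odd (degree \<pi>)" "odd (multiplicity \<pi> (S * G))"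
    by (rule odd_degree_prime)
  interpret valuation "prime_val \<pi>" by (rule valuation_prime_val[OF \<pi>(1) two])
  have cd: "prime_val \<pi> (cst c - cst d) = 0" if "cst c \<noteq> cst d"
    using prime_val_const[OF \<pi>(1), of "c - d"] that by (simp flip: to_fract_diff)
  interpret pencil_at_prime "prime_val \<pi>" "cst c" "cst d" "cst \<kappa>" "to_fract T" "to_fract S" l
    by standard (use cst_nonzero nonzero cst_sum cst_prod to_fract_S G h_nonzero plane prime_val_const[OF \<pi>(1)]
      not_sim_nonsquare[OF \<pi>(1,2) two c_nonsquare] cd ab(2) in auto)
  have "multiplicity \<pi> (S * G) = multiplicity \<pi> S + multiplicity \<pi> G"
    using \<pi> G nonzero by (simp add: prime_elem_multiplicity_mult_distrib)
  moreover have "prime_val \<pi> g = int (multiplicity \<pi> G) - 2 * int (multiplicity \<pi> b)"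
    using prime_val_fract[OF \<pi>(1) G(2), of "b\<^sup>2"] ab(2) \<pi>(1)
    by (simp add: g_def G(3) prime_elem_multiplicity_power_distrib)
  ultimately have odd: "odd (prime_val \<pi> (to_fract S) + prime_val \<pi> g)"
    using \<pi>(3) val_T_S[OF \<pi>(1)] by simp
  \<comment> \<open>\<open>T\<close> and \<open>S\<close> are squarefree and coprime. The total
    parity is odd, so the valuation of \<open>g\<close> is odd in the first two cases and even in
    the last, as the three local lemmas require.\<close>
  consider "multiplicity \<pi> T = 0" "multiplicity \<pi> S = 0" | "multiplicity \<pi> T = 1" "multiplicity \<pi> S = 0"
    | "multiplicity \<pi> S = 1"
    using val_T_S[OF \<pi>(1)] by linarith
  then show False
    by cases (use odd val_T_S[OF \<pi>(1)] good_prime prime_dvd_T prime_dvd_s in auto)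
qed

text \<open>At a prime of odd degree dividing \<open>S\<close> once, \<open>T\<close> is a local
  square. The form splits by parity into two binary forms, each anisotropic because \<open>d\<close>
  is not a square, and a descent between them shows that all terms vanish.\<close>

lemma quaternary_form_anisotropic:
  assumes eq: "x0\<^sup>2 - to_fract T * to_fract S * x1\<^sup>2 - cst d * to_fract T * x2\<^sup>2
      + cst d * to_fract T * to_fract S * x3\<^sup>2 = 0"
  shows "x0 = 0" "x1 = 0" "x2 = 0" "x3 = 0"
proof -
  have "odd (degree S)" using degree_S odd_degree by simp
  then obtain \<pi> where \<pi>: "prime_elem \<pi>" "odd (degree \<pi>)" "odd (multiplicity \<pi> S)"
    by (rule odd_degree_prime)
  interpret valuation "prime_val \<pi>" by (rule valuation_prime_val[OF \<pi>(1) two])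
  note val = val_T_S[OF \<pi>(1)]
  let ?v = "prime_val \<pi>" and ?T = "to_fract T" and ?S = "to_fract S" and ?c = "cst c" and ?d = "cst d"
  have mS: "multiplicity \<pi> S = 1" "multiplicity \<pi> T = 0" using \<pi>(3) val by (auto elim: oddE)
  have v: "?v ?S = 1" "?v ?T = 0" "?v ?d = 0" using mS val prime_val_const[OF \<pi>(1)] nonzero by auto
  note nz = cst_nonzero
  have "vge 1 ?S" using v by (simp add: vge_def)
  then have "sim (?c * ?d * ?T) 1" using sim_near[of 1 "?c * ?d * ?T"] vge_minus[of 1 ?S] by (simp add: to_fract_S)
  then have "sim (?T * (cst \<kappa>)\<^sup>2) 1" by (simp add: ac_simps flip: cst_prod)
  then have T1: "sim ?T 1" by (rule sim_cancel_sq)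
  have nd: "\<not> sim ?d 1" by (rule not_sim_nonsquare[OF \<pi>(1,2) two d_nonsquare])
  have an1: "\<not> sim (- (1 * - (?d * ?T))) 1"
  proof
    assume "sim (- (1 * - (?d * ?T))) 1"
    from sim_mult[OF this T1] have "sim (?d * ?T\<^sup>2) 1" by (simp add: power2_eq_square ac_simps)
    then show False using nd sim_cancel_sq by blast
  qed
  have an2: "\<not> sim (- (- (?T * ?S) * (?d * ?T * ?S))) 1"
  proof
    assume "sim (- (- (?T * ?S) * (?d * ?T * ?S))) 1"
    then have "sim (?d * (?T * ?S)\<^sup>2) 1" by (simp add: power2_eq_square ac_simps)
    then show False using nd sim_cancel_sq by blast
  qed
  define e0 e1 e2 e3 where "e0 = 1 * x0\<^sup>2" and "e1 = - (?T * ?S) * x1\<^sup>2" and "e2 = - (?d * ?T) * x2\<^sup>2"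
    and "e3 = ?d * ?T * ?S * x3\<^sup>2"
  note e_def = e0_def e1_def e2_def e3_def
  have sum0: "e0 + e2 = - (e1 + e3)" using eq unfolding e_def by Groebner_Basis.algebra
  have sp1: "vge n e0 \<and> vge n e2" if "vge n (e0 + e2)" for n
    using vge_sum_aniso_sq[OF _ _ an1] that nz by (simp add: e_def)
  have sp2: "vge n e1 \<and> vge n e3" if "vge n (e1 + e3)" for n
    using vge_sum_aniso_sq[OF _ _ an2] that nz by (simp add: e_def)
  have par: "e0 \<noteq> 0 \<Longrightarrow> even (?v e0)" "e2 \<noteq> 0 \<Longrightarrow> even (?v e2)" "e1 \<noteq> 0 \<Longrightarrow> odd (?v e1)" "e3 \<noteq> 0 \<Longrightarrow> odd (?v e3)"
    using v nz by (auto simp: e_def v_mult v_power)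
  have all: "e0 = 0 \<and> e1 = 0 \<and> e2 = 0 \<and> e3 = 0"
  proof (rule ccontr)
    assume "\<not> ?thesis"
    then obtain z where z: "z \<in> {e0, e1, e2, e3} - {0}" "\<forall>x\<in>{e0, e1, e2, e3} - {0}. vge (?v z) x"
      using least_vge[of "{e0, e1, e2, e3} - {0}"] by auto
    have ge: "vge (?v z) e0" "vge (?v z) e1" "vge (?v z) e2" "vge (?v z) e3"
      using z(2) by (metis DiffI insertCI singletonD vge_0)+
    have "vge (?v z + 1) e0 \<and> vge (?v z + 1) e2 \<and> vge (?v z + 1) e1 \<and> vge (?v z + 1) e3"
    proof (cases "even (?v z)")
      case True
      have "vge (?v z + 1) e1" "vge (?v z + 1) e3"
        by (rule vge_parity[OF _ ge(2)] vge_parity[OF _ ge(4)]; use par True in simp)+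
      then show ?thesis using vge_add sp1 sum0 vge_minus by metis
    next
      case False
      have "vge (?v z + 1) e0" "vge (?v z + 1) e2"
        by (rule vge_parity[OF _ ge(1)] vge_parity[OF _ ge(3)]; use par False in simp)+
      then show ?thesis using vge_add sp2 sum0 vge_minus by metis
    qed
    then show False using z(1) vge_not[of z] by auto
  qed
  then show "x0 = 0" "x1 = 0" "x2 = 0" "x3 = 0" using nz by (simp_all add: e_def)
qed

end

no_notation fps_nth (infixl \<open>$\<close> 75)

section \<open>The surfaces and their quadratic points\<close>

lemma UNIV_5: "(UNIV :: 5 set) = {0, 1, 2, 3, 4}"
proof -
  have "card {0, 1, 2, 3, 4 :: 5} = 5" by simp
  then show ?thesis by (intro card_subset_eq[symmetric]) auto
qed

lemma eval5_add: "eval5 (F + G) x = eval5 F x + eval5 G x"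
  unfolding eval5_def
  by (rule setsum_keys_plus_distrib) (auto simp: algebra_simps)

lemma partial_add: "partial i (F + G) = partial i F + partial i G"
  unfolding partial_def
  by (rule setsum_keys_plus_distrib) (auto simp: algebra_simps single_add)

lemma eval5_single: "eval5 (Poly_Mapping.single m a) x = to_ac a * (\<Prod>i\<in>UNIV. x $ i ^ Poly_Mapping.lookup m i)"
  by (simp add: eval5_def)

lemma partial_single: "partial i (Poly_Mapping.single m a) =
    Poly_Mapping.single (m - Poly_Mapping.single i 1) (of_nat (Poly_Mapping.lookup m i) * a)"
  by (simp add: partial_def)

definition qmono :: "5 \<Rightarrow> 5 \<Rightarrow> 'a::zero \<Rightarrow> 'a poly5" where
  "qmono i j a = Poly_Mapping.single (Poly_Mapping.single i 1 + Poly_Mapping.single j 1) a"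

lemma prod_single: "(\<Prod>l\<in>UNIV. (x :: 'b::comm_monoid_mult ^ 5) $ l ^ Poly_Mapping.lookup (Poly_Mapping.single i (1::nat)) l) = x $ i"
proof -
  have "(\<Prod>l\<in>UNIV. x $ l ^ Poly_Mapping.lookup (Poly_Mapping.single i (1::nat)) l) = (\<Prod>l\<in>UNIV. if i = l then x $ l else 1)"
    by (intro prod.cong) (auto simp: lookup_single when_def)
  then show ?thesis by simp
qed

lemma eval5_qmono: "eval5 (qmono i j a) x = to_ac a * (x $ i * x $ j)"
  by (simp add: qmono_def eval5_single lookup_add power_add prod.distrib prod_single[unfolded One_nat_def])

lemma eval5_partial_qmono: "eval5 (partial k (qmono i j a)) x =
    to_ac a * ((if k = i then x $ j else 0) + (if k = j then x $ i else 0))"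
proof -
  let ?e = "\<lambda>i::5. Poly_Mapping.single i (1::nat)"
  have eq: "eval5 (partial k (qmono i j a)) x =
      to_ac (of_nat (Poly_Mapping.lookup (?e i) k + Poly_Mapping.lookup (?e j) k) * a) *
      (\<Prod>l\<in>UNIV. x $ l ^ Poly_Mapping.lookup (?e i + ?e j - ?e k) l)"
    by (simp only: qmono_def partial_single eval5_single lookup_add)
  have ei: "Poly_Mapping.lookup (?e i) k = (if k = i then 1 else 0)" for i
    by (auto simp: lookup_single when_def)
  have minus: "?e i + ?e j - ?e i = ?e j" "?e i + ?e j - ?e j = ?e i" by simp_all
  consider "k = i" "k = j" | "k = i" "k \<noteq> j" | "k \<noteq> i" "k = j" | "k \<noteq> i" "k \<noteq> j" by blast
  then show ?thesis
  proof cases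
    case 1
    then have ij: "k = i" "j = i" by simp_all
    have "?e i + ?e i - ?e i = ?e i" by simp
    then show ?thesis unfolding eq unfolding ij ei by (simp only: prod_single) (simp add: algebra_simps)
  next
    case 2
    then show ?thesis unfolding eq ei using minus(1) by (simp only: prod_single) simp
  next
    case 3
    then show ?thesis unfolding eq ei using minus(2) by (simp only: prod_single) simp
  next
    case 4
    \<comment> \<open>The coefficient is 0 here, so the truncated subtraction of exponents has no
      effect.\<close>
    then show ?thesis unfolding eq ei by simp
  qed
qed

lemma homogeneous_qmono: "homogeneous 2 (qmono i j a)"
proof -
  have "(\<Sum>l\<in>UNIV. Poly_Mapping.lookup (Poly_Mapping.single i (1::nat)) l) = 1" for i :: 5
  proof -
    have "(\<Sum>l\<in>UNIV. Poly_Mapping.lookup (Poly_Mapping.single i (1::nat)) l) = (\<Sum>l\<in>UNIV. if i = l then 1 else 0)"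
      by (intro sum.cong) (auto simp: lookup_single when_def)
    then show ?thesis by simp
  qed
  from this[of i] this[of j] show ?thesis
    by (auto simp: homogeneous_def qmono_def lookup_add sum.distrib)
qed

lemma homogeneous_add: "homogeneous d F \<Longrightarrow> homogeneous d G \<Longrightarrow> homogeneous d (F + G)"
  using keys_add[of F G] unfolding homogeneous_def by blast

lemma eval5_scale:
  assumes "homogeneous d F"
  shows "eval5 F (a *s x) = a ^ d * eval5 F x"
proof -
  have "eval5 F (a *s x) = (\<Sum>m\<in>Poly_Mapping.keys F. a ^ d * (to_ac (Poly_Mapping.lookup F m) *
      (\<Prod>i\<in>UNIV. x $ i ^ Poly_Mapping.lookup m i)))"
    unfolding eval5_def
  proof (intro sum.cong refl)
    fix m assume "m \<in> Poly_Mapping.keys F"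
    then have "(\<Sum>i\<in>UNIV. Poly_Mapping.lookup m i) = d" using assms by (simp add: homogeneous_def)
    then have "(\<Prod>i\<in>UNIV. (a *s x) $ i ^ Poly_Mapping.lookup m i) = a ^ d * (\<Prod>i\<in>UNIV. x $ i ^ Poly_Mapping.lookup m i)"
      by (simp add: power_mult_distrib prod.distrib flip: power_sum)
    then show "to_ac (Poly_Mapping.lookup F m) * (\<Prod>i\<in>UNIV. (a *s x) $ i ^ Poly_Mapping.lookup m i) =
       a ^ d * (to_ac (Poly_Mapping.lookup F m) * (\<Prod>i\<in>UNIV. x $ i ^ Poly_Mapping.lookup m i))"
      by simp
  qed
  then show ?thesis by (simp add: eval5_def sum_distrib_left)
qed

text \<open>The polar form, normalised so that its diagonal is \<open>A\<close> itself. It is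
  defined over any commutative ring because it is evaluated on polynomials, on fractions and in the
  algebraic closure.\<close>

definition bilA :: "'k::comm_ring_1 \<Rightarrow> 'k \<Rightarrow> 'k \<Rightarrow> (nat \<Rightarrow> 'k) \<Rightarrow> (nat \<Rightarrow> 'k) \<Rightarrow> 'k" where
  "bilA c d T x y = (let s = 1 - c * d * T in x 4 * y 4
     - c * T * (c * (x 0 * y 0) + s * (x 0 * y 1 + x 1 * y 0) + c * T * s * (x 1 * y 1))
     - c * T * ((d * T - 1) * (x 2 * y 2) - s * (x 2 * y 3 + x 3 * y 2) - s * (x 3 * y 3)))"

definition bilB :: "'k::comm_ring_1 \<Rightarrow> 'k \<Rightarrow> 'k \<Rightarrow> (nat \<Rightarrow> 'k) \<Rightarrow> (nat \<Rightarrow> 'k) \<Rightarrow> 'k" where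
  "bilB c d T x y = (let s = 1 - c * d * T in
     c * (x 0 * y 0 - T * s * (x 1 * y 1) - d * T * (x 2 * y 2) + d * T * s * (x 3 * y 3)))"

lemma pencil_bilinear: "pencil c d T l x y = bilA c d T x y - l * bilB c d T x y"
  by (simp add: pencil_def bilA_def bilB_def Let_def algebra_simps)

definition formA :: "'k::comm_ring_1 \<Rightarrow> 'k \<Rightarrow> 'k \<Rightarrow> 'k poly5" where
  "formA c d T = (let s = 1 - c * d * T in qmono 4 4 1 + qmono 0 0 (- c\<^sup>2 * T) + qmono 0 1 (- 2 * c * T * s)
     + qmono 1 1 (- c\<^sup>2 * T\<^sup>2 * s) + qmono 2 2 (- c * T * (d * T - 1)) + qmono 2 3 (2 * c * T * s)
     + qmono 3 3 (c * T * s))"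

definition formB :: "'k::comm_ring_1 \<Rightarrow> 'k \<Rightarrow> 'k \<Rightarrow> 'k poly5" where
  "formB c d T = (let s = 1 - c * d * T in qmono 0 0 c + qmono 1 1 (- c * T * s)
     + qmono 2 2 (- c * d * T) + qmono 3 3 (c * d * T * s))"

definition surface :: "'k::comm_ring_1 \<Rightarrow> 'k \<Rightarrow> 'k \<Rightarrow> 'k poly5 \<times> 'k poly5" where
  "surface c d T = (formA c d T, formB c d T)"

text \<open>The index is cast into the type \<open>5\<close>, hence read modulo 5. Only the values
  at 0, ..., 4 enter the forms.\<close>

definition coords :: "'k ^ 5 \<Rightarrow> nat \<Rightarrow> 'k" where
  "coords x i = x $ of_nat i"

lemma coords_simps: "coords x 0 = x $ 0" "coords x 1 = x $ 1" "coords x (Suc 0) = x $ 1" "coords x 2 = x $ 2"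
    "coords x 3 = x $ 3" "coords x 4 = x $ 4"
  by (simp_all add: coords_def)

lemma homogeneous_forms: "homogeneous 2 (formA c d T)" "homogeneous 2 (formB c d T)"
  by (simp_all add: formA_def formB_def Let_def homogeneous_add homogeneous_qmono)

lemma eval_formA: "eval5 (formA c d T) x = bilA (to_ac c) (to_ac d) (to_ac T) (coords x) (coords x)"
  by (simp add: formA_def bilA_def Let_def eval5_add eval5_qmono coords_simps algebra_simps power2_eq_square)

lemma eval_formB: "eval5 (formB c d T) x = bilB (to_ac c) (to_ac d) (to_ac T) (coords x) (coords x)"
  by (simp add: formB_def bilB_def Let_def eval5_add eval5_qmono coords_simps algebra_simps power2_eq_square)

lemma surface_points: "points (surface c d T) L = {proj_point x | x. x \<noteq> 0 \<and> (\<forall>i. x $ i \<in> L) \<and>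
    bilA (to_ac c) (to_ac d) (to_ac T) (coords x) (coords x) = 0 \<and>
    bilB (to_ac c) (to_ac d) (to_ac T) (coords x) (coords x) = 0}"
  by (simp add: points_def surface_def eval_formA eval_formB)

lemma proj_point_eqD:
  assumes "proj_point x = proj_point y"
  obtains a where "a \<noteq> 0" "x = a *s y"
proof -
  have "x = 1 *s x" by simp
  then have "x \<in> proj_point x" unfolding proj_point_def by (metis (mono_tags, lifting) CollectI one_neq_zero)
  then show thesis using that assms unfolding proj_point_def by auto
qed

lemma geom_point_eval:
  assumes "proj_point x \<in> geom_points V" "homogeneous d (fst V)" "homogeneous d' (snd V)"
  shows "x \<noteq> 0" "eval5 (fst V) x = 0" "eval5 (snd V) x = 0"
proof -
  obtain y where y: "proj_point x = proj_point y" "y \<noteq> 0" "eval5 (fst V) y = 0" "eval5 (snd V) y = 0"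
    using assms(1) by (auto simp: points_def)
  obtain a where "a \<noteq> 0" "x = a *s y" using proj_point_eqD[OF y(1)] .
  then show "x \<noteq> 0" "eval5 (fst V) x = 0" "eval5 (snd V) x = 0"
    using y eval5_scale[OF assms(2), of a y] eval5_scale[OF assms(3), of a y] by auto
qed

lemma rank_two_rows:
  fixes u w :: "'a::field ^ 5"
  assumes "\<And>\<alpha> \<beta>. \<alpha> *s u + \<beta> *s w = 0 \<Longrightarrow> \<alpha> = 0 \<and> \<beta> = 0"
  shows "rank (vector [u, w] :: 'a ^ 5 ^ 2) = 2"
proof -
  have w0: "w \<noteq> 0" using assms[of 0 1] by auto
  have us: "u \<noteq> \<alpha> *s w" for \<alpha> using assms[of 1 "- \<alpha>"] by auto
  then have "u \<notin> vec.span {w}" by (auto simp: vec.span_singleton)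
  moreover have "vec.independent {w}" using w0 by simp
  ultimately have ind: "vec.independent {u, w}" by (auto simp: vec.independent_insert)
  have "rows (vector [u, w] :: 'a ^ 5 ^ 2) = {u, w}"
  proof -
    have "row 1 (vector [u, w] :: 'a ^ 5 ^ 2) = u" "row 2 (vector [u, w] :: 'a ^ 5 ^ 2) = w"
      by (simp_all add: row_def vec_eq_iff)
    then show ?thesis unfolding rows_def using exhaust_2 by (auto, metis+)
  qed
  moreover have "u \<noteq> w" using us[of 1] by simp
  ultimately show ?thesis using vec.dim_eq_card_independent[OF ind] by (simp add: row_rank_def_gen)
qed

section \<open>Smoothness by the Jacobian criterion\<close>

lemma gradient_surface:
  fixes x :: "'k::field alg_closure ^ 5" and c d T :: 'k
  defines "C \<equiv> to_ac c" and "D \<equiv> to_ac d" and "\<tau> \<equiv> to_ac T"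
  defines "\<sigma> \<equiv> 1 - C * D * \<tau>"
  shows "gradient (formA c d T) x $ 0 = 2 * (- C\<^sup>2 * \<tau> * x $ 0 - C * \<tau> * \<sigma> * x $ 1)"
    "gradient (formA c d T) x $ 1 = 2 * (- C * \<tau> * \<sigma> * x $ 0 - C\<^sup>2 * \<tau>\<^sup>2 * \<sigma> * x $ 1)"
    "gradient (formA c d T) x $ 2 = 2 * (- C * \<tau> * (D * \<tau> - 1) * x $ 2 + C * \<tau> * \<sigma> * x $ 3)"
    "gradient (formA c d T) x $ 3 = 2 * (C * \<tau> * \<sigma> * x $ 2 + C * \<tau> * \<sigma> * x $ 3)"
    "gradient (formA c d T) x $ 4 = 2 * x $ 4"
    "gradient (formB c d T) x $ 0 = 2 * (C * x $ 0)"
    "gradient (formB c d T) x $ 1 = 2 * (- C * \<tau> * \<sigma> * x $ 1)"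
    "gradient (formB c d T) x $ 2 = 2 * (- C * D * \<tau> * x $ 2)"
    "gradient (formB c d T) x $ 3 = 2 * (C * D * \<tau> * \<sigma> * x $ 3)"
    "gradient (formB c d T) x $ 4 = 0"
  unfolding assms
  by (simp_all add: gradient_def formA_def formB_def Let_def partial_add eval5_add eval5_partial_qmono
      algebra_simps power2_eq_square)

text \<open>A relation between the gradients with \<open>\<alpha> \<noteq> 0\<close> makes the point
  singular on the member \<open>l = - \<beta> / \<alpha>\<close>; if \<open>\<alpha> = 0\<close> the
  first four coordinates vanish and \<open>A\<close> kills the last. Singular members are the roots
  of \<open>g\<close> and \<open>h\<close>. A common root forces
  \<open>\<tau> * \<sigma> = 0\<close>, and \<open>C * \<tau> \<noteq> 1\<close> and
  \<open>\<tau> \<noteq> 4\<close> say that neither polynomial in \<open>l\<close> has a double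
  root.\<close>

lemma jacobian_kernel:
  fixes C D \<tau> :: "'b::field"
  assumes nz: "C \<noteq> 0" "D \<noteq> 0" "\<tau> \<noteq> 0" "(2::'b) \<noteq> 0" and CD: "C + D = 1" and \<sigma>: "\<sigma> = 1 - C * D * \<tau>" "\<sigma> \<noteq> 0"
    and t: "C * \<tau> \<noteq> 1" "\<tau> \<noteq> 4"
    and A: "X4\<^sup>2 - C * \<tau> * (C * X0\<^sup>2 + 2 * \<sigma> * X0 * X1 + C * \<tau> * \<sigma> * X1\<^sup>2)
        - C * \<tau> * ((D * \<tau> - 1) * X2\<^sup>2 - 2 * \<sigma> * X2 * X3 - \<sigma> * X3\<^sup>2) = 0"
    and B: "X0\<^sup>2 - \<tau> * \<sigma> * X1\<^sup>2 - D * \<tau> * X2\<^sup>2 + D * \<tau> * \<sigma> * X3\<^sup>2 = 0"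
    and g0: "\<alpha> * (- C\<^sup>2 * \<tau> * X0 - C * \<tau> * \<sigma> * X1) + \<beta> * (C * X0) = 0"
    and g1: "\<alpha> * (- C * \<tau> * \<sigma> * X0 - C\<^sup>2 * \<tau>\<^sup>2 * \<sigma> * X1) + \<beta> * (- C * \<tau> * \<sigma> * X1) = 0"
    and g2: "\<alpha> * (- C * \<tau> * (D * \<tau> - 1) * X2 + C * \<tau> * \<sigma> * X3) + \<beta> * (- C * D * \<tau> * X2) = 0"
    and g3: "\<alpha> * (C * \<tau> * \<sigma> * X2 + C * \<tau> * \<sigma> * X3) + \<beta> * (C * D * \<tau> * \<sigma> * X3) = 0"
    and g4: "\<alpha> * X4 = 0" and x: "\<not> (X0 = 0 \<and> X1 = 0 \<and> X2 = 0 \<and> X3 = 0 \<and> X4 = 0)"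
  shows "\<alpha> = 0 \<and> \<beta> = 0"
proof (rule ccontr)
  assume neg: "\<not> ?thesis"
  have C: "C = 1 - D" using CD by (simp add: eq_diff_eq)
  have "\<alpha> \<noteq> 0"
  proof
    assume \<alpha>: "\<alpha> = 0"
    then have "\<beta> \<noteq> 0" using neg by simp
    then have "X0 = 0" "X1 = 0" "X2 = 0" "X3 = 0" using g0 g1 g2 g3 \<alpha> nz \<sigma>(2) by auto
    moreover from this have "X4 = 0" using A by simp
    ultimately show False using x by simp
  qed
  define l where "l = - \<beta> / \<alpha>"
  have \<beta>: "\<beta> = - \<alpha> * l" using \<open>\<alpha> \<noteq> 0\<close> by (simp add: l_def)
  have X4: "X4 = 0" using g4 \<open>\<alpha> \<noteq> 0\<close> by simp
  have "\<alpha> * C * ((C * \<tau> + l) * X0 + \<tau> * \<sigma> * X1) = 0" using g0 unfolding \<beta> by Groebner_Basis.algebra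
  then have e0: "(C * \<tau> + l) * X0 + \<tau> * \<sigma> * X1 = 0" using nz \<open>\<alpha> \<noteq> 0\<close> by simp
  have "\<alpha> * C * \<tau> * \<sigma> * (X0 - (l - C * \<tau>) * X1) = 0" using g1 unfolding \<beta> by Groebner_Basis.algebra
  then have e1: "X0 = (l - C * \<tau>) * X1" using nz \<sigma>(2) \<open>\<alpha> \<noteq> 0\<close> by simp
  have "\<alpha> * C * \<tau> * ((1 - D * \<tau> + D * l) * X2 + \<sigma> * X3) = 0" using g2 unfolding \<beta> by Groebner_Basis.algebra
  then have e2: "(1 - D * \<tau> + D * l) * X2 + \<sigma> * X3 = 0" using nz \<open>\<alpha> \<noteq> 0\<close> by simp
  have "\<alpha> * C * \<tau> * \<sigma> * (X2 - (D * l - 1) * X3) = 0" using g3 unfolding \<beta> by Groebner_Basis.algebra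
  then have e3: "X2 = (D * l - 1) * X3" using nz \<sigma>(2) \<open>\<alpha> \<noteq> 0\<close> by simp
  define g h where "g = (l - C * \<tau>) * (l + C * \<tau>) + \<tau> * \<sigma>" and "h = (1 - D * \<tau> + D * l) * (D * l - 1) + \<sigma>"
  have "X1 * g = 0" using e0 unfolding e1 g_def by Groebner_Basis.algebra
  then have g: "X1 = 0 \<or> g = 0" by simp
  have "X3 * h = 0" using e2 unfolding e3 h_def by Groebner_Basis.algebra
  then have h: "X3 = 0 \<or> h = 0" by simp
  have B': "X1\<^sup>2 * ((l - C * \<tau>)\<^sup>2 - \<tau> * \<sigma>) = D * \<tau> * X3\<^sup>2 * ((D * l - 1)\<^sup>2 - \<sigma>)"
    using B unfolding e1 e3 by Groebner_Basis.algebra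
  consider "X1 \<noteq> 0" "X3 \<noteq> 0" | "X1 \<noteq> 0" "X3 = 0" | "X1 = 0" "X3 \<noteq> 0" | "X1 = 0" "X3 = 0" by blast
  then show False
  proof cases
    case 1
    then have gh: "g = 0" "h = 0" using g h by auto
    have "h = D\<^sup>2 * (g - \<tau> * (l - C * \<tau>))" unfolding h_def g_def \<sigma>(1) C by Groebner_Basis.algebra
    then have "l = C * \<tau>" using gh nz by simp
    then have "\<tau> * \<sigma> = 0" using gh(1) by (simp add: g_def)
    then show False using nz \<sigma>(2) by simp
  next
    case 2
    then have g0: "g = 0" and "(l - C * \<tau>)\<^sup>2 - \<tau> * \<sigma> = 0" using g B' by auto
    \<comment> \<open>The sum of the two equations. Its factor \<open>2 * l\<close> is the
      derivative of \<open>g\<close> in \<open>l\<close>, so a singular point on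
      \<open>B = 0\<close> is a double root; in the next case \<open>2 * l - \<tau>\<close> plays
      this part for \<open>h\<close>.\<close>
    then have "2 * l * (l - C * \<tau>) = 0" unfolding g_def by Groebner_Basis.algebra
    then consider "l = 0" | "l = C * \<tau>" using nz(4) by auto
    then show False
    proof cases
      case 1
      have "\<tau> * (1 - C * \<tau>) = g" unfolding g_def 1 \<sigma>(1) C by Groebner_Basis.algebra
      then show False using g0 nz t by simp
    next
      case 2
      then have "\<tau> * \<sigma> = 0" using g0 by (simp add: g_def)
      then show False using nz \<sigma>(2) by simp
    qed
  next
    case 3
    then have h0: "h = 0" and h1: "(D * l - 1)\<^sup>2 - \<sigma> = 0" using h B' nz by auto
    then have "D * (D * l - 1) * (2 * l - \<tau>) = 0" unfolding h_def by Groebner_Basis.algebra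
    then consider "D * l = 1" | "2 * l = \<tau>" using nz by auto
    then show False
    proof cases
      case 1
      then show False using h1 \<sigma>(2) by simp
    next
      case 2
      have "l * (l - 2) * D\<^sup>2 = (D * l - 1)\<^sup>2 - \<sigma>" unfolding \<sigma>(1) 2[symmetric] C by Groebner_Basis.algebra
      then have "l = 0 \<or> l = 2" using h1 nz by simp
      then show False using 2 nz t by auto
    qed
  next
    case 4
    then show False using e1 e3 X4 x by simp
  qed
qed

lemma surface_quartic_del_pezzo:
  fixes c d T :: "'k::field"
  assumes "c \<noteq> 0" "d \<noteq> 0" "T \<noteq> 0" "(2::'k) \<noteq> 0" "c + d = 1" "1 - c * d * T \<noteq> 0" "c * T \<noteq> 1" "T \<noteq> 4"
  shows "quartic_del_pezzo (surface c d T)"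
  unfolding quartic_del_pezzo_def
proof (intro conjI allI impI)
  show hom: "homogeneous 2 (fst (surface c d T))" "homogeneous 2 (snd (surface c d T))"
    by (simp_all add: surface_def homogeneous_forms)
  fix x assume "proj_point x \<in> geom_points (surface c d T)"
  note x = geom_point_eval[OF this hom]
  let ?C = "to_ac c" and ?D = "to_ac d" and ?T = "to_ac T"
  show "rank (vector [gradient (fst (surface c d T)) x, gradient (snd (surface c d T)) x]
       :: 'k alg_closure ^ 5 ^ 2) = 2"
  proof (rule rank_two_rows)
    fix \<alpha> \<beta>
    assume "\<alpha> *s gradient (fst (surface c d T)) x + \<beta> *s gradient (snd (surface c d T)) x = 0"
    then have G: "\<alpha> * gradient (formA c d T) x $ i + \<beta> * gradient (formB c d T) x $ i = 0" for i
      by (auto simp: vec_eq_iff surface_def)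
    have two: "(2 :: 'k alg_closure) \<noteq> 0" using assms(4) by (metis to_ac_eq_0_iff to_ac_numeral)
    have two': "2 * u = 0 \<longleftrightarrow> u = 0" for u :: "'k alg_closure" using two by simp
    have facts: "?C * ?D * ?T \<noteq> 1" "?C * ?T \<noteq> 1" "?T \<noteq> 4" "?C + ?D = 1"
      using assms(5-) by (metis to_ac_eq_iff to_ac_mult to_ac_add to_ac_1 to_ac_numeral right_minus_eq)+
    show "\<alpha> = 0 \<and> \<beta> = 0"
    proof (rule jacobian_kernel)
      show "?C \<noteq> 0" "?D \<noteq> 0" "?T \<noteq> 0" using assms by simp_all
      show "(2 :: 'k alg_closure) \<noteq> 0" by (rule two)
      show "?C + ?D = 1" "1 - ?C * ?D * ?T \<noteq> 0" "?C * ?T \<noteq> 1" "?T \<noteq> 4" using facts by auto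
      show "1 - ?C * ?D * ?T = 1 - ?C * ?D * ?T" ..
      have gi: "\<alpha> * (2 * p) + \<beta> * (2 * q) = 2 * (\<alpha> * p + \<beta> * q)" for p q by (simp add: algebra_simps)
      show "\<alpha> * (- ?C\<^sup>2 * ?T * x $ 0 - ?C * ?T * (1 - ?C * ?D * ?T) * x $ 1) + \<beta> * (?C * x $ 0) = 0"
        "\<alpha> * (- ?C * ?T * (1 - ?C * ?D * ?T) * x $ 0 - ?C\<^sup>2 * ?T\<^sup>2 * (1 - ?C * ?D * ?T) * x $ 1)
          + \<beta> * (- ?C * ?T * (1 - ?C * ?D * ?T) * x $ 1) = 0"
        "\<alpha> * (- ?C * ?T * (?D * ?T - 1) * x $ 2 + ?C * ?T * (1 - ?C * ?D * ?T) * x $ 3)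
          + \<beta> * (- ?C * ?D * ?T * x $ 2) = 0"
        "\<alpha> * (?C * ?T * (1 - ?C * ?D * ?T) * x $ 2 + ?C * ?T * (1 - ?C * ?D * ?T) * x $ 3)
          + \<beta> * (?C * ?D * ?T * (1 - ?C * ?D * ?T) * x $ 3) = 0"
        using G[of 0] G[of 1] G[of 2] G[of 3] unfolding gradient_surface gi two' .
      show "\<alpha> * x $ 4 = 0" using G[of 4] unfolding gradient_surface using two by simp
      have "x $ i = 0" if "i \<in> {0, 1, 2, 3, 4}" "x $ 0 = 0 \<and> x $ 1 = 0 \<and> x $ 2 = 0 \<and> x $ 3 = 0 \<and> x $ 4 = 0" for i
        using that by auto
      then show "\<not> (x $ 0 = 0 \<and> x $ 1 = 0 \<and> x $ 2 = 0 \<and> x $ 3 = 0 \<and> x $ 4 = 0)"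
        using x(1) UNIV_5 by (metis UNIV_I vec_eq_iff zero_index)
      have "eval5 (formA c d T) x = 0" "eval5 (formB c d T) x = 0" using x(2,3) by (simp_all add: surface_def)
      then have E: "bilA ?C ?D ?T (coords x) (coords x) = 0" "bilB ?C ?D ?T (coords x) (coords x) = 0"
        by (simp_all add: eval_formA eval_formB)
      from E(1) show "(x $ 4)\<^sup>2 - ?C * ?T * (?C * (x $ 0)\<^sup>2 + 2 * (1 - ?C * ?D * ?T) * x $ 0 * x $ 1
           + ?C * ?T * (1 - ?C * ?D * ?T) * (x $ 1)\<^sup>2)
        - ?C * ?T * ((?D * ?T - 1) * (x $ 2)\<^sup>2 - 2 * (1 - ?C * ?D * ?T) * x $ 2 * x $ 3
           - (1 - ?C * ?D * ?T) * (x $ 3)\<^sup>2) = 0"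
        unfolding bilA_def Let_def coords_simps by Groebner_Basis.algebra
      have "?C * ((x $ 0)\<^sup>2 - ?T * (1 - ?C * ?D * ?T) * (x $ 1)\<^sup>2 - ?D * ?T * (x $ 2)\<^sup>2
          + ?D * ?T * (1 - ?C * ?D * ?T) * (x $ 3)\<^sup>2) = 0"
        using E(2) unfolding bilB_def Let_def coords_simps by Groebner_Basis.algebra
      then show "(x $ 0)\<^sup>2 - ?T * (1 - ?C * ?D * ?T) * (x $ 1)\<^sup>2 - ?D * ?T * (x $ 2)\<^sup>2
          + ?D * ?T * (1 - ?C * ?D * ?T) * (x $ 3)\<^sup>2 = 0"
        using assms by simp
    qed
  qed
qed

section \<open>From quadratic points to lines on members of the pencil\<close>

lemma quadratic_extension_basis:
  fixes K :: "'k::field alg_closure set"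
  assumes "quadratic_extension K"
  obtains u w where "u \<noteq> 0" "\<And>a b. to_ac a * u + to_ac b * w = 0 \<Longrightarrow> a = 0 \<and> b = 0"
    "\<And>z. z \<in> K \<Longrightarrow> \<exists>a b. z = to_ac a * u + to_ac b * w"
proof -
  let ?R = "ring_of_type_algebra :: 'k alg_closure ring" and ?k = "range (to_ac :: 'k \<Rightarrow> 'k alg_closure)"
  interpret R: ring ?R by (rule ring_from_type_algebra)
  have dim: "R.dimension (Suc (Suc 0)) ?k K"
    using assms by (simp add: quadratic_extension_def numeral_2_eq_2)
  then obtain w E where w: "w \<notin> E" "R.dimension (Suc 0) ?k E" "K = R.line_extension ?k w E"
    by (cases rule: R.dimension.cases) auto
  from w(2) obtain u E0 where u: "u \<notin> E0" "R.dimension 0 ?k E0" "E = R.line_extension ?k u E0"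
    by (cases rule: R.dimension.cases) auto
  have "E0 = {\<zero>\<^bsub>?R\<^esub>}" using u(2) by (cases rule: R.dimension.cases) auto
  then have E0: "E0 = {0}" by (simp add: ring_of_type_algebra_def)
  have ops: "x \<otimes>\<^bsub>?R\<^esub> y = x * y" "x \<oplus>\<^bsub>?R\<^esub> y = x + y" for x y
    by (simp_all add: ring_of_type_algebra_def)
  have E: "z \<in> E \<longleftrightarrow> (\<exists>a. z = to_ac a * u)" for z
    unfolding u(3) R.line_extension_mem_iff E0 ops by auto
  have K: "\<exists>a b. z = to_ac a * u + to_ac b * w" if z: "z \<in> K" for z
  proof -
    obtain b e where "e \<in> E" "z = to_ac b * w + e"
      using z unfolding w(3) R.line_extension_mem_iff ops by blast
    then show ?thesis using E by (metis add.commute)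
  qed
  have u0: "u \<noteq> 0" using u(1) E0 by simp
  have ind: "a = 0 \<and> b = 0" if "to_ac a * u + to_ac b * w = 0" for a b
  proof -
    have "b = 0"
    proof (rule ccontr)
      assume b: "b \<noteq> 0"
      have "to_ac b * w = - (to_ac a * u)" using that by (simp add: eq_neg_iff_add_eq_0 add.commute)
      then have "w = to_ac (- a / b) * u" using b by (simp add: field_simps)
      then show False using w(1) E by blast
    qed
    then show ?thesis using that u0 by simp
  qed
  show thesis using that[of u w] u0 ind K by blast
qed

lemma bil_combination:
  fixes c d T :: "'k::field"
  shows "bilA (to_ac c) (to_ac d) (to_ac T) (\<lambda>i. to_ac (x i) * u + to_ac (y i) * w) (\<lambda>i. to_ac (x i) * u + to_ac (y i) * w)
     = to_ac (bilA c d T x x) * u\<^sup>2 + to_ac (2 * bilA c d T x y) * (u * w) + to_ac (bilA c d T y y) * w\<^sup>2"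
    and "bilB (to_ac c) (to_ac d) (to_ac T) (\<lambda>i. to_ac (x i) * u + to_ac (y i) * w) (\<lambda>i. to_ac (x i) * u + to_ac (y i) * w)
     = to_ac (bilB c d T x x) * u\<^sup>2 + to_ac (2 * bilB c d T x y) * (u * w) + to_ac (bilB c d T y y) * w\<^sup>2"
  unfolding bilA_def bilB_def Let_def
  by (simp_all only: to_ac_add to_ac_diff to_ac_mult to_ac_1 to_ac_numeral) (Groebner_Basis.algebra+)

context surface_parameters
begin

abbreviation dp4 :: "'a poly fract poly5 \<times> 'a poly fract poly5" where
  "dp4 \<equiv> surface (cst c) (cst d) (to_fract T)"

lemma bilB_eq_0D:
  assumes "bilB (cst c) (cst d) (to_fract T) x x = 0" "i < 4"
  shows "x i = 0"
proof -
  have "cst c * ((x 0)\<^sup>2 - to_fract T * to_fract S * (x 1)\<^sup>2 - cst d * to_fract T * (x 2)\<^sup>2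
      + cst d * to_fract T * to_fract S * (x 3)\<^sup>2) = 0"
    using assms(1) unfolding bilB_def Let_def to_fract_S by Groebner_Basis.algebra
  then have "x 0 = 0" "x 1 = 0" "x 2 = 0" "x 3 = 0"
    using quaternary_form_anisotropic[of "x 0" "x 1" "x 2" "x 3"] cst_nonzero by auto
  moreover have "i = 0 \<or> i = 1 \<or> i = 2 \<or> i = 3" using assms(2) by auto
  ultimately show ?thesis by auto
qed

text \<open>Writing the point as \<open>a u + b w\<close> with \<open>a\<close>, \<open>b\<close>
  over the base field turns each equation into a relation between the squares and the product of
  \<open>u\<close> and \<open>w\<close>. Subtracting a multiple to remove the square of
  \<open>w\<close> leaves \<open>u\<close> times a linear relation, whose coefficients must
  vanish.\<close>

theorem no_quadratic_points:
  assumes K: "quadratic_extension K"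
  shows "points dp4 K = {}"
proof (rule ccontr)
  assume "points dp4 K \<noteq> {}"
  let ?c = "cst c" and ?d = "cst d" and ?T = "to_fract T"
  obtain x :: "'a poly fract alg_closure ^ 5" where x: "x \<noteq> 0" "\<And>i. x $ i \<in> K"
     "bilA (to_ac ?c) (to_ac ?d) (to_ac ?T) (coords x) (coords x) = 0"
     "bilB (to_ac ?c) (to_ac ?d) (to_ac ?T) (coords x) (coords x) = 0"
    using \<open>points dp4 K \<noteq> {}\<close> unfolding surface_points by auto
  obtain u w where uw: "u \<noteq> 0" "\<And>a b. to_ac a * u + to_ac b * w = 0 \<Longrightarrow> a = 0 \<and> b = 0"
    "\<And>z. z \<in> K \<Longrightarrow> \<exists>a b. z = to_ac a * u + to_ac b * w" using quadratic_extension_basis[OF K] by metis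
  have "\<forall>i. \<exists>a b. coords x i = to_ac a * u + to_ac b * w" using uw(3) x(2) by (simp add: coords_def)
  then obtain a b where ab: "\<And>i. coords x i = to_ac (a i) * u + to_ac (b i) * w" by metis
  then have cx: "coords x = (\<lambda>i. to_ac (a i) * u + to_ac (b i) * w)" by auto
  let ?A = "bilA ?c ?d ?T" and ?B = "bilB ?c ?d ?T"
  have two: "(2 :: 'a poly fract) \<noteq> 0"
    using valuation.two_nonzero[OF valuation_prime_val] exists_prime_T two by metis
  note E = x(3,4)[unfolded cx bil_combination]
  have rel: "\<alpha> = 0 \<and> \<beta> = 0" if "to_ac \<alpha> * u\<^sup>2 + to_ac \<beta> * (u * w) = 0" for \<alpha> \<beta>
  proof -
    have "u * (to_ac \<alpha> * u + to_ac \<beta> * w) = 0" using that by (simp add: power2_eq_square algebra_simps)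
    then show ?thesis using uw by simp
  qed
  have x_eq_0: False if "\<And>i. i < 5 \<Longrightarrow> coords x i = 0"
  proof -
    have "x $ i = 0" for i
      using that[of 0] that[of 1] that[of 2] that[of 3] that[of 4] UNIV_I[of i]
      unfolding UNIV_5 coords_simps by auto
    then show False using x(1) by (simp add: vec_eq_iff)
  qed
  show False
  proof (cases "?B b b = 0")
    case True
    \<comment> \<open>\<open>B\<close> itself is isotropic on \<open>a\<close> and on
      \<open>b\<close>. By anisotropy only the coordinate \<open>Y\<close> survives, and
      \<open>A\<close> kills it.\<close>
    then have "to_ac (?B a a) * u\<^sup>2 + to_ac (2 * ?B a b) * (u * w) = 0" using E(2) by simp
    then have "?B a a = 0" using rel by blast
    then have ab0: "a i = 0" "b i = 0" if "i < 4" for i using bilB_eq_0D True that by blast+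
    then have c0: "coords x i = 0" if "i < 4" for i using ab that by simp
    have "bilA (to_ac ?c) (to_ac ?d) (to_ac ?T) (coords x) (coords x) = coords x 4 * coords x 4"
      unfolding bilA_def Let_def using c0[of 0] c0[of 1] c0[of 2] c0[of 3] by simp
    then have "coords x 4 = 0" using x(3) by simp
    then have "coords x i = 0" if "i < 5" for i using c0[of i] that by (cases "i = 4") auto
    then show False by (rule x_eq_0)
  next
    case False
    \<comment> \<open>With this \<open>l\<close> the member \<open>A - l B\<close> vanishes at
      \<open>b\<close>, and then on the whole span of \<open>a\<close> and \<open>b\<close>.\<close>
    define l where "l = ?A b b / ?B b b"
    have "to_ac (?A a a - l * ?B a a) * u\<^sup>2 + to_ac (2 * (?A a b - l * ?B a b)) * (u * w)
        + to_ac (?A b b - l * ?B b b) * w\<^sup>2 = 0"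
      using E unfolding to_ac_diff to_ac_mult by Groebner_Basis.algebra
    moreover have bb: "?A b b - l * ?B b b = 0" using False by (simp add: l_def)
    ultimately have "to_ac (?A a a - l * ?B a a) * u\<^sup>2 + to_ac (2 * (?A a b - l * ?B a b)) * (u * w) = 0" by simp
    from rel[OF this] have P: "pencil ?c ?d ?T l a a = 0" "pencil ?c ?d ?T l a b = 0" "pencil ?c ?d ?T l b b = 0"
      using bb two by (simp_all add: pencil_bilinear)
    have "\<forall>i<5. \<forall>j<5. a i * b j = a j * b i"
      using no_pencil_plane[of l] P unfolding pencil_plane_def by blast
    moreover obtain j where j: "j < 4" "b j \<noteq> 0"
    proof -
      have "\<exists>j<4. b j \<noteq> 0"
      proof (rule ccontr)
        assume "\<not> ?thesis"
        then have "b 0 = 0" "b 1 = 0" "b 2 = 0" "b 3 = 0" by auto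
        then show False using False unfolding bilB_def Let_def by simp
      qed
      then show thesis using that by auto
    qed
    \<comment> \<open>No plane exists, so \<open>a\<close> and \<open>b\<close> are proportional and
      the point is rational up to a scalar \<open>z\<close>. But then \<open>B\<close> takes the
      nonzero value \<open>?B b b\<close> times a square there.\<close>
    ultimately have minors: "a i * b j = a j * b i" if "i < 5" for i using that by auto
    define z where "z = to_ac (a j / b j) * u + 1 * w"
    have z: "z \<noteq> 0" using uw(2)[of "a j / b j" 1] by (auto simp: z_def)
    have cz: "coords x i = to_ac (b i) * z" if "i < 5" for i
    proof -
      have "a i = b i * (a j / b j)" using minors[OF that] j by (simp add: field_simps)
      then have "to_ac (a i) = to_ac (b i) * to_ac (a j / b j)" by (metis to_ac_mult)
      then show ?thesis unfolding ab z_def by (simp add: algebra_simps)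
    qed
    have "bilB (to_ac ?c) (to_ac ?d) (to_ac ?T) (coords x) (coords x) = to_ac (?B b b) * z\<^sup>2"
      unfolding bilB_def Let_def using cz[of 0] cz[of 1] cz[of 2] cz[of 3]
      by (simp add: power2_eq_square algebra_simps)
    then show False using x(4) z False by simp
  qed
qed

lemma quartic_del_pezzo_dp4: "quartic_del_pezzo dp4"
proof (rule surface_quartic_del_pezzo)
  show "cst c \<noteq> 0" "cst d \<noteq> 0" "to_fract T \<noteq> 0" "cst c + cst d = 1" by (fact cst_nonzero cst_sum)+
  show "(2 :: 'a poly fract) \<noteq> 0"
    using valuation.two_nonzero[OF valuation_prime_val] exists_prime_T two by metis
  show "1 - cst c * cst d * to_fract T \<noteq> 0" using cst_nonzero by (simp flip: to_fract_S)
  show "cst c * to_fract T \<noteq> 1"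
  proof
    assume "cst c * to_fract T = 1"
    then have "[:c:] * T = 1" by (simp flip: to_fract_mult to_fract_1)
    then have "degree ([:c:] * T) = 0" by simp
    then show False using nonzero by simp
  qed
  show "to_fract T \<noteq> 4"
  proof
    assume "to_fract T = 4"
    also have "4 = to_fract (1 + 1 + 1 + 1)" unfolding to_fract_add to_fract_1 by simp
    finally have "T = 1 + 1 + 1 + 1" by (simp only: to_fract_eq_iff)
    then have "T = [:4:]" by (simp add: one_pCons)
    then show False using nonzero by simp
  qed
qed

end

section \<open>Points over biquadratic fields\<close>

lemma eval5_closed:
  fixes x :: "'k::field alg_closure ^ 5"
  assumes "range to_ac \<subseteq> L" "\<And>x y. x \<in> L \<Longrightarrow> y \<in> L \<Longrightarrow> x + y \<in> L"
    "\<And>x y. x \<in> L \<Longrightarrow> y \<in> L \<Longrightarrow> x * y \<in> L" "\<And>i. x $ i \<in> L"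
  shows "eval5 F x \<in> L"
proof -
  have 01: "0 \<in> L" "1 \<in> L" using assms(1) to_ac_0 to_ac_1 by (metis rangeI subsetD)+
  have pow: "z ^ n \<in> L" if "z \<in> L" for z n using that 01 assms(3) by (induction n) auto
  have prod: "(\<Prod>i\<in>A. f i) \<in> L" if "finite A" "\<And>i. i \<in> A \<Longrightarrow> f i \<in> L" for A and f :: "5 \<Rightarrow> _"
    using that 01 assms(3) by (induction A rule: finite_induct) auto
  have sum: "(\<Sum>m\<in>A. f m) \<in> L" if "finite A" "\<And>m. m \<in> A \<Longrightarrow> f m \<in> L" for A and f :: "(5 \<Rightarrow>\<^sub>0 nat) \<Rightarrow> _"
    using that 01 assms(2) by (induction A rule: finite_induct) auto
  show ?thesis unfolding eval5_def
    by (intro sum assms(3) prod pow assms(4)) (use assms(1) in auto)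
qed

text \<open>Near the point the morphism is given by forms over the base field, and evaluating such
  forms at coordinates in \<open>L\<close> stays in \<open>L\<close>. So \<open>L\<close> enters
  only through closure under sums and products.\<close>

lemma isomorphic_points:
  fixes V W :: "'k::field poly5 \<times> 'k poly5"
  assumes "isomorphic V W" and W: "homogeneous d (fst W)" "homogeneous d' (snd W)"
    and L: "range to_ac \<subseteq> L" "\<And>x y. x \<in> L \<Longrightarrow> y \<in> L \<Longrightarrow> x + y \<in> L"
    "\<And>x y. x \<in> L \<Longrightarrow> y \<in> L \<Longrightarrow> x * y \<in> L"
    and V: "points V L \<noteq> {}"
  shows "points W L \<noteq> {}"
proof -
  obtain f where f: "morphism V W f" using assms(1) by (auto simp: isomorphic_def)
  obtain x :: "'k alg_closure ^ 5" where x: "x \<noteq> 0" "\<And>i. x $ i \<in> L" "eval5 (fst V) x = 0" "eval5 (snd V) x = 0"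
    using V by (auto simp: points_def)
  then have px: "proj_point x \<in> geom_points V" by (auto simp: points_def)
  obtain F :: "5 \<Rightarrow> 'k poly5" where F: "(\<chi> i. eval5 (F i) x) \<noteq> 0"
    "f (proj_point x) = proj_point (\<chi> i. eval5 (F i) x)"
    using f px unfolding morphism_def by metis
  let ?z = "\<chi> i. eval5 (F i) x"
  have "proj_point ?z \<in> geom_points W" using f px F(2) unfolding morphism_def by (metis image_subset_iff)
  note z = geom_point_eval[OF this W]
  have "?z $ i \<in> L" for i using eval5_closed[OF L x(2)] by simp
  then have "proj_point ?z \<in> points W L" using z unfolding points_def by blast
  then show ?thesis by blast
qed

section \<open>No local points at a prime of odd degree dividing \<open>T\<close>\<close>

context surface_parameters
begin

abbreviation "pA \<equiv> bilA [:c:] [:d:] T"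
abbreviation "pB \<equiv> bilB [:c:] [:d:] T"

text \<open>The congruences are used in increasing strength: modulo \<open>\<pi>\<close>,
  \<open>B\<close> gives \<open>U\<close> and \<open>A\<close> gives \<open>Y\<close>; modulo the
  square, \<open>A\<close> gives \<open>W + Z\<close> and \<open>B\<close> gives \<open>V\<close>;
  modulo the cube, \<open>A\<close> becomes a norm form in \<open>Y / \<pi>\<close> and
  \<open>Z\<close>, which is anisotropic because \<open>c\<close> stays nonsquare.\<close>

lemma local_insolubility_step:
  assumes \<pi>: "prime_elem \<pi>" "odd (degree \<pi>)" "multiplicity \<pi> T = 1"
    and A: "\<pi> ^ 3 dvd pA P P" and B: "\<pi> ^ 2 dvd pB P P" and "i < 5"
  shows "\<pi> dvd P i"
proof -
  let ?C = "[:c:]" and ?D = "[:d:]"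
  have p0: "\<pi> \<noteq> 0" using \<pi> by auto
  have prime: "\<pi> dvd x * y \<longleftrightarrow> \<pi> dvd x \<or> \<pi> dvd y" for x y by (rule prime_elem_dvd_mult_iff[OF \<pi>(1)])
  have canc: "x = y" if "\<pi> * x = \<pi> * y" for x y using that p0 by simp
  have sq: "\<pi> dvd x\<^sup>2 \<Longrightarrow> \<pi> dvd x" for x by (simp add: power2_eq_square prime)
  have units: "\<not> \<pi> dvd ?C" "\<not> \<pi> dvd ?D"
  proof -
    have "is_unit ?C" "is_unit ?D" using nonzero by (simp_all add: is_unit_pCons_iff)
    then show "\<not> \<pi> dvd ?C" "\<not> \<pi> dvd ?D" using prime_elem_not_unit[OF \<pi>(1)] dvd_trans by blast+
  qed
  have CD: "?C + ?D = 1" using cd_sum by (simp add: one_pCons)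
  obtain T' where T': "T = \<pi> * T'" "\<not> \<pi> dvd T'"
    using multiplicity_decompose'[of T \<pi>] \<pi> nonzero prime_elem_not_unit[OF \<pi>(1)] by (metis power_one_right)
  define s where "s = 1 - ?C * ?D * T"
  obtain m where m: "pA P P = \<pi> ^ 3 * m" using A by (rule dvdE)
  obtain n where n: "pB P P = \<pi> ^ 2 * n" using B by (rule dvdE)
  have A': "(P 4)\<^sup>2 - ?C * T * (?C * (P 0)\<^sup>2 + 2 * s * P 0 * P 1 + ?C * T * s * (P 1)\<^sup>2)
      - ?C * T * ((?D * T - 1) * (P 2)\<^sup>2 - 2 * s * P 2 * P 3 - s * (P 3)\<^sup>2) = \<pi> ^ 3 * m"
    using m unfolding bilA_def Let_def s_def by Groebner_Basis.algebra
  have B': "?C * ((P 0)\<^sup>2 - T * s * (P 1)\<^sup>2 - ?D * T * (P 2)\<^sup>2 + ?D * T * s * (P 3)\<^sup>2) = \<pi> ^ 2 * n"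
    using n unfolding bilB_def Let_def s_def by Groebner_Basis.algebra
  have "?C * (P 0)\<^sup>2 = \<pi> * (\<pi> * n + ?C * (T' * s * (P 1)\<^sup>2 + ?D * T' * (P 2)\<^sup>2 - ?D * T' * s * (P 3)\<^sup>2))"
    using B' unfolding T'(1) by Groebner_Basis.algebra
  then have "\<pi> dvd ?C * (P 0)\<^sup>2" by (metis dvd_triv_left)
  then have "\<pi> dvd P 0" using units sq prime by blast
  then obtain p where p: "P 0 = \<pi> * p" by (rule dvdE)
  have "(P 4)\<^sup>2 = \<pi> * (\<pi>\<^sup>2 * m + ?C * T' * (?C * (P 0)\<^sup>2 + 2 * s * P 0 * P 1 + ?C * T * s * (P 1)\<^sup>2)
      + ?C * T' * ((?D * T - 1) * (P 2)\<^sup>2 - 2 * s * P 2 * P 3 - s * (P 3)\<^sup>2))"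
    using A' T'(1) by Groebner_Basis.algebra
  then have "\<pi> dvd (P 4)\<^sup>2" by (metis dvd_triv_left)
  then have "\<pi> dvd P 4" using sq by blast
  then obtain q where q: "P 4 = \<pi> * q" by (rule dvdE)
  have "\<pi> * (?C * T' * (P 2 + P 3)\<^sup>2) = \<pi> * (\<pi> * (\<pi> * m - q\<^sup>2
      + ?C * T' * (?C * \<pi> * p\<^sup>2 + 2 * s * p * P 1 + ?C * T' * s * (P 1)\<^sup>2
        + T' * (?D * (P 2)\<^sup>2 + 2 * ?C * ?D * P 2 * P 3 + ?C * ?D * (P 3)\<^sup>2))))"
    using A' unfolding s_def p q T'(1) by Groebner_Basis.algebra
  then have "?C * T' * (P 2 + P 3)\<^sup>2 = \<pi> * (\<pi> * m - q\<^sup>2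
      + ?C * T' * (?C * \<pi> * p\<^sup>2 + 2 * s * p * P 1 + ?C * T' * s * (P 1)\<^sup>2
        + T' * (?D * (P 2)\<^sup>2 + 2 * ?C * ?D * P 2 * P 3 + ?C * ?D * (P 3)\<^sup>2)))"
    by (rule canc)
  then have "\<pi> dvd ?C * T' * (P 2 + P 3)\<^sup>2" by (metis dvd_triv_left)
  then have "\<pi> dvd P 2 + P 3" using units T'(2) sq prime by blast
  then obtain r where r: "P 2 + P 3 = \<pi> * r" by (rule dvdE)
  have P2: "P 2 = \<pi> * r - P 3" using r by Groebner_Basis.algebra
  \<comment> \<open>Since \<open>s\<close> is congruent to 1, the terms in \<open>W\<close> and
    \<open>Z\<close> contain the factor \<open>W + Z\<close>, already divisible by
    \<open>\<pi>\<close>.\<close>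
  have "\<pi> * (?C * T' * (P 1)\<^sup>2) = \<pi> * (\<pi> * (?C * p\<^sup>2 - n + ?C * ?C * ?D * T' * T' * (P 1)\<^sup>2
      - ?C * ?D * T' * r * (P 2 - P 3) - ?C * ?D * ?C * ?D * T' * T' * (P 3)\<^sup>2))"
    using B' unfolding s_def p T'(1) P2 by Groebner_Basis.algebra
  then have "?C * T' * (P 1)\<^sup>2 = \<pi> * (?C * p\<^sup>2 - n + ?C * ?C * ?D * T' * T' * (P 1)\<^sup>2
      - ?C * ?D * T' * r * (P 2 - P 3) - ?C * ?D * ?C * ?D * T' * T' * (P 3)\<^sup>2)"
    by (rule canc)
  then have "\<pi> dvd ?C * T' * (P 1)\<^sup>2" by (metis dvd_triv_left)
  then have "\<pi> dvd P 1" using units T'(2) sq prime by blast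
  then obtain o1 where o1: "P 1 = \<pi> * o1" by (rule dvdE)
  define K where "K = ?D * (P 2)\<^sup>2 + 2 * ?C * ?D * P 2 * P 3 + ?C * ?D * (P 3)\<^sup>2"
  have E: "(?D * T - 1) * (P 2)\<^sup>2 - 2 * s * P 2 * P 3 - s * (P 3)\<^sup>2 = T * K - (P 2 + P 3)\<^sup>2"
    unfolding s_def K_def by Groebner_Basis.algebra
  have "K = \<pi> * (?D * \<pi> * r\<^sup>2 - 2 * ?D * r * P 3 + 2 * ?C * ?D * r * P 3) + ?D * (1 - ?C) * (P 3)\<^sup>2"
    unfolding K_def P2 by Groebner_Basis.algebra
  \<comment> \<open>This turns the coefficient of \<open>(P 3)\<^sup>2\<close> into the square of
    \<open>?D\<close>, which is what makes the residual equation a norm form for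
    \<open>c\<close>.\<close>
  moreover have "1 - ?C = ?D" using CD by Groebner_Basis.algebra
  ultimately have K: "K = \<pi> * (?D * \<pi> * r\<^sup>2 - 2 * ?D * r * P 3 + 2 * ?C * ?D * r * P 3) + ?D * ?D * (P 3)\<^sup>2"
    by simp
  define Y where "Y = ?C * (P 0)\<^sup>2 + 2 * s * P 0 * P 1 + ?C * T * s * (P 1)\<^sup>2"
  have Y: "Y = \<pi> * (\<pi> * (?C * p\<^sup>2 + 2 * s * p * o1 + ?C * T * s * o1\<^sup>2))"
    unfolding Y_def p o1 by Groebner_Basis.algebra
  have "(P 4)\<^sup>2 - ?C * T * Y - ?C * T * (T * K - (\<pi> * r)\<^sup>2) = \<pi> ^ 3 * m"
    using A' unfolding E r Y_def .
  then have "(P 4)\<^sup>2 - ?C * T * T * K = \<pi> ^ 3 * m + ?C * T * Y - ?C * T * (\<pi> * r)\<^sup>2"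
    by Groebner_Basis.algebra
  moreover have "\<pi> * (\<pi> * (q\<^sup>2 - ?C * T' * T' * K)) = (P 4)\<^sup>2 - ?C * T * T * K"
    unfolding q T'(1) by Groebner_Basis.algebra
  moreover have "\<pi> ^ 3 * m + ?C * (\<pi> * T') * Y - ?C * (\<pi> * T') * (\<pi> * r)\<^sup>2 = \<pi> * (\<pi> * (\<pi> * (m
      + ?C * T' * (?C * p\<^sup>2 + 2 * s * p * o1 + ?C * T * s * o1\<^sup>2 - r\<^sup>2))))"
    unfolding Y by Groebner_Basis.algebra
  ultimately have "\<pi> * (\<pi> * (q\<^sup>2 - ?C * T' * T' * K)) = \<pi> * (\<pi> * (\<pi> * (m
      + ?C * T' * (?C * p\<^sup>2 + 2 * s * p * o1 + ?C * T * s * o1\<^sup>2 - r\<^sup>2))))"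
    by (simp only: T'(1)[symmetric])
  then have "q\<^sup>2 - ?C * T' * T' * K = \<pi> * (m
      + ?C * T' * (?C * p\<^sup>2 + 2 * s * p * o1 + ?C * T * s * o1\<^sup>2 - r\<^sup>2))"
    by (rule canc[OF canc])
  then have "q\<^sup>2 - ?C * (T' * ?D * P 3)\<^sup>2 = \<pi> * (m
      + ?C * T' * (?C * p\<^sup>2 + 2 * s * p * o1 + ?C * T * s * o1\<^sup>2 - r\<^sup>2
        + T' * (?D * \<pi> * r\<^sup>2 - 2 * ?D * r * P 3 + 2 * ?C * ?D * r * P 3)))"
    unfolding K by Groebner_Basis.algebra
  then have "\<pi> dvd q\<^sup>2 - ?C * (T' * ?D * P 3)\<^sup>2" by (metis dvd_triv_left)
  then have "\<pi> dvd q\<^sup>2 - smult c ((T' * ?D * P 3)\<^sup>2)" by simp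
  from odd_prime_dvd_norm_form[OF c_nonsquare \<pi>(1,2) this] have "\<pi> dvd T' * ?D * P 3" by blast
  then have "\<pi> dvd P 3" using T'(2) units prime by blast
  moreover from this have "\<pi> dvd P 2" unfolding P2 by (intro dvd_diff) auto
  moreover have "i = 0 \<or> i = 1 \<or> i = 2 \<or> i = 3 \<or> i = 4" using \<open>i < 5\<close> by auto
  ultimately show ?thesis using \<open>\<pi> dvd P 0\<close> \<open>\<pi> dvd P 1\<close> \<open>\<pi> dvd P 4\<close> by blast
qed

text \<open>Dividing the vector by \<open>\<pi>\<close> divides both quadratic forms by its square,
  so each further factor costs two in the exponent; the 3 is what a single step consumes.\<close>

lemma local_insolubility:
  assumes \<pi>: "prime_elem \<pi>" "odd (degree \<pi>)" "multiplicity \<pi> T = 1"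
    and "\<pi> ^ (2 * M + 3) dvd pA P P" "\<pi> ^ (2 * M + 3) dvd pB P P" "i < 5"
  shows "\<pi> ^ (M + 1) dvd P i"
  using assms(4-)
proof (induction M arbitrary: P i)
  case 0
  then have "\<pi> ^ 2 dvd pB P P" using power_le_dvd[of \<pi> "2 * 0 + 3" "pB P P" 2] by simp
  then show ?case using local_insolubility_step[OF \<pi>, of P i] 0 by simp
next
  case (Suc M)
  have "\<pi> ^ 3 dvd pA P P" "\<pi> ^ 2 dvd pB P P"
    using Suc.prems(1,2) by (auto intro: power_le_dvd)
  note step = local_insolubility_step[OF \<pi> this]
  define P' where "P' = (\<lambda>i. P i div \<pi>)"
  have P': "P i = \<pi> * P' i" if "i < 5" for i using step[OF that] by (simp add: P'_def)
  have p0: "\<pi> \<noteq> 0" using \<pi> by auto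
  have eqs: "pA P P = \<pi>\<^sup>2 * pA P' P'" "pB P P = \<pi>\<^sup>2 * pB P' P'"
    unfolding bilA_def bilB_def Let_def using P'[of 0] P'[of 1] P'[of 2] P'[of 3] P'[of 4]
    by (simp_all add: power2_eq_square algebra_simps)
  have pw: "\<pi> ^ (2 * Suc M + 3) = \<pi>\<^sup>2 * \<pi> ^ (2 * M + 3)" by (simp add: power_add[symmetric])
  have "\<pi> ^ (2 * M + 3) dvd pA P' P'" "\<pi> ^ (2 * M + 3) dvd pB P' P'"
    using Suc.prems(1,2) p0 unfolding pw eqs by simp_all
  then have "\<pi> ^ (M + 1) dvd P' i" using Suc.prems(3) by (rule Suc.IH)
  then show ?case using P'[OF Suc.prems(3)] by simp
qed

end

text \<open>Square roots modulo every power of \<open>\<pi>\<close> stand in for a square root in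
  the completion.\<close>

lemma hensel_square:
  fixes \<pi> :: "'a::field_gcd poly"
  assumes \<pi>: "prime_elem \<pi>" and two: "(2::'a) \<noteq> 0" and "\<not> \<pi> dvd x" "\<pi> dvd x\<^sup>2 - \<alpha>"
  shows "\<exists>y. \<pi> ^ Suc n dvd y\<^sup>2 - \<alpha> \<and> \<not> \<pi> dvd y"
proof (induction n)
  case (Suc n)
  then obtain y where y: "\<pi> ^ Suc n dvd y\<^sup>2 - \<alpha>" "\<not> \<pi> dvd y" by blast
  obtain r where r: "y\<^sup>2 - \<alpha> = \<pi> ^ Suc n * r" using y(1) by (rule dvdE)
  have "\<not> \<pi> dvd 2 * y"
  proof
    have "2 * y = smult 2 y" by (simp add: numeral_poly)
    moreover assume "\<pi> dvd 2 * y"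
    ultimately show False using two y(2) by (simp add: dvd_smult_iff)
  qed
  then have "coprime \<pi> (2 * y)" using \<pi> by (rule prime_elem_imp_coprime[rotated])
  then obtain u w where uw: "u * \<pi> + w * (2 * y) = 1" using bezout_coefficients_fst_snd[of \<pi> "2 * y"] by (metis coprime_iff_gcd_eq_1)
  define Q where "Q = \<pi> ^ Suc n"
  \<comment> \<open>Newton's correction; \<open>w\<close> inverts \<open>2 * y\<close> modulo
    \<open>\<pi>\<close>.\<close>
  define z where "z = y - Q * w * r"
  have "z\<^sup>2 - \<alpha> = Q * (r - w * (2 * y) * r + Q * (w * r)\<^sup>2)"
    using r[folded Q_def] unfolding z_def by Groebner_Basis.algebra
  also have "r - w * (2 * y) * r = \<pi> * (u * r)" using uw by Groebner_Basis.algebra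
  also have "Q * (\<pi> * (u * r) + Q * (w * r)\<^sup>2) = \<pi> ^ Suc (Suc n) * (u * r + \<pi> ^ n * (w * r)\<^sup>2)"
    by (simp add: Q_def algebra_simps)
  finally have "\<pi> ^ Suc (Suc n) dvd z\<^sup>2 - \<alpha>" by simp
  moreover have "\<not> \<pi> dvd z"
  proof
    assume "\<pi> dvd z"
    then have "\<pi> dvd z + Q * w * r" by (intro dvd_add) (auto simp: Q_def)
    then show False using y(2) by (simp add: z_def)
  qed
  ultimately show ?case by blast
qed (use assms in auto)

section \<open>Biquadratic fields with denominators cleared\<close>

abbreviation emb :: "'a::field_gcd poly \<Rightarrow> 'a poly fract alg_closure" where
  "emb p \<equiv> to_ac (to_fract p)"

lemma emb_2 [simp]: "emb 2 = 2"
proof -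
  have "emb (1 + 1) = 1 + 1" by (simp only: to_fract_add to_fract_1 to_ac_add to_ac_1)
  then show ?thesis by (simp only: one_add_one)
qed

text \<open>This says that \<open>\<alpha>\<close> is not a square in the fraction field; in
  particular it is nonzero, as \<open>p = 0\<close> and \<open>q = 1\<close> show.\<close>

definition nonsquare_poly :: "'a::field_gcd poly \<Rightarrow> bool" where
  "nonsquare_poly \<alpha> \<longleftrightarrow> (\<forall>p q. p\<^sup>2 = \<alpha> * q\<^sup>2 \<longrightarrow> q = 0)"

lemma nonsquare_polyD: "nonsquare_poly \<alpha> \<Longrightarrow> p\<^sup>2 = \<alpha> * q\<^sup>2 \<Longrightarrow> p = 0 \<and> q = 0"
  unfolding nonsquare_poly_def by fastforce

text \<open>Coordinates with respect to 1, \<open>\<rho>\<close>, \<open>\<sigma>\<close> and their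
  product. Any commutative ring is allowed so that polynomial approximations can later take the
  place of the two roots.\<close>

definition biquad :: "'b::comm_ring_1 \<Rightarrow> 'b \<Rightarrow> 'b \<Rightarrow> 'b \<Rightarrow> 'b \<Rightarrow> 'b \<Rightarrow> 'b" where
  "biquad \<rho> \<sigma> a b c d = (a + b * \<rho>) + (c + d * \<rho>) * \<sigma>"

locale biquadratic =
  fixes \<alpha> \<beta> :: "'a::field_gcd poly" and \<rho> \<sigma> :: "'a poly fract alg_closure"
  assumes rho: "\<rho>\<^sup>2 = emb \<alpha>" and sigma: "\<sigma>\<^sup>2 = emb \<beta>" and two_nz: "(2::'a) \<noteq> 0"
    and ns: "nonsquare_poly \<alpha>" "nonsquare_poly \<beta>" "nonsquare_poly (\<alpha> * \<beta>)"
begin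

definition span :: "'a poly fract alg_closure set" where
  "span = {biquad \<rho> \<sigma> (emb a) (emb b) (emb c) (emb d) | a b c d. True}"

text \<open>The field generated by the two square roots: \<open>span\<close> is the ring they
  generate over the polynomials, and \<open>L\<close> inverts the nonzero polynomials.\<close>

definition L :: "'a poly fract alg_closure set" where
  "L = {z. \<exists>q. q \<noteq> 0 \<and> emb q * z \<in> span}"

lemma spanI: "biquad \<rho> \<sigma> (emb a) (emb b) (emb c) (emb d) \<in> span"
  unfolding span_def by blast

lemma span_emb: "emb a \<in> span" and span_rho: "\<rho> \<in> span" and span_sigma: "\<sigma> \<in> span"
  using spanI[of a 0 0 0] spanI[of 0 1 0 0] spanI[of 0 0 1 0] by (simp_all add: biquad_def)

lemma span_add: "x \<in> span \<Longrightarrow> y \<in> span \<Longrightarrow> x + y \<in> span"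
proof -
  assume "x \<in> span" "y \<in> span"
  then obtain a b c d a' b' c' d' where "x = biquad \<rho> \<sigma> (emb a) (emb b) (emb c) (emb d)"
    "y = biquad \<rho> \<sigma> (emb a') (emb b') (emb c') (emb d')" unfolding span_def by blast
  then have "x + y = biquad \<rho> \<sigma> (emb (a + a')) (emb (b + b')) (emb (c + c')) (emb (d + d'))"
    by (simp add: biquad_def algebra_simps)
  then show ?thesis using spanI by metis
qed

lemma span_mult: "x \<in> span \<Longrightarrow> y \<in> span \<Longrightarrow> x * y \<in> span"
proof -
  assume "x \<in> span" "y \<in> span"
  then obtain a b c d a' b' c' d' where "x = biquad \<rho> \<sigma> (emb a) (emb b) (emb c) (emb d)"
    "y = biquad \<rho> \<sigma> (emb a') (emb b') (emb c') (emb d')" unfolding span_def by blast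
  moreover have "biquad \<rho> \<sigma> A B C D * biquad \<rho> \<sigma> A' B' C' D' =
      biquad \<rho> \<sigma> (A * A' + \<rho>\<^sup>2 * (B * B') + \<sigma>\<^sup>2 * (C * C') + \<rho>\<^sup>2 * \<sigma>\<^sup>2 * (D * D'))
        (A * B' + B * A' + \<sigma>\<^sup>2 * (C * D' + D * C')) (A * C' + C * A' + \<rho>\<^sup>2 * (B * D' + D * B'))
        (A * D' + D * A' + B * C' + C * B')" for A B C D A' B' C' D'
    unfolding biquad_def by Groebner_Basis.algebra
  ultimately have "x * y = biquad \<rho> \<sigma> (emb (a * a' + \<alpha> * (b * b') + \<beta> * (c * c') + \<alpha> * \<beta> * (d * d')))
        (emb (a * b' + b * a' + \<beta> * (c * d' + d * c'))) (emb (a * c' + c * a' + \<alpha> * (b * d' + d * b')))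
        (emb (a * d' + d * a' + b * c' + c * b'))"
    unfolding rho sigma by simp
  then show ?thesis using spanI by metis
qed

lemma L_range: "range to_ac \<subseteq> L"
proof
  fix z assume "z \<in> range (to_ac :: 'a poly fract \<Rightarrow> _)"
  then obtain k where k: "z = to_ac k" by blast
  obtain a b where ab: "k = to_fract a / to_fract b" "b \<noteq> 0" using fract_repr[of k] by metis
  then have "emb b * z = emb a" unfolding k by simp
  then show "z \<in> L" unfolding L_def using ab span_emb by auto
qed

lemma L_add: "x \<in> L \<Longrightarrow> y \<in> L \<Longrightarrow> x + y \<in> L"
proof -
  assume "x \<in> L" "y \<in> L"
  then obtain p q where pq: "p \<noteq> 0" "emb p * x \<in> span" "q \<noteq> 0" "emb q * y \<in> span"
    unfolding L_def by blast
  have "emb (p * q) * (x + y) = emb q * (emb p * x) + emb p * (emb q * y)"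
    by (simp add: algebra_simps)
  also have "\<dots> \<in> span" by (rule span_add[OF span_mult[OF span_emb pq(2)] span_mult[OF span_emb pq(4)]])
  finally show ?thesis unfolding L_def using pq by (intro CollectI exI[of _ "p * q"]) auto
qed

lemma L_mult: "x \<in> L \<Longrightarrow> y \<in> L \<Longrightarrow> x * y \<in> L"
proof -
  assume "x \<in> L" "y \<in> L"
  then obtain p q where pq: "p \<noteq> 0" "emb p * x \<in> span" "q \<noteq> 0" "emb q * y \<in> span"
    unfolding L_def by blast
  have "emb (p * q) * (x * y) = (emb p * x) * (emb q * y)" by simp
  also have "\<dots> \<in> span" by (rule span_mult[OF pq(2,4)])
  finally show ?thesis unfolding L_def using pq by (intro CollectI exI[of _ "p * q"]) auto
qed

lemma span_L: "x \<in> span \<Longrightarrow> x \<in> L"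
  unfolding L_def by (intro CollectI exI[of _ 1]) simp

lemma emb_two: "2 * emb p = 0 \<longleftrightarrow> p = 0" for p :: "'a poly"
proof -
  have "2 * p = smult 2 p" by (simp add: numeral_poly)
  then have "2 * p = 0 \<longleftrightarrow> p = 0" using two_nz by simp
  moreover have "2 * emb p = emb (2 * p)" by simp
  ultimately show ?thesis by (metis to_ac_eq_0_iff to_fract_eq_0_iff)
qed

lemma rho_independent: "emb a + emb b * \<rho> = 0 \<Longrightarrow> a = 0 \<and> b = 0"
proof -
  assume eq: "emb a + emb b * \<rho> = 0"
  have "(emb a)\<^sup>2 = (emb b)\<^sup>2 * \<rho>\<^sup>2" using eq by Groebner_Basis.algebra
  then have "emb (a\<^sup>2) = emb (\<alpha> * b\<^sup>2)" unfolding rho by (simp add: power2_eq_square ac_simps)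
  then have "a\<^sup>2 = \<alpha> * b\<^sup>2" by (simp only: to_ac_eq_iff to_fract_eq_iff)
  then show ?thesis using nonsquare_polyD[OF ns(1)] by blast
qed

text \<open>Moving the part with \<open>\<sigma>\<close> to one side and squaring gives an equation
  over the field of \<open>\<rho>\<close>, whose two components reduce the claim to one of the
  products \<open>\<beta>\<close> or \<open>\<alpha> * \<beta>\<close> being a square.\<close>

lemma independent:
  assumes eq: "biquad \<rho> \<sigma> (emb a) (emb b) (emb c) (emb d) = 0"
  shows "a = 0 \<and> b = 0 \<and> c = 0 \<and> d = 0"
proof -
  have "(emb a + emb b * \<rho>)\<^sup>2 = (emb c + emb d * \<rho>)\<^sup>2 * \<sigma>\<^sup>2"
    using eq unfolding biquad_def by Groebner_Basis.algebra
  then have "((emb a)\<^sup>2 + (emb b)\<^sup>2 * \<rho>\<^sup>2 - ((emb c)\<^sup>2 + (emb d)\<^sup>2 * \<rho>\<^sup>2) * \<sigma>\<^sup>2)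
      + 2 * (emb a * emb b - emb c * emb d * \<sigma>\<^sup>2) * \<rho> = 0"
    by Groebner_Basis.algebra
  then have "emb (a\<^sup>2 + b\<^sup>2 * \<alpha> - (c\<^sup>2 + d\<^sup>2 * \<alpha>) * \<beta>) + emb ((a * b - c * d * \<beta>) + (a * b - c * d * \<beta>)) * \<rho> = 0"
    unfolding rho sigma by (simp add: power2_eq_square algebra_simps)
  from rho_independent[OF this] have e: "a\<^sup>2 + b\<^sup>2 * \<alpha> = (c\<^sup>2 + d\<^sup>2 * \<alpha>) * \<beta>" "(a * b - c * d * \<beta>) + (a * b - c * d * \<beta>) = 0"
    by simp_all
  have two0: "p = 0" if "p + p = 0" for p :: "'a poly"
    using emb_two[of p] that by (metis mult_2 to_ac_add to_ac_eq_0_iff to_fract_0 to_fract_add)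
  have ab: "a * b = c * d * \<beta>" using two0[OF e(2)] by simp
  \<comment> \<open>Square the first component and subtract four times \<open>\<alpha>\<close> times
    the square of the second: the norms of both sides agree up to sign.\<close>
  have "(a\<^sup>2 - b\<^sup>2 * \<alpha> - (c\<^sup>2 - d\<^sup>2 * \<alpha>) * \<beta>) * (a\<^sup>2 - b\<^sup>2 * \<alpha> + (c\<^sup>2 - d\<^sup>2 * \<alpha>) * \<beta>) = 0"
    using e(1) ab by Groebner_Basis.algebra
  then consider "a\<^sup>2 - b\<^sup>2 * \<alpha> - (c\<^sup>2 - d\<^sup>2 * \<alpha>) * \<beta> = 0" | "a\<^sup>2 - b\<^sup>2 * \<alpha> + (c\<^sup>2 - d\<^sup>2 * \<alpha>) * \<beta> = 0"
    using mult_eq_0_iff by blast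
  then show ?thesis
  proof cases
    case 1
    have "(a\<^sup>2 - \<beta> * c\<^sup>2) + (a\<^sup>2 - \<beta> * c\<^sup>2) = 0" using e(1) 1 by Groebner_Basis.algebra
    from two0[OF this] have ac: "a = 0 \<and> c = 0" using nonsquare_polyD[OF ns(2), of a c] by simp
    have "(\<alpha> * b\<^sup>2 - \<alpha> * (\<beta> * d\<^sup>2)) + (\<alpha> * b\<^sup>2 - \<alpha> * (\<beta> * d\<^sup>2)) = 0" using e(1) 1 by Groebner_Basis.algebra
    from two0[OF this] have "\<alpha> * (b\<^sup>2 - \<beta> * d\<^sup>2) = 0" by (simp add: algebra_simps)
    moreover have "\<alpha> \<noteq> 0" using ns(1) unfolding nonsquare_poly_def by (metis mult_zero_left one_neq_zero power_zero_numeral)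
    ultimately have "b\<^sup>2 = \<beta> * d\<^sup>2" by simp
    then show ?thesis using ac nonsquare_polyD[OF ns(2), of b d] by simp
  next
    case 2
    have "(a\<^sup>2 - \<alpha> * \<beta> * d\<^sup>2) + (a\<^sup>2 - \<alpha> * \<beta> * d\<^sup>2) = 0" using e(1) 2 by Groebner_Basis.algebra
    from two0[OF this] have ad: "a = 0 \<and> d = 0" using nonsquare_polyD[OF ns(3), of a d] by simp
    have "((\<alpha> * b)\<^sup>2 - \<alpha> * \<beta> * c\<^sup>2) + ((\<alpha> * b)\<^sup>2 - \<alpha> * \<beta> * c\<^sup>2) = 0" using e(1) 2 by Groebner_Basis.algebra
    from two0[OF this] have "\<alpha> * b = 0 \<and> c = 0" using nonsquare_polyD[OF ns(3), of "\<alpha> * b" c] by simp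
    moreover have "\<alpha> \<noteq> 0" using ns(1) unfolding nonsquare_poly_def by (metis mult_zero_left one_neq_zero power_zero_numeral)
    ultimately show ?thesis using ad by simp
  qed
qed

text \<open>The cofactor is the product of conjugates: \<open>y\<close> changes the sign of
  \<open>\<sigma>\<close>, and \<open>x\<close> then changes that of \<open>\<rho>\<close>. It
  serves to make one coordinate of a point a polynomial.\<close>

lemma norm_multiple:
  assumes "z \<in> span" "z \<noteq> 0"
  obtains z' N where "z' \<in> span" "N \<noteq> 0" "z * z' = emb N"
proof -
  obtain a b c d where z: "z = biquad \<rho> \<sigma> (emb a) (emb b) (emb c) (emb d)"
    using assms(1) unfolding span_def by blast
  define y where "y = biquad \<rho> \<sigma> (emb a) (emb b) (emb (- c)) (emb (- d))"
  define e f where "e = a\<^sup>2 + b\<^sup>2 * \<alpha> - (c\<^sup>2 + d\<^sup>2 * \<alpha>) * \<beta>" and "f = a * b - c * d * \<beta> + (a * b - c * d * \<beta>)"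
  have "z * y = ((emb a)\<^sup>2 + (emb b)\<^sup>2 * \<rho>\<^sup>2 - ((emb c)\<^sup>2 + (emb d)\<^sup>2 * \<rho>\<^sup>2) * \<sigma>\<^sup>2)
      + 2 * (emb a * emb b - emb c * emb d * \<sigma>\<^sup>2) * \<rho>"
    unfolding z y_def biquad_def to_fract_uminus to_ac_minus by Groebner_Basis.algebra
  then have zy: "z * y = emb e + emb f * \<rho>"
    unfolding rho sigma e_def f_def by (simp add: power2_eq_square algebra_simps)
  have y0: "y \<noteq> 0"
  proof
    assume "y = 0"
    from independent[OF this[unfolded y_def]] have "a = 0 \<and> b = 0 \<and> c = 0 \<and> d = 0" by simp
    then show False using assms(2) z by (simp add: biquad_def)
  qed
  define x where "x = emb e + emb (- f) * \<rho>"
  have "x = biquad \<rho> \<sigma> (emb e) (emb (- f)) (emb 0) (emb 0)" by (simp add: x_def biquad_def)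
  then have x: "x \<in> span" using spanI by metis
  have "z * (y * x) = (emb e)\<^sup>2 - (emb f)\<^sup>2 * \<rho>\<^sup>2"
    using zy unfolding x_def to_fract_uminus to_ac_minus by Groebner_Basis.algebra
  then have N: "z * (y * x) = emb (e\<^sup>2 - \<alpha> * f\<^sup>2)" unfolding rho by (simp add: power2_eq_square ac_simps)
  have "e\<^sup>2 - \<alpha> * f\<^sup>2 \<noteq> 0"
  proof
    assume "e\<^sup>2 - \<alpha> * f\<^sup>2 = 0"
    then have "e = 0 \<and> f = 0" using nonsquare_polyD[OF ns(1), of e f] by simp
    then have "z * y = 0" using zy by simp
    then show False using y0 assms(2) by simp
  qed
  moreover have "y * x \<in> span" unfolding y_def by (intro span_mult x spanI)
  ultimately show thesis using that N by blast
qed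

end

definition sym_bilinear :: "((nat \<Rightarrow> 'b::comm_ring_1) \<Rightarrow> (nat \<Rightarrow> 'b) \<Rightarrow> 'b) \<Rightarrow> bool" where
  "sym_bilinear b \<longleftrightarrow> (\<forall>x y. b x y = b y x) \<and> (\<forall>x y w z. b (\<lambda>i. x i + y i * w) z = b x z + b y z * w)"

lemma sym_bilinear_bil: "sym_bilinear (bilA c d T)" "sym_bilinear (bilB c d T)"
  unfolding sym_bilinear_def bilA_def bilB_def Let_def by (simp_all add: algebra_simps)

lemma sym_bilinear_expand:
  assumes "sym_bilinear b"
  shows "b (\<lambda>i. x i + y i * w) (\<lambda>i. x' i + y' i * w) = b x x' + (b x y' + b y x') * w + b y y' * w\<^sup>2"
proof -
  have lin: "b (\<lambda>i. x i + y i * w) z = b x z + b y z * w" and sym: "b x y = b y x" for x y z w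
    using assms unfolding sym_bilinear_def by blast+
  have "b (\<lambda>i. x i + y i * w) (\<lambda>i. x' i + y' i * w) = b x' x + b y' x * w + (b x' y + b y' y * w) * w"
    by (simp only: lin sym[of _ "\<lambda>i. x' i + y' i * w"])
  then show ?thesis by (simp add: sym[of x'] sym[of y'] power2_eq_square algebra_simps)
qed

text \<open>The squares of \<open>X1\<close> and \<open>Y1\<close> are left symbolic, so one
  expansion serves both for the true roots and for their approximations.\<close>

lemma sym_bilinear_biquad:
  assumes "sym_bilinear b"
  shows "b (\<lambda>i. biquad X1 Y1 (p i) (q i) (r i) (s i)) (\<lambda>i. biquad X1 Y1 (p i) (q i) (r i) (s i)) =
    biquad X1 Y1 (b p p + X1\<^sup>2 * b q q + Y1\<^sup>2 * b r r + X1\<^sup>2 * Y1\<^sup>2 * b s s) (2 * b p q + 2 * Y1\<^sup>2 * b r s)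
      (2 * b p r + 2 * X1\<^sup>2 * b q s) (2 * b p s + 2 * b q r)"
proof -
  have sym: "b x y = b y x" for x y using assms unfolding sym_bilinear_def by blast
  show ?thesis
    unfolding biquad_def sym_bilinear_expand[OF assms] sym[of q p] sym[of r p] sym[of s p] sym[of r q] sym[of s q] sym[of s r]
    by (simp add: power2_eq_square algebra_simps)
qed

lemma emb_bil: "bilA (emb c) (emb d) (emb T) (\<lambda>i. emb (x i)) (\<lambda>i. emb (y i)) = emb (bilA c d T x y)"
  "bilB (emb c) (emb d) (emb T) (\<lambda>i. emb (x i)) (\<lambda>i. emb (y i)) = emb (bilB c d T x y)"
  by (simp_all add: bilA_def bilB_def Let_def)

context surface_parameters
begin

text \<open>Both radicands are squares in the completion at \<open>\<pi>\<close>, so the biquadratic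
  field embeds there, where the surface has no point. The proof replaces the roots by approximations
  of finite precision.\<close>

lemma points_biquadratic_empty:
  assumes bq: "biquadratic \<alpha> \<beta> \<rho> \<sigma>"
    and \<pi>: "prime_elem \<pi>" "odd (degree \<pi>)" "multiplicity \<pi> T = 1"
    and \<alpha>: "\<not> \<pi> dvd x0" "\<pi> dvd x0\<^sup>2 - \<alpha>" and \<beta>: "\<not> \<pi> dvd y0" "\<pi> dvd y0\<^sup>2 - \<beta>"
  shows "points dp4 (biquadratic.L \<rho> \<sigma>) = {}"
proof (rule ccontr)
  interpret biquadratic \<alpha> \<beta> \<rho> \<sigma> by (rule bq)
  let ?c = "emb [:c:]" and ?d = "emb [:d:]" and ?T = "emb T"
  assume "points dp4 L \<noteq> {}"
  then obtain x :: "'a poly fract alg_closure ^ 5" where x: "x \<noteq> 0" "\<And>i. x $ i \<in> L"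
     "bilA ?c ?d ?T (coords x) (coords x) = 0" "bilB ?c ?d ?T (coords x) (coords x) = 0"
    unfolding surface_points by auto
  obtain q where q: "\<And>i. q i \<noteq> 0" "\<And>i. emb (q i) * x $ i \<in> span"
    using x(2) unfolding L_def by (simp, metis)
  define Q where "Q = (\<Prod>i\<in>UNIV. q i)"
  have Q0: "Q \<noteq> 0" using q by (simp add: Q_def)
  have Qx: "emb Q * x $ i \<in> span" for i
  proof -
    have "Q = q i * (\<Prod>j\<in>UNIV - {i}. q j)" unfolding Q_def by (rule prod.remove) auto
    then have "emb Q = emb (q i) * emb (\<Prod>j\<in>UNIV - {i}. q j)" by (simp only: to_fract_mult to_ac_mult)
    then have "emb Q * x $ i = emb (\<Prod>j\<in>UNIV - {i}. q j) * (emb (q i) * x $ i)" by (simp only: ac_simps)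
    then show ?thesis using span_mult[OF span_emb q(2)[of i]] by (simp only:)
  qed
  obtain j where j: "x $ j \<noteq> 0" using x(1) by (auto simp: vec_eq_iff)
  \<comment> \<open>Scaling makes coordinate \<open>j\<close> the nonzero polynomial
    \<open>N\<close>, without components along the roots, so it is unchanged when the roots are
    replaced by approximations.\<close>
  obtain z N where z: "z \<in> span" "N \<noteq> 0" "emb Q * x $ j * z = emb N"
    using norm_multiple[OF Qx[of j]] j Q0 by auto
  define w where "w = emb Q * z"
  have wx: "w * x $ i \<in> span" for i using span_mult[OF Qx[of i] z(1)] by (simp add: w_def ac_simps)
  have "\<exists>e0 e1 e2 e3. w * x $ i = biquad \<rho> \<sigma> (emb e0) (emb e1) (emb e2) (emb e3) \<and>
      (i = j \<longrightarrow> e0 = N \<and> e1 = 0 \<and> e2 = 0 \<and> e3 = 0)" for i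
  proof (cases "i = j")
    case True
    have "w * x $ j = biquad \<rho> \<sigma> (emb N) (emb 0) (emb 0) (emb 0)" using z(3) by (simp add: w_def biquad_def ac_simps)
    then show ?thesis using True by blast
  next
    case False
    then show ?thesis using wx[of i] unfolding span_def by blast
  qed
  then obtain e0 e1 e2 e3 where e: "\<And>i. w * x $ i = biquad \<rho> \<sigma> (emb (e0 i)) (emb (e1 i)) (emb (e2 i)) (emb (e3 i))"
    "e0 j = N" "e1 j = 0" "e2 j = 0" "e3 j = 0" by metis
  define a0 a1 a2 a3 where "a0 = (\<lambda>n::nat. e0 (of_nat n))" and "a1 = (\<lambda>n::nat. e1 (of_nat n))"
    and "a2 = (\<lambda>n::nat. e2 (of_nat n))" and "a3 = (\<lambda>n::nat. e3 (of_nat n))"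
  note a_def = a0_def a1_def a2_def a3_def
  have cx: "w * coords x n = biquad \<rho> \<sigma> (emb (a0 n)) (emb (a1 n)) (emb (a2 n)) (emb (a3 n))" for n
    by (simp add: coords_def a_def e(1))
  obtain n where n: "n < 5" "of_nat n = j"
  proof -
    have "j \<in> {0, 1, 2, 3, 4}" using UNIV_5 by auto
    then have "\<exists>n<5. of_nat n = j"
      by (elim insertE) (auto intro: exI[of _ 0] exI[of _ 1] exI[of _ 2] exI[of _ 3] exI[of _ 4])
    then show thesis using that by auto
  qed
  have div: "\<exists>m. b (\<lambda>i. biquad X1 Y1 (a0 i) (a1 i) (a2 i) (a3 i)) (\<lambda>i. biquad X1 Y1 (a0 i) (a1 i) (a2 i) (a3 i))
      = (X1\<^sup>2 - \<alpha>) * m + (Y1\<^sup>2 - \<beta>) * (b a2 a2 + \<alpha> * b a3 a3 + 2 * X1 * b a2 a3)"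
    if b: "sym_bilinear b" and b': "sym_bilinear b'"
      and emb: "\<And>x y. b' (\<lambda>i. emb (x i)) (\<lambda>i. emb (y i)) = emb (b x y)"
      and zero: "b' (\<lambda>i. w * coords x i) (\<lambda>i. w * coords x i) = 0" for b b' X1 Y1
  proof -
    let ?e0 = "b a0 a0 + \<alpha> * b a1 a1 + \<beta> * b a2 a2 + \<alpha> * \<beta> * b a3 a3"
      and ?e1 = "2 * b a0 a1 + 2 * \<beta> * b a2 a3" and ?e2 = "2 * b a0 a2 + 2 * \<alpha> * b a1 a3"
      and ?e3 = "2 * b a0 a3 + 2 * b a1 a2"
    have "biquad \<rho> \<sigma> (emb ?e0) (emb ?e1) (emb ?e2) (emb ?e3) = 0"
      using zero unfolding cx sym_bilinear_biquad[OF b'] emb rho sigma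
      by (simp only: to_fract_add to_ac_add to_fract_mult to_ac_mult emb_2)
    from independent[OF this] have E: "?e0 = 0" "?e1 = 0" "?e2 = 0" "?e3 = 0" by auto
    \<comment> \<open>The four coordinates of the value at the true roots vanish, so the value at
      \<open>X1\<close>, \<open>Y1\<close> lies in the ideal of the two errors.\<close>
    have "b (\<lambda>i. biquad X1 Y1 (a0 i) (a1 i) (a2 i) (a3 i)) (\<lambda>i. biquad X1 Y1 (a0 i) (a1 i) (a2 i) (a3 i))
      = (X1\<^sup>2 - \<alpha>) * (b a1 a1 + Y1\<^sup>2 * b a3 a3 + 2 * Y1 * b a1 a3)
        + (Y1\<^sup>2 - \<beta>) * (b a2 a2 + \<alpha> * b a3 a3 + 2 * X1 * b a2 a3)"
      unfolding sym_bilinear_biquad[OF b] unfolding biquad_def using E by Groebner_Basis.algebra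
    then show ?thesis by blast
  qed
  \<comment> \<open>Precision \<open>2 * M + 3\<close> lets the descent put \<open>M + 1\<close>
    factors \<open>\<pi>\<close> into \<open>N\<close>, one more than it has.\<close>
  define M where "M = multiplicity \<pi> N"
  have n3: "Suc (2 * M + 2) = 2 * M + 3" by simp
  obtain X1 where X1: "\<pi> ^ (2 * M + 3) dvd X1\<^sup>2 - \<alpha>"
    using hensel_square[OF \<pi>(1) two \<alpha>, of "2 * M + 2"] unfolding n3 by blast
  obtain Y1 where Y1: "\<pi> ^ (2 * M + 3) dvd Y1\<^sup>2 - \<beta>"
    using hensel_square[OF \<pi>(1) two \<beta>, of "2 * M + 2"] unfolding n3 by blast
  define P where "P = (\<lambda>i. biquad X1 Y1 (a0 i) (a1 i) (a2 i) (a3 i))"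
  have scale: "bilA ?c ?d ?T (\<lambda>i. w * coords x i) (\<lambda>i. w * coords x i) = 0"
    "bilB ?c ?d ?T (\<lambda>i. w * coords x i) (\<lambda>i. w * coords x i) = 0"
  proof -
    have "bilA ?c ?d ?T (\<lambda>i. w * coords x i) (\<lambda>i. w * coords x i) = w\<^sup>2 * bilA ?c ?d ?T (coords x) (coords x)"
      "bilB ?c ?d ?T (\<lambda>i. w * coords x i) (\<lambda>i. w * coords x i) = w\<^sup>2 * bilB ?c ?d ?T (coords x) (coords x)"
      unfolding bilA_def bilB_def Let_def by (simp_all add: power2_eq_square algebra_simps)
    then show "bilA ?c ?d ?T (\<lambda>i. w * coords x i) (\<lambda>i. w * coords x i) = 0"
      "bilB ?c ?d ?T (\<lambda>i. w * coords x i) (\<lambda>i. w * coords x i) = 0"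
      using x(3,4) by simp_all
  qed
  have "\<pi> ^ (2 * M + 3) dvd pA P P" "\<pi> ^ (2 * M + 3) dvd pB P P"
    using div[OF sym_bilinear_bil(1) sym_bilinear_bil(1) emb_bil(1) scale(1), of X1 Y1]
      div[OF sym_bilinear_bil(2) sym_bilinear_bil(2) emb_bil(2) scale(2), of X1 Y1] X1 Y1
    unfolding P_def by (auto intro: dvd_add dvd_mult2)
  from local_insolubility[OF \<pi> this n(1)] have "\<pi> ^ (M + 1) dvd P n" .
  moreover have "P n = N" by (simp add: P_def a_def n(2) e biquad_def)
  ultimately have "M + 1 \<le> multiplicity \<pi> N"
    using z(2) prime_elem_not_unit[OF \<pi>(1)] by (intro multiplicity_geI) auto
  then show False by (simp add: M_def)
qed

section \<open>Explicit points over biquadratic fields\<close>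

lemma kappa_div_d: "(\<kappa> / d)\<^sup>2 = c / d"
  using cd_prod nonzero by (simp add: power_divide power2_eq_square field_simps)

text \<open>With \<open>V = W = 0\<close> and \<open>Z = 1\<close>, \<open>B\<close> gives
  \<open>U\<^sup>2 = - d T S\<close>, and then \<open>A\<close> gives
  \<open>Y\<^sup>2 = (c / d) U\<^sup>2 (1 + c d T)\<close>. The quotient \<open>c / d\<close> is the
  square of \<open>\<kappa> / d\<close>.\<close>

lemma biquadratic_point_V_W_zero:
  assumes bq: "biquadratic \<alpha> \<beta> \<rho> \<sigma>" and \<alpha>: "\<alpha> = - smult d (T * S)" and \<beta>: "1 + smult (c * d) T = \<beta> * \<gamma>\<^sup>2"
  shows "points dp4 (biquadratic.L \<rho> \<sigma>) \<noteq> {}"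
proof -
  interpret biquadratic \<alpha> \<beta> \<rho> \<sigma> by (rule bq)
  define y where "y = emb [:\<kappa> / d:] * \<rho> * \<sigma> * emb \<gamma>"
  define x :: "'a poly fract alg_closure ^ 5" where
    "x = (\<chi> i. if i = 0 then \<rho> else if i = 3 then 1 else if i = 4 then y else 0)"
  have cx: "coords x 0 = \<rho>" "coords x 1 = 0" "coords x (Suc 0) = 0" "coords x 2 = 0" "coords x 3 = 1" "coords x 4 = y"
    by (simp_all add: x_def coords_simps)
  have S: "emb S = 1 - emb [:c:] * emb [:d:] * emb T" by (simp add: to_fract_S)
  have ra: "\<rho>\<^sup>2 = - (emb [:d:] * emb T * emb S)"
  proof -
    have "\<alpha> = - ([:d:] * T * S)" by (simp add: \<alpha>)
    then show ?thesis unfolding rho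
      by (simp only: to_fract_mult to_fract_uminus to_ac_mult to_ac_minus)
  qed
  have sb: "\<sigma>\<^sup>2 * (emb \<gamma>)\<^sup>2 = 1 + emb [:c:] * emb [:d:] * emb T"
  proof -
    have "\<beta> * \<gamma>\<^sup>2 = 1 + [:c:] * [:d:] * T" by (simp add: mult.commute flip: \<beta>)
    then have "emb (\<beta> * \<gamma>\<^sup>2) = emb (1 + [:c:] * [:d:] * T)" by (rule arg_cong)
    then show ?thesis unfolding sigma
      by (simp only: power2_eq_square to_fract_mult to_fract_add to_fract_1 to_ac_mult to_ac_add to_ac_1)
  qed
  have kd: "(emb [:\<kappa> / d:])\<^sup>2 * emb [:d:] = emb [:c:]"
  proof -
    have "[:\<kappa> / d:]\<^sup>2 * [:d:] = [:c:]" using kappa_div_d nonzero by (simp add: power2_eq_square)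
    then have "emb ([:\<kappa> / d:]\<^sup>2 * [:d:]) = emb [:c:]" by (rule arg_cong)
    then show ?thesis by (simp only: power2_eq_square to_fract_mult to_ac_mult)
  qed
  have "y\<^sup>2 = (emb [:\<kappa> / d:])\<^sup>2 * \<rho>\<^sup>2 * (\<sigma>\<^sup>2 * (emb \<gamma>)\<^sup>2)" unfolding y_def by Groebner_Basis.algebra
  also have "\<dots> = - ((emb [:\<kappa> / d:])\<^sup>2 * emb [:d:] * emb T * emb S * (1 + emb [:c:] * emb [:d:] * emb T))"
    unfolding ra sb by Groebner_Basis.algebra
  finally have y2: "y\<^sup>2 = - (emb [:c:] * emb T * emb S * (1 + emb [:c:] * emb [:d:] * emb T))" unfolding kd .
  have "bilA (emb [:c:]) (emb [:d:]) (emb T) (coords x) (coords x) = 0"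
    unfolding bilA_def Let_def cx using y2 ra unfolding S by Groebner_Basis.algebra
  moreover have "bilB (emb [:c:]) (emb [:d:]) (emb T) (coords x) (coords x) = 0"
    unfolding bilB_def Let_def cx using ra unfolding S by Groebner_Basis.algebra
  moreover have "x $ 3 \<noteq> 0" by (simp add: x_def)
  then have "x \<noteq> 0" by auto
  moreover have "x $ i \<in> L" for i
  proof -
    have "y \<in> span" unfolding y_def by (intro span_mult span_emb span_rho span_sigma)
    then have "x $ i \<in> span" using span_emb[of 0] span_emb[of 1] span_rho by (simp add: x_def)
    then show ?thesis by (rule span_L)
  qed
  ultimately show ?thesis unfolding surface_points by blast
qed

text \<open>With \<open>V = Z = 0\<close> and \<open>W = 1\<close>, \<open>B\<close> gives
  \<open>U\<^sup>2 = d T\<close>, and then \<open>A\<close> gives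
  \<open>Y\<^sup>2 = (c / d) U\<^sup>2 ((1 + c) d T - 1)\<close>.\<close>

lemma biquadratic_point_V_Z_zero:
  assumes bq: "biquadratic \<alpha> \<beta> \<rho> \<sigma>" and \<alpha>: "\<alpha> = smult d T" and \<beta>: "\<beta> = smult ((1 + c) * d) T - 1"
  shows "points dp4 (biquadratic.L \<rho> \<sigma>) \<noteq> {}"
proof -
  interpret biquadratic \<alpha> \<beta> \<rho> \<sigma> by (rule bq)
  define y where "y = emb [:\<kappa> / d:] * \<rho> * \<sigma>"
  define x :: "'a poly fract alg_closure ^ 5" where
    "x = (\<chi> i. if i = 0 then \<rho> else if i = 2 then 1 else if i = 4 then y else 0)"
  have cx: "coords x 0 = \<rho>" "coords x 1 = 0" "coords x (Suc 0) = 0" "coords x 2 = 1" "coords x 3 = 0" "coords x 4 = y"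
    by (simp_all add: x_def coords_simps)
  have ra: "\<rho>\<^sup>2 = emb [:d:] * emb T"
  proof -
    have "\<alpha> = [:d:] * T" by (simp add: \<alpha>)
    then show ?thesis unfolding rho
      by (simp only: to_fract_mult to_fract_uminus to_ac_mult to_ac_minus)
  qed
  have sb: "\<sigma>\<^sup>2 = (1 + emb [:c:]) * emb [:d:] * emb T - 1"
  proof -
    have "\<beta> = (1 + [:c:]) * [:d:] * T - 1" by (simp add: \<beta> one_pCons mult.commute)
    then show ?thesis unfolding sigma
      by (simp only: to_fract_mult to_fract_add to_fract_diff to_fract_1 to_ac_mult to_ac_add to_ac_diff to_ac_1)
  qed
  have kd: "(emb [:\<kappa> / d:])\<^sup>2 * emb [:d:] = emb [:c:]"
  proof -
    have "[:\<kappa> / d:]\<^sup>2 * [:d:] = [:c:]" using kappa_div_d nonzero by (simp add: power2_eq_square)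
    then have "emb ([:\<kappa> / d:]\<^sup>2 * [:d:]) = emb [:c:]" by (rule arg_cong)
    then show ?thesis by (simp only: power2_eq_square to_fract_mult to_ac_mult)
  qed
  have "y\<^sup>2 = (emb [:\<kappa> / d:])\<^sup>2 * \<rho>\<^sup>2 * \<sigma>\<^sup>2" unfolding y_def by Groebner_Basis.algebra
  also have "\<dots> = (emb [:\<kappa> / d:])\<^sup>2 * emb [:d:] * emb T * ((1 + emb [:c:]) * emb [:d:] * emb T - 1)"
    unfolding ra sb by Groebner_Basis.algebra
  finally have y2: "y\<^sup>2 = emb [:c:] * emb T * ((1 + emb [:c:]) * emb [:d:] * emb T - 1)" unfolding kd .
  have "bilA (emb [:c:]) (emb [:d:]) (emb T) (coords x) (coords x) = 0"
    unfolding bilA_def Let_def cx using y2 ra by Groebner_Basis.algebra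
  moreover have "bilB (emb [:c:]) (emb [:d:]) (emb T) (coords x) (coords x) = 0"
    unfolding bilB_def Let_def cx using ra by Groebner_Basis.algebra
  moreover have "x $ 2 \<noteq> 0" by (simp add: x_def)
  then have "x \<noteq> 0" by auto
  moreover have "x $ i \<in> L" for i
  proof -
    have "y \<in> span" unfolding y_def by (intro span_mult span_emb span_rho span_sigma)
    then have "x $ i \<in> span" using span_emb[of 0] span_emb[of 1] span_rho by (simp add: x_def)
    then show ?thesis by (rule span_L)
  qed
  ultimately show ?thesis unfolding surface_points by blast
qed

end

section \<open>Infinitely many isomorphism classes\<close>

lemma odd_degree_nonsquare_poly:
  assumes "odd (degree \<alpha>)" shows "nonsquare_poly \<alpha>"
  unfolding nonsquare_poly_def
proof (intro allI impI, rule ccontr)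
  fix p q assume eq: "p\<^sup>2 = \<alpha> * q\<^sup>2" and q: "q \<noteq> 0"
  have "\<alpha> \<noteq> 0" using assms by auto
  then have "\<alpha> * q\<^sup>2 \<noteq> 0" "degree (\<alpha> * q\<^sup>2) = degree \<alpha> + 2 * degree q"
    using q by (simp_all add: degree_mult_eq degree_power_eq)
  moreover from this have "p \<noteq> 0" unfolding eq[symmetric] by simp
  then have "degree (p\<^sup>2) = 2 * degree p" by (simp add: degree_power_eq)
  ultimately have "2 * degree p = degree \<alpha> + 2 * degree q" unfolding eq by simp
  then show False using assms by presburger
qed

lemma nonsquare_lead_coeff:
  assumes "\<nexists>z. z\<^sup>2 = lead_coeff \<alpha>" shows "nonsquare_poly \<alpha>"
  unfolding nonsquare_poly_def
proof (intro allI impI, rule ccontr)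
  fix p q assume eq: "p\<^sup>2 = \<alpha> * q\<^sup>2" and q: "q \<noteq> 0"
  have "(lead_coeff p)\<^sup>2 = lead_coeff \<alpha> * (lead_coeff q)\<^sup>2"
    using arg_cong[OF eq, of lead_coeff] by (simp only: lead_coeff_mult lead_coeff_power)
  then have "(lead_coeff p / lead_coeff q)\<^sup>2 = lead_coeff \<alpha>" using q by (simp add: power_divide)
  then show False using assms by blast
qed

lemma squarefree_smult:
  "k \<noteq> 0 \<Longrightarrow> squarefree (smult k f) \<longleftrightarrow> squarefree f" for f :: "'a::field_gcd poly"
  by (simp add: squarefree_def dvd_smult_iff)

lemma squarefree_pderiv:
  fixes f :: "'a::field_gcd poly"
  assumes "f \<noteq> 0" "\<And>u. u dvd f \<Longrightarrow> u dvd pderiv f \<Longrightarrow> is_unit u"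
  shows "squarefree f"
proof (rule squarefreeI)
  fix u assume "u\<^sup>2 dvd f"
  then obtain g where g: "f = u\<^sup>2 * g" by (rule dvdE)
  have "pderiv f = u * (u * pderiv g + 2 * pderiv u * g)"
    unfolding g by (simp add: pderiv_mult power2_eq_square algebra_simps)
  then show "is_unit u" using assms(2)[of u] g by (simp add: power2_eq_square)
qed

lemma pderiv_power_char: "of_nat n = (0::'a::field_gcd) \<Longrightarrow> pderiv ((f :: 'a poly) ^ n) = 0"
  by (cases n) (simp_all add: pderiv_power_Suc del: of_nat_Suc power_Suc)

section \<open>Choosing the next polynomial\<close>

locale surface_constants =
  fixes c d \<kappa> :: "'a::field_gcd" and n :: nat
  assumes two: "(2::'a) \<noteq> 0" and c_ns: "\<nexists>z. z\<^sup>2 = c" and d_ns: "\<nexists>z. z\<^sup>2 = d"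
    and cd_sum: "c + d = 1" and cd_prod: "c * d = \<kappa>\<^sup>2" and char: "of_nat n = (0::'a)" "n > 0"
    and ns_mult: "\<And>a b :: 'a. \<nexists>z. z\<^sup>2 = a \<Longrightarrow> \<nexists>z. z\<^sup>2 = b \<Longrightarrow> \<exists>z. z\<^sup>2 = a * b"
    and three: "\<exists>z::'a. z\<^sup>2 = 2 \<Longrightarrow> (3::'a) \<noteq> 0"
begin

definition splits_at :: "'a poly \<Rightarrow> 'a poly \<Rightarrow> bool" where
  "splits_at \<alpha> \<pi> \<longleftrightarrow> (\<exists>x. \<not> \<pi> dvd x \<and> \<pi> dvd x\<^sup>2 - \<alpha>)"

text \<open>\<open>H\<close> will be the product of the earlier polynomials. The two radicands give
  a biquadratic field that provides a point on the new surface and splits at all primes of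
  \<open>H\<close>, so that the earlier surfaces stay without points over it.\<close>

definition good :: "'a poly \<Rightarrow> 'a poly \<Rightarrow> 'a poly \<Rightarrow> 'a poly \<Rightarrow> bool" where
  "good H T \<alpha> \<beta> \<longleftrightarrow> surface_parameters c d \<kappa> T \<and>
     nonsquare_poly \<alpha> \<and> nonsquare_poly \<beta> \<and> nonsquare_poly (\<alpha> * \<beta>) \<and>
     (\<forall>\<rho> \<sigma>. biquadratic \<alpha> \<beta> \<rho> \<sigma> \<longrightarrow>
        points (surface (cst c) (cst d) (to_fract T)) (biquadratic.L \<rho> \<sigma>) \<noteq> {}) \<and>
     (\<forall>\<pi>. prime_elem \<pi> \<longrightarrow> \<pi> dvd H \<longrightarrow> splits_at \<alpha> \<pi> \<and> splits_at \<beta> \<pi>)"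

lemma nz: "c \<noteq> 0" "d \<noteq> 0" "\<kappa> \<noteq> 0"
proof -
  show "c \<noteq> 0" "d \<noteq> 0" using c_ns d_ns by (metis power_zero_numeral)+
  then show "\<kappa> \<noteq> 0" using cd_prod by auto
qed

lemma splits_at_const:
  assumes "prime_elem \<pi>" "x \<noteq> 0" "\<pi> dvd \<alpha> - [:x\<^sup>2:]"
  shows "splits_at \<alpha> \<pi>"
proof -
  have "is_unit [:x:]" using assms(2) by (simp add: is_unit_pCons_iff)
  then have "\<not> \<pi> dvd [:x:]" using prime_elem_not_unit[OF assms(1)] dvd_trans by blast
  moreover have "\<pi> dvd [:x:]\<^sup>2 - \<alpha>" using assms(3) by (simp add: power2_eq_square dvd_diff_commute)
  ultimately show ?thesis unfolding splits_at_def by blast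
qed

text \<open>\<open>T\<close> is built so that \<open>1 + c d T = \<beta> Q\<^sup>2\<close>, as the
  point with \<open>V = W = 0\<close> requires. That fixes \<open>\<alpha>\<close> modulo
  \<open>H\<close> as 2 times the nonsquare 1/c, hence the hypothesis on 2. Even degree of
  \<open>Q\<close> makes the degree of \<open>T\<close> odd.\<close>

lemma good_two_nonsquare:
  assumes H: "H \<noteq> 0" and two_ns: "\<nexists>z::'a. z\<^sup>2 = 2"
  shows "\<exists>T \<alpha> \<beta>. good H T \<alpha> \<beta>"
proof -
  \<comment> \<open>\<open>Q\<close> has derivative \<open>0\<close>, and modulo \<open>H\<close> we get \<open>c d T \<equiv> - 1\<close>, so \<open>\<alpha> \<equiv> 2 / c\<close>, a nonzero square.\<close>
  define Q where "Q = (H\<^sup>2) ^ n"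
  define E where "E = Q\<^sup>2 + [:0, 1:] * Q ^ 3"
  define T where "T = smult (1 / (c * d)) (E - 1)"
  define S where "S = 1 - smult (c * d) T"
  define \<alpha> where "\<alpha> = - smult d (T * S)"
  define \<beta> where "\<beta> = 1 + [:0, 1:] * Q"
  have Q0: "Q \<noteq> 0" using H by (simp add: Q_def)
  have dQ: "even (degree Q)" using H by (simp add: Q_def degree_power_eq)
  have E: "E = \<beta> * Q\<^sup>2" unfolding E_def \<beta>_def by Groebner_Basis.algebra
  have d\<beta>: "degree \<beta> = 1 + degree Q"
  proof -
    have "degree ([:0, 1:] * Q) = 1 + degree Q" using Q0 by (subst degree_mult_eq) auto
    then show ?thesis unfolding \<beta>_def by (subst degree_add_eq_right) auto
  qed
  have \<beta>0: "\<beta> \<noteq> 0" using d\<beta> by auto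
  have dE: "degree E = 1 + 3 * degree Q" unfolding E using Q0 \<beta>0 d\<beta> by (simp add: degree_mult_eq degree_power_eq)
  have dE1: "degree (E - [:k:]) = degree E" for k
  proof -
    have "degree (E + - [:k:]) = degree E" by (rule degree_add_eq_left) (simp add: dE)
    then show ?thesis by (simp only: diff_conv_add_uminus)
  qed
  have pE: "pderiv E = Q ^ 3"
  proof -
    have "pderiv Q = 0" unfolding Q_def by (rule pderiv_power_char[OF char(1)])
    then show ?thesis by (simp add: E_def pderiv_add pderiv_mult pderiv_power pderiv_pCons)
  qed
  have sf: "squarefree (E - [:k:])" if "k \<noteq> 0" for k
  proof (rule squarefree_pderiv)
    show "E - [:k:] \<noteq> 0" using dE1[of k] dE by auto
    fix u assume u: "u dvd E - [:k:]" "u dvd pderiv (E - [:k:])"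
    have "pderiv (E - [:k:]) = Q ^ 3" using pE by (simp add: pderiv_diff pderiv_pCons)
    then have "u dvd Q ^ 3 * \<beta>" using u(2) by simp
    then have "u dvd Q ^ 3 * \<beta> - Q * (E - [:k:])" using u(1) by (intro dvd_diff) auto
    \<comment> \<open>A common divisor of \<open>E - [:k:]\<close> and its derivative divides
      \<open>Q\<close>, hence \<open>E\<close>, hence the constant \<open>k\<close>.\<close>
    moreover have "Q ^ 3 * \<beta> - Q * (E - [:k:]) = [:k:] * Q" unfolding E by Groebner_Basis.algebra
    ultimately have "u dvd smult k Q" by simp
    then have "u dvd Q" using that by (simp add: dvd_smult_iff)
    then have "u dvd E" unfolding E by (simp add: power2_eq_square)
    then have "u dvd E - (E - [:k:])" using u(1) by (rule dvd_diff)
    then have "u dvd [:k:]" by simp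
    then show "is_unit u" using that by (meson dvd_trans is_unit_pCons_iff)
  qed
  have SE: "S = [:2:] - E"
  proof -
    have "smult (c * d) T = E - 1" using nz by (simp add: T_def)
    then show ?thesis by (simp add: S_def one_pCons numeral_poly)
  qed
  have par: "surface_parameters c d \<kappa> T"
  proof
    show "odd (degree T)" using nz dE1[of 1] dE dQ by (simp add: T_def one_pCons)
    show "squarefree T" unfolding T_def using sf[of 1] nz by (simp add: squarefree_smult one_pCons)
    have "squarefree (E - [:2:])" using two by (rule sf)
    then have "squarefree (- (E - [:2:]))" by (simp only: squarefree_minus)
    then show "squarefree (1 - smult (c * d) T)" using SE by (simp add: S_def)
  qed (fact two c_ns d_ns cd_sum cd_prod)+
  have \<alpha>_eq: "smult c \<alpha> = - (E - [:1:]) * ([:2:] - E)"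
  proof -
    have "smult c \<alpha> = - smult (c * d) T * S" by (simp add: \<alpha>_def)
    moreover have "smult (c * d) T = E - [:1:]" using nz by (simp add: T_def one_pCons)
    ultimately show ?thesis by (simp only: SE)
  qed
  have ns\<alpha>: "nonsquare_poly \<alpha>"
  proof (rule nonsquare_lead_coeff)
    have l: "lead_coeff (E - [:k:]) = lead_coeff E" for k
      using dE1[of k] dE by (simp add: coeff_pCons split: nat.splits)
    have "smult c \<alpha> = (E - [:1:]) * (E - [:2:])" unfolding \<alpha>_eq by Groebner_Basis.algebra
    then have "c * lead_coeff \<alpha> = (lead_coeff E)\<^sup>2"
      by (metis lead_coeff_smult lead_coeff_mult l power2_eq_square)
    then have "lead_coeff \<alpha> = (lead_coeff E)\<^sup>2 / c" using nz by (simp add: field_simps)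
    moreover have "E \<noteq> 0" using dE by auto
    then have "lead_coeff E \<noteq> 0" by (simp only: leading_coeff_0_iff not_False_eq_True)
    ultimately show "\<nexists>z. z\<^sup>2 = lead_coeff \<alpha>"
      using c_ns nz by (metis divide_divide_eq_right nonzero_mult_div_cancel_left power_divide power_not_zero)
  qed
  have d\<alpha>: "even (degree \<alpha>)"
  proof -
    have "E - [:k:] \<noteq> 0" for k using dE1[of k] dE by (metis degree_0 add_is_0 one_neq_zero)
    moreover have "smult c \<alpha> = (E - [:1:]) * (E - [:2:])" unfolding \<alpha>_eq by Groebner_Basis.algebra
    ultimately have "degree (smult c \<alpha>) = degree E + degree E" by (simp only: degree_mult_eq dE1 not_False_eq_True)
    then show ?thesis using nz by simp
  qed
  have \<alpha>0: "\<alpha> \<noteq> 0" using ns\<alpha> unfolding nonsquare_poly_def by (metis mult_zero_left one_neq_zero power_zero_numeral)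
  have \<alpha>_S: "\<alpha> = - smult d (T * (1 - smult (c * d) T))" by (simp add: \<alpha>_def S_def)
  have pts: "points (surface (cst c) (cst d) (to_fract T)) (biquadratic.L \<rho> \<sigma>) \<noteq> {}" if "biquadratic \<alpha> \<beta> \<rho> \<sigma>" for \<rho> \<sigma>
  proof -
    interpret surface_parameters c d \<kappa> T by (rule par)
    show ?thesis
    proof (rule biquadratic_point_V_W_zero[OF that, of Q])
      show "\<alpha> = - smult d (T * surface_parameters.S c d T)"
        by (simp add: \<alpha>_S surface_parameters.S_def[OF par])
      show "1 + smult (c * d) T = \<beta> * Q\<^sup>2" using nz by (simp add: T_def flip: E)
    qed
  qed
  obtain z where z: "z\<^sup>2 = 2 * c" using ns_mult[OF two_ns c_ns] by blast
  have z0: "z \<noteq> 0" using z two nz by auto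
  have split: "splits_at \<alpha> \<pi>" "splits_at \<beta> \<pi>" if \<pi>: "prime_elem \<pi>" "\<pi> dvd H" for \<pi>
  proof -
    have \<pi>Q: "\<pi> dvd Q" unfolding Q_def using that char(2)
      by (metis dvd_power dvd_trans dvd_mult2 power2_eq_square less_irrefl)
    show "splits_at \<beta> \<pi>"
      by (rule splits_at_const[OF \<pi>(1), of 1]) (use \<pi>Q dvd_mult[OF \<pi>Q, of "[:0, 1:]"] in \<open>simp_all add: \<beta>_def one_pCons\<close>)
    have "\<pi> dvd E" unfolding E using \<pi>Q by (simp add: power2_eq_square)
    then have "\<pi> dvd E * (E - [:3:])" by (rule dvd_mult2)
    moreover have "smult c (\<alpha> - [:(z / c)\<^sup>2:]) = E * (E - [:3:])"
    proof -
      have "smult c (\<alpha> - [:(z / c)\<^sup>2:]) = - (E - [:1:]) * ([:2:] - E) - [:2:]"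
        using \<alpha>_eq nz z by (simp add: smult_diff_right power_divide power2_eq_square)
      also have "\<dots> = E * E - ([:1:] + [:2:]) * E + ([:1:] * [:2:] - [:2:])" by Groebner_Basis.algebra
      also have "\<dots> = E * E - [:3:] * E" by simp
      finally show ?thesis by (simp only: right_diff_distrib mult.commute[of E "[:3:]"])
    qed
    ultimately have "\<pi> dvd \<alpha> - [:(z / c)\<^sup>2:]" using nz by (metis dvd_smult_iff)
    then show "splits_at \<alpha> \<pi>" using z0 nz by (intro splits_at_const[OF \<pi>(1), of "z / c"]) auto
  qed
  have "good H T \<alpha> \<beta>"
    unfolding good_def using par ns\<alpha> pts split d\<alpha> d\<beta> dQ \<alpha>0 \<beta>0
    by (auto intro!: odd_degree_nonsquare_poly simp: degree_mult_eq)
  then show ?thesis by blast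
qed

lemma one_plus_c:
  assumes "w\<^sup>2 = (2::'a)"
  shows "1 + c \<noteq> 0"
proof
  assume "1 + c = 0"
  moreover have "1 + c + d = 1 + 1" using cd_sum by (simp only: add.assoc)
  ultimately have "w\<^sup>2 = d" using assms by simp
  then show False using d_ns by blast
qed

text \<open>With \<open>d T\<close> congruent to \<open>x\<^sup>2\<close>, the second radicand of
  the point with \<open>V = Z = 0\<close> is congruent to \<open>(1 + c) x\<^sup>2 - 1\<close>. Both
  must be nonzero squares modulo \<open>H\<close>.\<close>

lemma conic_point:
  assumes "w\<^sup>2 = (2::'a)"
  obtains x y where "(1 + c) * x\<^sup>2 - 1 = y\<^sup>2" "x \<noteq> 0" "y \<noteq> 0"
proof (cases "\<exists>m. m\<^sup>2 = 1 + c")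
  case True
  have c1: "1 + c \<noteq> 0" by (rule one_plus_c[OF assms])
  obtain m where m: "m\<^sup>2 = 1 + c" using True by blast
  have m0: "m \<noteq> 0" and w0: "w \<noteq> 0" using m c1 assms two by auto
  have 3: "(3::'a) \<noteq> 0" using three assms by blast
  have "(2::'a) * 2 = 4" by simp
  then have 4: "(4::'a) \<noteq> 0" using two by (metis mult_eq_0_iff)
  show thesis
  \<comment> \<open>From 9/8 - 1 = 1/8, where \<open>m * m = 1 + c\<close> and \<open>2 * w\<close>
    squares to 8; characteristic 3 would make \<open>x\<close> zero.\<close>
  proof (rule that[of "3 / (2 * w * m)" "1 / (2 * w)"])
    have "(3 / (2 * w * m))\<^sup>2 * m\<^sup>2 * (2 * w)\<^sup>2 = 9" "(1 / (2 * w))\<^sup>2 * (2 * w)\<^sup>2 = 1"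
      using m0 w0 two 4 by (simp_all add: power_divide power_mult_distrib)
    moreover have "((1 + c) * A - 1 - K) * (2 * w)\<^sup>2 = 0"
      if "A * m\<^sup>2 * (2 * w)\<^sup>2 = 9" "K * (2 * w)\<^sup>2 = 1" for A K
    proof -
      have "(2 * w)\<^sup>2 = 8" using assms by (simp add: power_mult_distrib)
      moreover have "(1 + c) * A = A * m\<^sup>2" by (simp add: m)
      ultimately show ?thesis using that by (simp only: left_diff_distrib) simp
    qed
    ultimately have "((1 + c) * (3 / (2 * w * m))\<^sup>2 - 1 - (1 / (2 * w))\<^sup>2) * (2 * w)\<^sup>2 = 0" by blast
    then show "(1 + c) * (3 / (2 * w * m))\<^sup>2 - 1 = (1 / (2 * w))\<^sup>2" using w0 two 4 by simp
  qed (use 3 m0 w0 two in auto)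
next
  case False
  then obtain z where z: "z\<^sup>2 = (1 + c) * c" using ns_mult[OF _ c_ns] by blast
  have c1: "1 + c \<noteq> 0" using False by (metis power_zero_numeral)
  then have z0: "z \<noteq> 0" using z nz by auto
  show thesis
  \<comment> \<open>Here \<open>(1 + c) / z\<^sup>2\<close> is 1/c, and 1/c - 1 = d/c is a square
    because \<open>c d\<close> is.\<close>
  proof (rule that[of "1 / z" "\<kappa> / c"])
    have "(1 + c) * (1 / z)\<^sup>2 = 1 / c" using z z0 c1 nz by (simp add: power_divide)
    moreover have "(\<kappa> / c)\<^sup>2 = d / c" using cd_prod nz by (simp add: power_divide power2_eq_square field_simps)
    moreover have "1 / c - 1 = d / c" using nz cd_sum by (simp add: field_simps)
    ultimately show "(1 + c) * (1 / z)\<^sup>2 - 1 = (\<kappa> / c)\<^sup>2" by simp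
  qed (use z0 nz in auto)
qed

lemma good_two_square:
  assumes H: "H \<noteq> 0" and "w\<^sup>2 = (2::'a)"
  shows "\<exists>T \<alpha> \<beta>. good H T \<alpha> \<beta>"
proof -
  obtain x y where xy: "(1 + c) * x\<^sup>2 - 1 = y\<^sup>2" "x \<noteq> 0" "y \<noteq> 0" using conic_point[OF assms(2)] .
  have c1: "1 + c \<noteq> 0" by (rule one_plus_c[OF assms(2)])
  \<comment> \<open>Modulo \<open>H\<close> we get \<open>\<alpha> \<equiv> x\<^sup>2\<close> and \<open>\<beta> \<equiv> y\<^sup>2\<close>.\<close>
  define Q where "Q = (H\<^sup>2) ^ n"
  define e where "e = x\<^sup>2 / d"
  define T where "T = [:e:] + [:0, 1:] * Q"
  define \<alpha> where "\<alpha> = smult d T"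
  define \<beta> where "\<beta> = smult ((1 + c) * d) T - 1"
  have Q0: "Q \<noteq> 0" using H by (simp add: Q_def)
  have dQ: "even (degree Q)" using H by (simp add: Q_def degree_power_eq)
  have pQ: "pderiv Q = 0" unfolding Q_def by (rule pderiv_power_char[OF char(1)])
  have dlin: "degree ([:k:] + smult m ([:0, 1:] * Q)) = 1 + degree Q" if "m \<noteq> 0" for k m
  proof -
    have "degree (smult m ([:0, 1:] * Q)) = 1 + degree Q" using Q0 that by (simp add: degree_mult_eq)
    then show ?thesis by (subst degree_add_eq_right) auto
  qed
  have sf: "squarefree ([:k:] + smult m ([:0, 1:] * Q))" if "k \<noteq> 0" "m \<noteq> 0" for k m
  proof (rule squarefree_pderiv)
    show "[:k:] + smult m ([:0, 1:] * Q) \<noteq> 0" using dlin[OF that(2), of k] by auto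
    fix u assume u: "u dvd [:k:] + smult m ([:0, 1:] * Q)" "u dvd pderiv ([:k:] + smult m ([:0, 1:] * Q))"
    have "pderiv ([:k:] + smult m ([:0, 1:] * Q)) = smult m Q"
      using pQ by (simp add: pderiv_add pderiv_smult pderiv_mult pderiv_pCons)
    then have "u dvd Q" using u(2) that by (simp add: dvd_smult_iff)
    then have "u dvd smult m ([:0, 1:] * Q)" by (intro dvd_smult dvd_mult)
    then have "u dvd ([:k:] + smult m ([:0, 1:] * Q)) - smult m ([:0, 1:] * Q)" using u(1) by (intro dvd_diff)
    then have "u dvd [:k:]" by simp
    then show "is_unit u" using that by (meson dvd_trans is_unit_pCons_iff)
  qed
  have e0: "e \<noteq> 0" "d * e = x\<^sup>2" using xy nz by (simp_all add: e_def)
  have cde: "1 - c * d * e \<noteq> 0"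
  proof
    assume "1 - c * d * e = 0"
    then have "(1 / x)\<^sup>2 = c" using e0 xy(2) by (simp add: power_divide field_simps)
    then show False using c_ns by blast
  qed
  have T1: "T = [:e:] + smult 1 ([:0, 1:] * Q)" by (simp add: T_def)
  have S1: "1 - smult (c * d) T = [:1 - c * d * e:] + smult (- (c * d)) ([:0, 1:] * Q)"
    by (simp add: T_def smult_add_right one_pCons)
  have \<beta>1: "\<beta> = [:(1 + c) * d * e - 1:] + smult ((1 + c) * d) ([:0, 1:] * Q)"
    by (simp add: T_def \<beta>_def smult_add_right one_pCons)
  have dT: "degree T = 1 + degree Q" and d\<beta>: "degree \<beta> = 1 + degree Q"
    unfolding T1 \<beta>1 using c1 nz by (intro dlin; simp)+
  have par: "surface_parameters c d \<kappa> T"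
  proof
    show "odd (degree T)" using dT dQ by simp
    show "squarefree T" unfolding T1 using e0 by (intro sf) auto
    show "squarefree (1 - smult (c * d) T)" unfolding S1 using cde nz by (intro sf) auto
  qed (fact two c_ns d_ns cd_sum cd_prod)+
  have T0: "T \<noteq> 0" and \<beta>0: "\<beta> \<noteq> 0" using dT d\<beta> by auto
  \<comment> \<open>The product has even degree and its leading coefficient may be a square.
    Instead, a prime of odd multiplicity in \<open>T\<close> is used; there \<open>\<beta>\<close>
    is congruent to -1 and contributes nothing.\<close>
  have ns: "nonsquare_poly (\<alpha> * \<beta>)"
    unfolding nonsquare_poly_def
  proof (intro allI impI, rule ccontr)
    fix p q assume eq: "p\<^sup>2 = \<alpha> * \<beta> * q\<^sup>2" and q: "q \<noteq> 0"
    obtain \<pi> where \<pi>: "prime_elem \<pi>" "odd (degree \<pi>)" "odd (multiplicity \<pi> T)"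
      using odd_degree_prime[of T] dT dQ by auto
    have "\<pi> dvd T" using \<pi>(3) not_dvd_imp_multiplicity_0[of \<pi> T] by fastforce
    have "\<not> \<pi> dvd \<beta>"
    proof
      assume "\<pi> dvd \<beta>"
      then have "\<pi> dvd smult ((1 + c) * d) T - \<beta>" using \<open>\<pi> dvd T\<close> by (intro dvd_diff dvd_smult)
      then have "is_unit \<pi>" by (simp add: \<beta>_def)
      then show False using prime_elem_not_unit[OF \<pi>(1)] by blast
    qed
    then have "multiplicity \<pi> \<beta> = 0" by (rule not_dvd_imp_multiplicity_0)
    moreover have "multiplicity \<pi> [:d:] = 0" using nz by (simp add: multiplicity_unit_right is_unit_pCons_iff)
    moreover have "p \<noteq> 0" using eq q T0 \<beta>0 nz by (auto simp: \<alpha>_def)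
    moreover have "p\<^sup>2 = [:d:] * T * \<beta> * q\<^sup>2" using eq by (simp add: \<alpha>_def)
    then have "multiplicity \<pi> (p\<^sup>2) = multiplicity \<pi> ([:d:] * T * \<beta> * q\<^sup>2)" by simp
    ultimately have "2 * multiplicity \<pi> p = multiplicity \<pi> T + 2 * multiplicity \<pi> q"
      using \<pi>(1) q T0 \<beta>0 nz
      by (simp add: prime_elem_multiplicity_mult_distrib prime_elem_multiplicity_power_distrib del: mult_pCons_left)
    then show False using \<pi>(3) by presburger
  qed
  have pts: "points (surface (cst c) (cst d) (to_fract T)) (biquadratic.L \<rho> \<sigma>) \<noteq> {}" if "biquadratic \<alpha> \<beta> \<rho> \<sigma>" for \<rho> \<sigma>
    by (rule surface_parameters.biquadratic_point_V_Z_zero[OF par that \<alpha>_def \<beta>_def])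
  have split: "splits_at \<alpha> \<pi>" "splits_at \<beta> \<pi>" if \<pi>: "prime_elem \<pi>" "\<pi> dvd H" for \<pi>
  proof -
    have \<pi>Q: "\<pi> dvd Q" unfolding Q_def using that char(2)
      by (metis dvd_power dvd_trans dvd_mult2 power2_eq_square less_irrefl)
    have "\<alpha> - [:x\<^sup>2:] = smult d ([:0, 1:] * Q)"
      unfolding \<alpha>_def T_def by (simp add: smult_add_right e0)
    then show "splits_at \<alpha> \<pi>"
      by (intro splits_at_const[OF \<pi>(1) xy(2)]) (simp only:, intro dvd_smult dvd_mult \<pi>Q)
    have "(1 + c) * d * e - 1 = y\<^sup>2" using xy(1) e0 by (simp add: mult.assoc)
    then have "\<beta> - [:y\<^sup>2:] = smult ((1 + c) * d) ([:0, 1:] * Q)" unfolding \<beta>1 by simp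
    then show "splits_at \<beta> \<pi>"
      by (intro splits_at_const[OF \<pi>(1) xy(3)]) (simp only:, intro dvd_smult dvd_mult \<pi>Q)
  qed
  have "nonsquare_poly \<alpha>" "nonsquare_poly \<beta>"
    using dT d\<beta> dQ nz by (auto intro!: odd_degree_nonsquare_poly simp: \<alpha>_def)
  then have "good H T \<alpha> \<beta>" unfolding good_def using par ns pts split by auto
  then show ?thesis by blast
qed

lemma isomorphic_sym: "isomorphic V W \<Longrightarrow> isomorphic W V"
  unfolding isomorphic_def by blast

text \<open>For \<open>i < k\<close> the biquadratic field of stage \<open>k\<close> splits at every
  prime of \<open>T i\<close>: it gives a point to \<open>V k\<close> and none to
  \<open>V i\<close>, while an isomorphism would transport the point. The same separation makes
  \<open>V\<close> injective, so its range is infinite.\<close>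

theorem infinite_family:
  "\<exists>\<S> :: ('a poly fract poly5 \<times> 'a poly fract poly5) set. infinite \<S> \<and>
    (\<forall>V\<in>\<S>. quartic_del_pezzo V \<and> (\<forall>K. quadratic_extension K \<longrightarrow> points V K = {})) \<and>
    pairwise (\<lambda>V W. \<not> isomorphic V W) \<S>"
proof -
  have "\<exists>T \<alpha> \<beta>. good H T \<alpha> \<beta>" if "H \<noteq> 0" for H
    using good_two_nonsquare[OF that] good_two_square[OF that] by (cases "\<exists>z::'a. z\<^sup>2 = 2") blast+
  then obtain next_T next_\<alpha> next_\<beta> where next_good: "\<And>H. H \<noteq> 0 \<Longrightarrow> good H (next_T H) (next_\<alpha> H) (next_\<beta> H)"
    by metis
  define P where "P = rec_nat 1 (\<lambda>_ H. H * next_T H)"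
  define T where "T = (\<lambda>k. next_T (P k))"
  have P: "P 0 = 1" "P (Suc k) = P k * T k" for k by (simp_all add: P_def T_def)
  have P0: "P k \<noteq> 0" for k
  proof (induction k)
    case (Suc k)
    have "surface_parameters c d \<kappa> (T k)" using next_good[OF Suc] by (simp add: T_def good_def)
    then have "T k \<noteq> 0" by (rule surface_parameters.nonzero)
    then show ?case using Suc P by simp
  qed (simp add: P)
  have good: "good (P k) (T k) (next_\<alpha> (P k)) (next_\<beta> (P k))" for k
    using next_good[OF P0] by (simp add: T_def)
  have dvd: "T i dvd P k" if "i < k" for i k
    using that by (induction k) (auto simp: P less_Suc_eq)
  define V where "V = (\<lambda>k. surface (cst c) (cst d) (to_fract (T k)))"
  have par: "surface_parameters c d \<kappa> (T k)" for k using good[of k] by (simp add: good_def)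
  have separate: "\<exists>L. range to_ac \<subseteq> L \<and> (\<forall>x\<in>L. \<forall>y\<in>L. x + y \<in> L \<and> x * y \<in> L) \<and>
      points (V i) L = {} \<and> points (V k) L \<noteq> {}" if "i < k" for i k
  proof -
    let ?\<alpha> = "next_\<alpha> (P k)" and ?\<beta> = "next_\<beta> (P k)"
    obtain \<rho> where r: "\<rho>\<^sup>2 = emb ?\<alpha>" using nth_root_exists[OF pos2, of "emb ?\<alpha>"] by blast
    obtain \<sigma> where rs: "\<rho>\<^sup>2 = emb ?\<alpha>" "\<sigma>\<^sup>2 = emb ?\<beta>"
      using r nth_root_exists[OF pos2, of "emb ?\<beta>"] by blast
    have bq: "biquadratic ?\<alpha> ?\<beta> \<rho> \<sigma>"
      by standard (use rs two good[of k] in \<open>auto simp: good_def\<close>)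
    interpret bq: biquadratic ?\<alpha> ?\<beta> \<rho> \<sigma> by (rule bq)
    interpret Ti: surface_parameters c d \<kappa> "T i" by (rule par)
    obtain \<pi> where \<pi>: "prime_elem \<pi>" "odd (degree \<pi>)" "multiplicity \<pi> (T i) = 1" by (rule Ti.exists_prime_T)
    have "\<pi> dvd T i" using \<pi>(3) not_dvd_imp_multiplicity_0[of \<pi> "T i"] by fastforce
    then have "\<pi> dvd P k" using dvd[OF that] dvd_trans by blast
    then have "splits_at ?\<alpha> \<pi>" "splits_at ?\<beta> \<pi>" using good[of k] \<pi>(1) by (auto simp: good_def)
    then have "points (V i) bq.L = {}"
      unfolding splits_at_def V_def using Ti.points_biquadratic_empty[OF bq \<pi>] by blast
    moreover have "points (V k) bq.L \<noteq> {}" using good[of k] bq by (simp add: good_def V_def)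
    ultimately show ?thesis
      by (intro exI[of _ bq.L] conjI ballI bq.L_range bq.L_add bq.L_mult)
  qed
  have not_iso: "\<not> isomorphic (V k) (V i)" if "i < k" for i k
  proof
    assume iso: "isomorphic (V k) (V i)"
    obtain L where L: "range to_ac \<subseteq> L" "\<forall>x\<in>L. \<forall>y\<in>L. x + y \<in> L \<and> x * y \<in> L"
      "points (V i) L = {}" "points (V k) L \<noteq> {}" using separate[OF \<open>i < k\<close>] by blast
    have "points (V i) L \<noteq> {}"
      by (rule isomorphic_points[OF iso, of 2 2]) (use L in \<open>auto simp: V_def surface_def homogeneous_forms\<close>)
    then show False using L by blast
  qed
  have "V i \<noteq> V k" if "i < k" for i k using separate[OF that] by metis
  then have inj: "inj V" by (metis injI linorder_neqE_nat)
  have "pairwise (\<lambda>V W. \<not> isomorphic V W) (range V)"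
  proof (rule pairwiseI)
    fix A B assume "A \<in> range V" "B \<in> range V" "A \<noteq> B"
    then obtain i k where ik: "A = V i" "B = V k" "i \<noteq> k" by blast
    then consider "i < k" | "k < i" by linarith
    then show "\<not> isomorphic A B"
    proof cases
      case 1
      then show ?thesis using not_iso isomorphic_sym unfolding ik by blast
    next
      case 2
      then show ?thesis using not_iso unfolding ik by blast
    qed
  qed
  moreover have "infinite (range V)" using inj finite_imageD infinite_UNIV_nat by blast
  moreover have "quartic_del_pezzo W \<and> (\<forall>K. quadratic_extension K \<longrightarrow> points W K = {})" if W: "W \<in> range V" for W
  proof -
    obtain k where k: "W = V k" using W by blast
    interpret surface_parameters c d \<kappa> "T k" by (rule par)
    show ?thesis unfolding k V_def using quartic_del_pezzo_dp4 no_quadratic_points by blast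
  qed
  ultimately show ?thesis by blast
qed

end

section \<open>Squares in finite fields and the choice of constants\<close>

lemma finite_field_nonsquare_mult:
  fixes a b :: "'a::{field, finite}"
  assumes a: "\<nexists>z. z\<^sup>2 = a" and b: "\<nexists>z. z\<^sup>2 = b"
  shows "\<exists>z. z\<^sup>2 = a * b"
proof (rule ccontr)
  assume ab: "\<nexists>z. z\<^sup>2 = a * b"
  \<comment> \<open>If \<open>a * b\<close> were also a nonsquare, then \<open>Q\<close>,
    \<open>a Q\<close> and \<open>b Q\<close> would be disjoint sets of nonzero elements. But
    squaring is at most two-to-one, so the nonzero elements number at most twice the size of
    \<open>Q\<close>.\<close>
  define Q where "Q = {z\<^sup>2 | z :: 'a. z \<noteq> 0}"
  have ab0: "a \<noteq> 0" "b \<noteq> 0" using a b by (metis power_zero_numeral)+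
  have disj: "Q \<inter> (*) a ` Q = {}" "(Q \<union> (*) a ` Q) \<inter> (*) b ` Q = {}"
  proof -
    have no: False if "z\<^sup>2 = k * y\<^sup>2" "y \<noteq> 0" "\<nexists>z. z\<^sup>2 = k" for z y k :: 'a
    proof -
      have "(z / y)\<^sup>2 = k" using that by (simp add: power_divide)
      then show False using that by blast
    qed
    show "Q \<inter> (*) a ` Q = {}" unfolding Q_def using no[OF _ _ a] by blast
    have "a * z\<^sup>2 \<noteq> b * y\<^sup>2" if "y \<noteq> 0" "z \<noteq> 0" for z y
    proof
      assume "a * z\<^sup>2 = b * y\<^sup>2"
      then have "(b * y)\<^sup>2 = a * b * z\<^sup>2" by (simp add: power2_eq_square ac_simps)
      then show False using no[OF _ that(2) ab] by blast
    qed
    then show "(Q \<union> (*) a ` Q) \<inter> (*) b ` Q = {}" unfolding Q_def using no[OF _ _ b] by blast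
  qed
  have inj: "inj_on ((*) k) Q" if "k \<noteq> 0" for k using that by (simp add: inj_on_def)
  have "card (Q \<union> (*) a ` Q \<union> (*) b ` Q) = card Q + card Q + card Q"
    using disj inj ab0 by (simp add: card_Un_disjoint card_image)
  moreover have "Q \<union> (*) a ` Q \<union> (*) b ` Q \<subseteq> UNIV - {0}" using ab0 by (auto simp: Q_def)
  then have "card (Q \<union> (*) a ` Q \<union> (*) b ` Q) \<le> card (UNIV - {0 :: 'a})" by (intro card_mono) auto
  moreover have "card (UNIV - {0 :: 'a}) \<le> card (Q \<times> {1, - 1 :: 'a})"
  proof -
    define r where "r = (\<lambda>y :: 'a. SOME z. z\<^sup>2 = y)"
    have r: "(r y)\<^sup>2 = y" if "y \<in> Q" for y
      using that unfolding r_def Q_def by (auto intro: someI_ex)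
    have "UNIV - {0} \<subseteq> (\<lambda>(y, e). e * r y) ` (Q \<times> {1, - 1})"
    proof
      fix x :: 'a assume "x \<in> UNIV - {0}"
      then have x: "x\<^sup>2 \<in> Q" by (auto simp: Q_def)
      from r[OF this] have "x = 1 * r (x\<^sup>2) \<or> x = - 1 * r (x\<^sup>2)"
        by (metis minus_mult_left mult_1 power2_eq_iff)
      then show "x \<in> (\<lambda>(y, e). e * r y) ` (Q \<times> {1, - 1})" using x by force
    qed
    then show ?thesis by (rule surj_card_le[rotated]) simp
  qed
  moreover have "card (Q \<times> {1, - 1 :: 'a}) \<le> card Q * 2"
    unfolding card_cartesian_product by (intro mult_le_mono2) (simp add: card_insert_if)
  moreover have "1\<^sup>2 \<in> Q" using one_neq_zero[where 'a = 'a] unfolding Q_def by blast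
  then have "Q \<noteq> {}" by blast
  then have "card Q > 0" by (simp only: card_gt_0_iff finite simp_thms)
  ultimately show False by linarith
qed

text \<open>Some \<open>z\<^sup>2 + 1 = a\<close> with \<open>z\<close> nonzero is not a square.
  Dividing by \<open>a\<close> gives 1 as the sum of the nonsquares \<open>1 / a\<close> and
  \<open>z\<^sup>2 / a\<close>, whose product is visibly a square.\<close>

lemma nonsquare_summands_mod_ring:
  assumes two: "(2 :: 'p::prime_card mod_ring) \<noteq> 0"
  obtains c d \<kappa> :: "'p::prime_card mod_ring" where "\<nexists>z. z\<^sup>2 = c" "\<nexists>z. z\<^sup>2 = d" "c + d = 1" "c * d = \<kappa>\<^sup>2"
proof -
  have "\<exists>z :: 'p mod_ring. z \<noteq> 0 \<and> (\<nexists>w. w\<^sup>2 = z\<^sup>2 + 1)"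
  proof (rule ccontr)
    assume neg: "\<not> ?thesis"
    \<comment> \<open>Otherwise adding 1 preserves squares, so every residue is one. Squaring would
      then be surjective, hence injective, although 1 and -1 have the same square.\<close>
    have "\<exists>w :: 'p mod_ring. w\<^sup>2 = of_nat n" for n
    proof (induction n)
      case 0
      show ?case by (rule exI[of _ 0]) simp
    next
      case (Suc n)
      then obtain w :: "'p mod_ring" where w: "w\<^sup>2 = of_nat n" by blast
      show ?case
      proof (cases "w = 0")
        case True
        then have "1\<^sup>2 = (of_nat (Suc n) :: 'p mod_ring)" using w by simp
        then show ?thesis by blast
      next
        case False
        then show ?thesis using neg w by (metis of_nat_Suc add.commute)
      qed
    qed
    then have "\<exists>w. w\<^sup>2 = x" for x :: "'p mod_ring" using surj_of_nat_mod_ring[of x] by metis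
    then have "surj (\<lambda>w :: 'p mod_ring. w\<^sup>2)" unfolding surj_def by metis
    then have "inj (\<lambda>w :: 'p mod_ring. w\<^sup>2)" by (intro finite_UNIV_surj_inj) auto
    then have "(1 :: 'p mod_ring) = - 1" by (rule injD) simp
    then have "(1 :: 'p mod_ring) + 1 = 0" by (metis add.right_inverse)
    then show False using two by simp
  qed
  then obtain z :: "'p mod_ring" where z: "z \<noteq> 0" "\<nexists>w. w\<^sup>2 = z\<^sup>2 + 1" by blast
  define a where "a = z\<^sup>2 + 1"
  have a0: "a \<noteq> 0" using z(2) unfolding a_def by (metis power_zero_numeral)
  have a: "\<nexists>w. w\<^sup>2 = a" using z(2) by (simp add: a_def)
  have ns: "\<nexists>w. w\<^sup>2 = y\<^sup>2 / a" if "y \<noteq> 0" for y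
  proof
    assume "\<exists>w. w\<^sup>2 = y\<^sup>2 / a"
    then obtain w where w: "w\<^sup>2 = y\<^sup>2 / a" by blast
    then have "w \<noteq> 0" using that a0 by auto
    then have "(y / w)\<^sup>2 = a" using w a0 that by (simp add: power_divide)
    then show False using a by blast
  qed
  show thesis
  proof (rule that[of "1 / a" "z\<^sup>2 / a" "z / a"])
    show "\<nexists>w. w\<^sup>2 = 1 / a" using ns[of 1] by simp
    show "\<nexists>w. w\<^sup>2 = z\<^sup>2 / a" by (rule ns[OF z(1)])
    have "1 / a + z\<^sup>2 / a = a / a" by (simp only: a_def add_divide_distrib add.commute)
    then show "1 / a + z\<^sup>2 / a = 1" using a0 by simp
  qed (simp add: power_divide power2_eq_square)
qed

text \<open>In the field with three elements the only squares are 0 and 1.\<close>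

lemma mod_ring_three_nonzero:
  assumes two: "(2 :: 'p::prime_card mod_ring) \<noteq> 0" and "\<exists>z :: 'p::prime_card mod_ring. z\<^sup>2 = 2"
  shows "(3 :: 'p::prime_card mod_ring) \<noteq> 0"
proof
  assume 3: "(3 :: 'p mod_ring) = 0"
  have three: "(2 :: 'p mod_ring) + 1 = 0" "(4 :: 'p mod_ring) = 1"
  proof -
    show "(2 :: 'p mod_ring) + 1 = 0" using 3 by simp
    have "(4 :: 'p mod_ring) = 3 + 1" by simp
    then show "(4 :: 'p mod_ring) = 1" using 3 by simp
  qed
  have "of_nat n = (0 :: 'p mod_ring) \<or> of_nat n = (1 :: 'p mod_ring) \<or> of_nat n = (2 :: 'p mod_ring)" for n
    by (induction n) (use three in \<open>auto simp: add.commute\<close>)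
  then have all: "x = 0 \<or> x = 1 \<or> x = 2" for x :: "'p mod_ring" using surj_of_nat_mod_ring[of x] by metis
  obtain z :: "'p mod_ring" where z: "z\<^sup>2 = 2" using assms(2) by blast
  have "(1 :: 'p mod_ring) \<noteq> 2"
  proof
    assume "(1 :: 'p mod_ring) = 2"
    then have "(1 :: 'p mod_ring) = 1 + 1" by simp
    then show False by (metis add_cancel_right_right one_neq_zero)
  qed
  then show False using all[of z] z two three(2) by auto
qed

theorem theorem1p1:
  fixes p :: nat
  assumes "prime p" and "p > 2" and "CARD('p::prime_card) = p"
  shows "\<exists>S :: ('p ratfun poly5 \<times> 'p ratfun poly5) set.
    infinite S \<and>
    (\<forall>V\<in>S. quartic_del_pezzo V \<and> (\<forall>K. quadratic_extension K \<longrightarrow> points V K = {})) \<and>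
    pairwise (\<lambda>V W. \<not> isomorphic V W) S"
proof -
  have two: "(2 :: 'p mod_ring) \<noteq> 0"
  proof
    assume "(2 :: 'p mod_ring) = 0"
    then have "(of_nat 2 :: 'p mod_ring) = 0" by simp
    then have "CARD('p) dvd 2" by (simp add: of_nat_0_mod_ring_dvd)
    then show False using assms by (auto dest: dvd_imp_le)
  qed
  obtain c d \<kappa> :: "'p mod_ring" where cd: "\<nexists>z. z\<^sup>2 = c" "\<nexists>z. z\<^sup>2 = d" "c + d = 1" "c * d = \<kappa>\<^sup>2"
    using nonsquare_summands_mod_ring[OF two] .
  interpret surface_constants c d \<kappa> "CARD('p)"
  proof
    show "\<exists>z. z\<^sup>2 = a * b" if "\<nexists>z. z\<^sup>2 = a" "\<nexists>z. z\<^sup>2 = b" for a b :: "'p mod_ring"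
      using finite_field_nonsquare_mult[OF that] .
    show "(3 :: 'p mod_ring) \<noteq> 0" if "\<exists>z :: 'p mod_ring. z\<^sup>2 = 2"
      using mod_ring_three_nonzero[OF two that] .
  qed (use two cd assms in auto)
  show ?thesis by (rule infinite_family)
qed

end
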